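(* Let $M=M_0\times\mathbb{R}^2$, with Lorentzian metric $g=g_0+2\,du\,dv+\mathcal{H}(x,u)\,du^2$, be a generalized plane wave with $(M_0,g_0)$ a complete Riemannian manifold. If $\nabla^{M_0}\mathcal{H}$ grows at most linearly in $M_0$ along finite times, then $(M,g)$ is geodesically complete.
   Context: A Lorentzian manifold $(M,g)$ is a generalized plane wave (GPW) if there exists a connected $n$-dimensional Riemannian manifold $(M_0,g_0)$ such that $M=M_0\times\mathbb{R}^2$ and $$g=g_0+2\,du\,dv+\mathcal{H}(x,u)\,du^2,$$ where $x\in M_0$, $(u,v)$ are the natural coordinates of $\mathbb{R}^2$, and $\mathcal{H}:M_0\times\mathbb{R}\to\mathbb{R}$ is a smooth function with $\mathcal{H}\not\equiv 0$. A Riemannian or Lorentzian manifold is geodesically complete if each of its inextensible geodesics is defined on all of $\mathbb{R}$; for the Riemannian manifold $(M_0,g_0)$ this is equivalent to completeness of its distance $d$. $\nabla^{M_0}\mathcal{H}(x,u)$ denotes the $g_0$-gradient at $x$ of the function $\mathcal{H}(\cdot,u)$ on $M_0$. It grows at most linearly in $M_0$ along finite times if for each $T>0$ there exist a point $x_0\in M_0$ and constants $A_T,C_T>0$ such that $$\|\nabla^{M_0}\mathcal{H}(x,u)\|\ \le\ A_T\,d(x,x_0)+C_T\quad\text{for all }(x,u)\in M_0\times[-T,T],$$ where $\|\cdot\|$ is the norm of $g_0$ and $d$ is the distance induced by $g_0$. *)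

theory Defs
  imports "HOL-Analysis.Analysis"
begin

text \<open>
  Smooth manifolds are modelled on a Euclidean space \<open>'e\<close> (of dimension \<open>DIM('e)\<close>); the point set
  is a whole type \<open>'a\<close>, so that Hausdorff and second countable are class constraints on \<open>'a\<close>.
  All notions below are relative to an atlas, which need not be maximal.
\<close>

subsection \<open>Smooth maps between open subsets of normed spaces\<close>

text \<open>Class \<open>C\<^sup>k\<close> and \<open>C\<^sup>\<infinity>\<close>; meant for open \<open>S\<close>.\<close>

primrec Ck_on :: "nat \<Rightarrow> 'e::real_normed_vector set \<Rightarrow> ('e \<Rightarrow> 'f::real_normed_vector) \<Rightarrow> bool" where
  "Ck_on 0 S f \<longleftrightarrow> continuous_on S f"
| "Ck_on (Suc k) S f \<longleftrightarrow> (\<forall>x\<in>S. f differentiable (at x)) \<and>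
     (\<forall>v. Ck_on k S (\<lambda>x. frechet_derivative f (at x) v))"

definition smooth_on :: "'e::real_normed_vector set \<Rightarrow> ('e \<Rightarrow> 'f::real_normed_vector) \<Rightarrow> bool" where
  "smooth_on S f \<longleftrightarrow> (\<forall>k. Ck_on k S f)"

subsection \<open>Charts and atlases\<close>

text \<open>A chart is a pair of its domain and its coordinate map.\<close>

type_synonym ('a, 'e) chart = "'a set \<times> ('a \<Rightarrow> 'e)"

definition chart_inv :: "('a, 'e) chart \<Rightarrow> 'e \<Rightarrow> 'a" where
  "chart_inv c = inv_into (fst c) (snd c)"

definition is_chart :: "('a::topological_space, 'e::euclidean_space) chart \<Rightarrow> bool" where
  "is_chart c \<longleftrightarrow> open (fst c) \<and> open (snd c ` fst c) \<and>
     homeomorphism (fst c) (snd c ` fst c) (snd c) (chart_inv c)"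

definition smooth_atlas :: "('a::topological_space, 'e::euclidean_space) chart set \<Rightarrow> bool" where
  "smooth_atlas A \<longleftrightarrow> (\<forall>c\<in>A. is_chart c) \<and> (\<Union>c\<in>A. fst c) = UNIV \<and>
     (\<forall>c\<in>A. \<forall>c'\<in>A. smooth_on (snd c ` (fst c \<inter> fst c')) (snd c' \<circ> chart_inv c))"

definition prod_chart :: "('a, 'e) chart \<Rightarrow> ('b, 'f) chart \<Rightarrow> ('a \<times> 'b, 'e \<times> 'f) chart" where
  "prod_chart c d = (fst c \<times> fst d, map_prod (snd c) (snd d))"

definition prod_atlas ::
  "('a, 'e) chart set \<Rightarrow> ('b, 'f) chart set \<Rightarrow> ('a \<times> 'b, 'e \<times> 'f) chart set" where
  "prod_atlas A B = {prod_chart c d | c d. c \<in> A \<and> d \<in> B}"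

definition std_atlas :: "('e::euclidean_space, 'e) chart set" where
  "std_atlas = {(UNIV, id)}"

subsection \<open>Smooth functions and tangent vectors\<close>

definition smooth_fun_on ::
  "('a::topological_space, 'e::euclidean_space) chart set \<Rightarrow> 'a set \<Rightarrow> ('a \<Rightarrow> real) \<Rightarrow> bool" where
  "smooth_fun_on A W f \<longleftrightarrow> (\<forall>c\<in>A. smooth_on (snd c ` (fst c \<inter> W)) (f \<circ> chart_inv c))"

definition smooth_near ::
  "('a::topological_space, 'e::euclidean_space) chart set \<Rightarrow> 'a \<Rightarrow> ('a \<Rightarrow> real) \<Rightarrow> bool" where
  "smooth_near A p f \<longleftrightarrow> (\<exists>W. open W \<and> p \<in> W \<and> smooth_fun_on A W f)"

text \<open>
  A tangent vector at \<open>p\<close> acts as a derivation on the functions that are smooth near \<open>p\<close>; to make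
  it a well-determined element of the function type it is set to \<open>0\<close> on all other functions.
  The differential of a real function \<open>f\<close> is thus \<open>df(V) = V f\<close>.
\<close>

type_synonym 'a tvec = "('a \<Rightarrow> real) \<Rightarrow> real"

text \<open>The vector \<open>\<Sum>\<^sub>i e\<^sup>i \<partial>\<^sub>i\<close> at \<open>p\<close>, where \<open>\<partial>\<^sub>i\<close> are the coordinate vectors of the chart \<open>c\<close>.\<close>

definition coord_vec ::
  "('a::topological_space, 'e::euclidean_space) chart set \<Rightarrow> ('a, 'e) chart \<Rightarrow> 'a \<Rightarrow> 'e \<Rightarrow> 'a tvec" where
  "coord_vec A c p e = (\<lambda>f. if smooth_near A p f
     then frechet_derivative (f \<circ> chart_inv c) (at (snd c p)) e else 0)"

definition tangent_space ::
  "('a::topological_space, 'e::euclidean_space) chart set \<Rightarrow> 'a \<Rightarrow> 'a tvec set" where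
  "tangent_space A p = {coord_vec A c p e | c e. c \<in> A \<and> p \<in> fst c}"

text \<open>The differential at a point of a smooth map \<open>F\<close> whose target carries the atlas \<open>B\<close>.\<close>

definition pushforward ::
  "('b::topological_space, 'f::euclidean_space) chart set \<Rightarrow> ('a \<Rightarrow> 'b) \<Rightarrow> 'a \<Rightarrow> 'a tvec \<Rightarrow> 'b tvec" where
  "pushforward B F p V = (\<lambda>f. if smooth_near B (F p) f then V (f \<circ> F) else 0)"

definition velocity ::
  "('a::topological_space, 'e::euclidean_space) chart set \<Rightarrow> (real \<Rightarrow> 'a) \<Rightarrow> real \<Rightarrow> 'a tvec" where
  "velocity A \<gamma> t = (\<lambda>f. if smooth_near A (\<gamma> t) f then deriv (f \<circ> \<gamma>) t else 0)"

subsection \<open>Semi-Riemannian, Riemannian and Lorentzian metrics\<close>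

type_synonym 'a tensor2 = "'a \<Rightarrow> 'a tvec \<Rightarrow> 'a tvec \<Rightarrow> real"

text \<open>The components of \<open>g\<close> in the chart \<open>c\<close>, as a function of the coordinates \<open>y\<close>.\<close>

definition metric_coord ::
  "('a::topological_space, 'e::euclidean_space) chart set \<Rightarrow> 'a tensor2 \<Rightarrow> ('a, 'e) chart
    \<Rightarrow> 'e \<Rightarrow> 'e \<Rightarrow> 'e \<Rightarrow> real" where
  "metric_coord A g c y v w = g (chart_inv c y)
     (coord_vec A c (chart_inv c y) v) (coord_vec A c (chart_inv c y) w)"

definition semi_riemannian_manifold ::
  "('a::topological_space, 'e::euclidean_space) chart set \<Rightarrow> 'a tensor2 \<Rightarrow> bool" where
  "semi_riemannian_manifold A g \<longleftrightarrow> smooth_atlas A \<and>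
     (\<forall>p. \<forall>V\<in>tangent_space A p. \<forall>W\<in>tangent_space A p. g p V W = g p W V) \<and>
     (\<forall>p. \<forall>V\<in>tangent_space A p. \<forall>V'\<in>tangent_space A p. \<forall>W\<in>tangent_space A p. \<forall>a b.
        g p (\<lambda>f. a * V f + b * V' f) W = a * g p V W + b * g p V' W) \<and>
     (\<forall>p. \<forall>V\<in>tangent_space A p. (\<forall>W\<in>tangent_space A p. g p V W = 0) \<longrightarrow> V = (\<lambda>f. 0)) \<and>
     (\<forall>c\<in>A. \<forall>v w. smooth_on (snd c ` fst c) (\<lambda>y. metric_coord A g c y v w))"

definition riemannian_manifold ::
  "('a::topological_space, 'e::euclidean_space) chart set \<Rightarrow> 'a tensor2 \<Rightarrow> bool" where
  "riemannian_manifold A g \<longleftrightarrow> semi_riemannian_manifold A g \<and>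
     (\<forall>p. \<forall>V\<in>tangent_space A p. V \<noteq> (\<lambda>f. 0) \<longrightarrow> g p V V > 0)"

text \<open>
  Signature \<open>(-,+,\<dots>,+)\<close>: at each point there is a timelike vector whose orthogonal complement
  is positive definite.
\<close>

definition lorentzian_manifold ::
  "('a::topological_space, 'e::euclidean_space) chart set \<Rightarrow> 'a tensor2 \<Rightarrow> bool" where
  "lorentzian_manifold A g \<longleftrightarrow> semi_riemannian_manifold A g \<and> DIM('e) \<ge> 2 \<and>
     (\<forall>p. \<exists>Z\<in>tangent_space A p. g p Z Z < 0 \<and>
        (\<forall>V\<in>tangent_space A p. g p Z V = 0 \<and> V \<noteq> (\<lambda>f. 0) \<longrightarrow> g p V V > 0))"

definition tnorm :: "'a tensor2 \<Rightarrow> 'a \<Rightarrow> 'a tvec \<Rightarrow> real" where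
  "tnorm g p V = sqrt (g p V V)"

definition gradient ::
  "('a::topological_space, 'e::euclidean_space) chart set \<Rightarrow> 'a tensor2 \<Rightarrow> ('a \<Rightarrow> real) \<Rightarrow> 'a \<Rightarrow> 'a tvec" where
  "gradient A g f p =
     (THE V. V \<in> tangent_space A p \<and> (\<forall>W\<in>tangent_space A p. g p V W = W f))"

subsection \<open>Geodesics\<close>

text \<open>
  \<open>christoffel A g c y v w\<close> is the vector with components \<open>\<Gamma>\<^sup>k\<^sub>i\<^sub>j v\<^sup>i w\<^sup>j\<close> of the Levi-Civita
  connection: \<open>g\<^sub>k\<^sub>l \<Gamma>\<^sup>k\<^sub>i\<^sub>j = (\<partial>\<^sub>i g\<^sub>j\<^sub>l + \<partial>\<^sub>j g\<^sub>i\<^sub>l - \<partial>\<^sub>l g\<^sub>i\<^sub>j) / 2\<close>, contracted with \<open>v\<close>, \<open>w\<close>, \<open>e\<close>.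
\<close>

definition christoffel ::
  "('a::topological_space, 'e::euclidean_space) chart set \<Rightarrow> 'a tensor2 \<Rightarrow> ('a, 'e) chart
    \<Rightarrow> 'e \<Rightarrow> 'e \<Rightarrow> 'e \<Rightarrow> 'e" where
  "christoffel A g c y v w = (THE z. \<forall>e. metric_coord A g c y z e =
     (frechet_derivative (\<lambda>x. metric_coord A g c x w e) (at y) v
      + frechet_derivative (\<lambda>x. metric_coord A g c x v e) (at y) w
      - frechet_derivative (\<lambda>x. metric_coord A g c x v w) (at y) e) / 2)"

text \<open>
  Curves on an open interval \<open>I\<close>, twice differentiable in every chart, with vanishing covariant
  acceleration. (Such curves are automatically smooth.) Values of \<open>\<gamma>\<close> outside \<open>I\<close> are irrelevant.
\<close>

definition geodesic ::
  "('a::topological_space, 'e::euclidean_space) chart set \<Rightarrow> 'a tensor2 \<Rightarrow> real set \<Rightarrow> (real \<Rightarrow> 'a) \<Rightarrow> bool" where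
  "geodesic A g I \<gamma> \<longleftrightarrow> open I \<and> is_interval I \<and> I \<noteq> {} \<and> continuous_on I \<gamma> \<and>
     (\<forall>c\<in>A. \<exists>x' x''. \<forall>t\<in>I. \<gamma> t \<in> fst c \<longrightarrow>
        ((snd c \<circ> \<gamma>) has_vector_derivative x' t) (at t) \<and>
        (x' has_vector_derivative x'' t) (at t) \<and>
        x'' t + christoffel A g c (snd c (\<gamma> t)) (x' t) (x' t) = 0)"

definition inextensible_geodesic ::
  "('a::topological_space, 'e::euclidean_space) chart set \<Rightarrow> 'a tensor2 \<Rightarrow> real set \<Rightarrow> (real \<Rightarrow> 'a) \<Rightarrow> bool" where
  "inextensible_geodesic A g I \<gamma> \<longleftrightarrow> geodesic A g I \<gamma> \<and>
     (\<forall>J \<delta>. geodesic A g J \<delta> \<and> I \<subseteq> J \<and> (\<forall>t\<in>I. \<delta> t = \<gamma> t) \<longrightarrow> J = I)"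

definition geodesically_complete ::
  "('a::topological_space, 'e::euclidean_space) chart set \<Rightarrow> 'a tensor2 \<Rightarrow> bool" where
  "geodesically_complete A g \<longleftrightarrow> (\<forall>I \<gamma>. inextensible_geodesic A g I \<gamma> \<longrightarrow> I = UNIV)"

subsection \<open>Riemannian distance\<close>

text \<open>
  The pieces are \<open>C\<^sup>1\<close> up to their end points (one-sided derivatives), so the speed of a piecewise
  \<open>C\<^sup>1\<close> curve is bounded and integrable. \<^const>\<open>piecewise_C1_differentiable_on\<close> would not ensure this,
  and a non-integrable speed would get length \<open>0\<close>.
\<close>

definition C1_curve ::
  "('a::topological_space, 'e::euclidean_space) chart set \<Rightarrow> (real \<Rightarrow> 'a) \<Rightarrow> real \<Rightarrow> real \<Rightarrow> bool" where
  "C1_curve A \<gamma> a b \<longleftrightarrow> continuous_on {a..b} \<gamma> \<and>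
     (\<forall>c\<in>A. \<exists>x'. continuous_on {t\<in>{a..b}. \<gamma> t \<in> fst c} x' \<and>
        (\<forall>t\<in>{a..b}. \<gamma> t \<in> fst c \<longrightarrow>
           ((snd c \<circ> \<gamma>) has_vector_derivative x' t) (at t within {a..b})))"

definition piecewise_C1_curve ::
  "('a::topological_space, 'e::euclidean_space) chart set \<Rightarrow> (real \<Rightarrow> 'a) \<Rightarrow> bool" where
  "piecewise_C1_curve A \<gamma> \<longleftrightarrow> (\<exists>S. finite S \<and> {0, 1} \<subseteq> S \<and> S \<subseteq> {0..1} \<and>
     (\<forall>a\<in>S. \<forall>b\<in>S. a < b \<and> S \<inter> {a<..<b} = {} \<longrightarrow> C1_curve A \<gamma> a b))"

definition curve_length ::
  "('a::topological_space, 'e::euclidean_space) chart set \<Rightarrow> 'a tensor2 \<Rightarrow> (real \<Rightarrow> 'a) \<Rightarrow> real" where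
  "curve_length A g \<gamma> = integral {0..1} (\<lambda>t. tnorm g (\<gamma> t) (velocity A \<gamma> t))"

definition riem_dist ::
  "('a::topological_space, 'e::euclidean_space) chart set \<Rightarrow> 'a tensor2 \<Rightarrow> 'a \<Rightarrow> 'a \<Rightarrow> real" where
  "riem_dist A g p q =
     Inf {curve_length A g \<gamma> | \<gamma>. piecewise_C1_curve A \<gamma> \<and> \<gamma> 0 = p \<and> \<gamma> 1 = q}"

definition complete_riemannian_manifold ::
  "('a::topological_space, 'e::euclidean_space) chart set \<Rightarrow> 'a tensor2 \<Rightarrow> bool" where
  "complete_riemannian_manifold A g \<longleftrightarrow>
     riemannian_manifold A g \<and> Metric_space.mcomplete UNIV (riem_dist A g)"

subsection \<open>Generalized plane waves\<close>

text \<open>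
  The manifold \<open>M\<^sub>0 \<times> \<real>\<^sup>2\<close>, with points \<open>(x, u, v)\<close>, and the metric
  \<open>g\<^sub>0 + 2 du dv + \<H>(x,u) du\<^sup>2\<close>, where \<open>2 du dv = du \<otimes> dv + dv \<otimes> du\<close> and \<open>g\<^sub>0\<close> is pulled back
  along the projection to \<open>M\<^sub>0\<close>.
\<close>

definition gpw_atlas ::
  "('a::topological_space, 'e::euclidean_space) chart set
    \<Rightarrow> ('a \<times> real \<times> real, 'e \<times> real \<times> real) chart set" where
  "gpw_atlas A = prod_atlas A std_atlas"

definition u_coord :: "'a \<times> real \<times> real \<Rightarrow> real" where
  "u_coord = (\<lambda>(x, u, v). u)"

definition v_coord :: "'a \<times> real \<times> real \<Rightarrow> real" where
  "v_coord = (\<lambda>(x, u, v). v)"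

definition gpw_metric ::
  "('a::topological_space, 'e::euclidean_space) chart set \<Rightarrow> 'a tensor2 \<Rightarrow> ('a \<Rightarrow> real \<Rightarrow> real)
    \<Rightarrow> ('a \<times> real \<times> real) tensor2" where
  "gpw_metric A g\<^sub>0 H p V W =
     g\<^sub>0 (fst p) (pushforward A fst p V) (pushforward A fst p W)
     + (V u_coord * W v_coord + V v_coord * W u_coord)
     + H (fst p) (u_coord p) * V u_coord * W u_coord"

definition generalized_plane_wave ::
  "('a::topological_space, 'e::euclidean_space) chart set \<Rightarrow> 'a tensor2 \<Rightarrow> ('a \<Rightarrow> real \<Rightarrow> real) \<Rightarrow> bool" where
  "generalized_plane_wave A g\<^sub>0 H \<longleftrightarrow>
     riemannian_manifold A g\<^sub>0 \<and> connected (UNIV :: 'a set) \<and>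
     smooth_fun_on (prod_atlas A std_atlas) UNIV (\<lambda>(x, u). H x u) \<and>
     (\<exists>x u. H x u \<noteq> 0) \<and>
     lorentzian_manifold (gpw_atlas A) (gpw_metric A g\<^sub>0 H)"

definition gradient_grows_at_most_linearly ::
  "('a::topological_space, 'e::euclidean_space) chart set \<Rightarrow> 'a tensor2 \<Rightarrow> ('a \<Rightarrow> real \<Rightarrow> real) \<Rightarrow> bool" where
  "gradient_grows_at_most_linearly A g\<^sub>0 H \<longleftrightarrow>
     (\<forall>T>0. \<exists>x\<^sub>0. \<exists>A\<^sub>T>0. \<exists>C\<^sub>T>0. \<forall>x. \<forall>u\<in>{-T..T}.
        tnorm g\<^sub>0 x (gradient A g\<^sub>0 (\<lambda>y. H y u) x) \<le> A\<^sub>T * riem_dist A g\<^sub>0 x x\<^sub>0 + C\<^sub>T)"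

end

theory Submission
  imports Defs
begin

text \<open>
  In coordinates \<open>(x, u, v)\<close> the geodesic equations are \<open>u'' = 0\<close>, \<open>D x'/dt = (u'\<^sup>2 / 2) \<nabla>\<H>(\<cdot>, u)\<close> and a
  linear equation expressing \<open>v''\<close> through \<open>x\<close>, \<open>u\<close> and their velocities. So \<open>u\<close> is affine, and along a
  geodesic on a bounded interval the growth condition bounds the derivative of \<open>|x'|\<^sup>2\<close> by a multiple of
  \<open>(d(x, x\<^sub>0) + 1) |x'|\<close>. As \<open>d(x, x\<^sub>0)\<close> grows at most with speed \<open>|x'|\<close>, Gronwall's inequality bounds
  \<open>|x'|\<close>. Completeness of \<open>M\<^sub>0\<close> then makes \<open>x\<close> converge at a finite end point, after which the equation
  for \<open>v\<close> bounds \<open>v'\<close> and \<open>v\<close> converges too. A geodesic that converges with bounded coordinate velocity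
  can be continued by solving the geodesic equation in a chart around the limit; the transformation
  law of the Euler-Lagrange expression shows that the result is a geodesic in every other chart.
\<close>

section \<open>Smooth functions on open sets\<close>

text \<open>As g is indefinite, the conserved square of the velocity of a geodesic does not bound
  the velocity. What helps is the triangular form of the equations: \<open>u\<close> is determined
  alone, the equation for \<open>x\<close> contains no \<open>v\<close>, and \<open>v''\<close>
  contains neither \<open>v\<close> nor \<open>v'\<close>. Bounds are obtained in this order, each
  from the previous ones, and the positive quantity that drives them is the energy of the projection
  to \<open>M0\<close>. Two obstacles shape the rest. Completeness speaks of an infimum of lengths,
  while continuation needs convergence in the manifold topology; the link is a lower bound for the
  length of every curve that leaves a coordinate ball. Moreover \<open>geodesic\<close> quantifies
  over all charts of an arbitrary atlas and asks for one pair of derivatives on the whole interval;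
  so geodesics are handled through a local condition in a single chart, and tangent vectors, which
  are functionals, are replaced by their coordinates.\<close>

abbreviation fd :: "('e::real_normed_vector \<Rightarrow> 'f::real_normed_vector) \<Rightarrow> 'e \<Rightarrow> 'e \<Rightarrow> 'f" where
  "fd f x \<equiv> frechet_derivative f (at x)"

lemma fd_eqI: "(f has_derivative f') (at x) \<Longrightarrow> fd f x = f'"
  using frechet_derivative_at by metis

text \<open>As \<open>S\<close> is open, equality on \<open>S\<close> is equality near each of its
  points, so the derivatives agree on \<open>S\<close> too and the induction continues.\<close>

lemma Ck_on_cong:
  assumes "open S" "\<And>x. x \<in> S \<Longrightarrow> f x = g x" "Ck_on k S f"
  shows "Ck_on k S g"
  using assms(2,3)
proof (induction k arbitrary: f g)
  case 0
  then show ?case by (simp cong: continuous_on_cong)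
next
  case (Suc k)
  have D: "(g has_derivative fd f x) (at x)" if "x \<in> S" for x
    using Suc.prems that assms(1) frechet_derivative_works has_derivative_transform_within_open
    by (metis Ck_on.simps(2))
  show ?case
    using Suc.prems Suc.IH[of "\<lambda>x. fd f x v" "\<lambda>x. fd g x v" for v]
    by (auto simp: fd_eqI[OF D] intro: differentiableI D)
qed

lemma Ck_on_subset: "Ck_on k S f \<Longrightarrow> T \<subseteq> S \<Longrightarrow> Ck_on k T f"
  by (induction k arbitrary: f) (auto intro: continuous_on_subset)

lemma Ck_on_const: "Ck_on k S (\<lambda>x. c)"
  by (induction k arbitrary: c) auto

lemma Ck_on_bounded_linear:
  assumes "bounded_linear L" shows "Ck_on k S L"
proof (cases k)
  case 0
  then show ?thesis using assms by (simp add: linear_continuous_on)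
next
  case (Suc j)
  have "fd L x = L" for x
    using assms by (intro fd_eqI bounded_linear_imp_has_derivative)
  then show ?thesis
    using assms Suc by (auto simp: Ck_on_const bounded_linear_imp_differentiable)
qed

lemma Ck_on_bounded_linear_compose:
  assumes "bounded_linear L" "open S" "Ck_on k S f" shows "Ck_on k S (\<lambda>x. L (f x))"
  using assms(3)
proof (induction k arbitrary: f)
  case 0
  then show ?case using assms(1) by (auto intro: bounded_linear.continuous_on)
next
  case (Suc k)
  have D: "((\<lambda>x. L (f x)) has_derivative (\<lambda>v. L (fd f x v))) (at x)" if "x \<in> S" for x
    using Suc.prems that assms(1)
    by (auto intro: bounded_linear.has_derivative simp: frechet_derivative_works)
  have "Ck_on k S (\<lambda>x. fd (\<lambda>x. L (f x)) x v)" for v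
    by (rule Ck_on_cong[OF assms(2), of "\<lambda>x. L (fd f x v)"])
      (use Suc in \<open>auto simp: fd_eqI[OF D]\<close>)
  then show ?case using D by (auto intro: differentiableI)
qed

text \<open>The inner maps that occur later are projections of a product to a factor and slices
  \<open>y \<mapsto> (y, u)\<close>. Their derivative is constant, so each step of the induction
  only replaces \<open>f\<close> by one of its directional derivatives.\<close>

lemma Ck_on_compose_affine:
  assumes "bounded_linear L" "open T" "\<And>x. x \<in> T \<Longrightarrow> a + L x \<in> S" "Ck_on k S f"
  shows "Ck_on k T (\<lambda>x. f (a + L x))"
  using assms(4)
proof (induction k arbitrary: f)
  case 0
  have "continuous_on T (\<lambda>x. a + L x)"
    using assms(1) by (intro continuous_intros linear_continuous_on)
  then show ?case using 0 assms(3) by (auto intro: continuous_on_compose2)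
next
  case (Suc k)
  have D: "((\<lambda>x. f (a + L x)) has_derivative (\<lambda>v. fd f (a + L x) (L v))) (at x)" if "x \<in> T" for x
  proof -
    have 1: "((\<lambda>x. a + L x) has_derivative L) (at x)"
      using bounded_linear_imp_has_derivative[OF assms(1)] by (auto intro!: derivative_eq_intros)
    have "(f has_derivative fd f (a + L x)) (at (a + L x))"
      using Suc.prems assms(3)[OF that] by (auto simp: frechet_derivative_works)
    from has_derivative_compose[OF 1 this] show ?thesis .
  qed
  have "Ck_on k T (\<lambda>x. fd (\<lambda>x. f (a + L x)) x v)" for v
    by (rule Ck_on_cong[OF assms(2), of "\<lambda>x. fd f (a + L x) (L v)"])
      (use Suc in \<open>auto simp: fd_eqI[OF D]\<close>)
  then show ?case using D by (auto intro: differentiableI)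
qed

lemma smooth_on_cong:
  "open S \<Longrightarrow> (\<And>x. x \<in> S \<Longrightarrow> f x = g x) \<Longrightarrow> smooth_on S f \<Longrightarrow> smooth_on S g"
  unfolding smooth_on_def using Ck_on_cong by blast

lemma smooth_on_subset: "smooth_on S f \<Longrightarrow> T \<subseteq> S \<Longrightarrow> smooth_on T f"
  unfolding smooth_on_def using Ck_on_subset by blast

lemma smooth_on_bounded_linear_compose:
  "bounded_linear L \<Longrightarrow> open S \<Longrightarrow> smooth_on S f \<Longrightarrow> smooth_on S (\<lambda>x. L (f x))"
  unfolding smooth_on_def using Ck_on_bounded_linear_compose by blast

lemma smooth_on_compose_affine:
  "bounded_linear L \<Longrightarrow> open T \<Longrightarrow> (\<And>x. x \<in> T \<Longrightarrow> a + L x \<in> S) \<Longrightarrow> smooth_on S f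
    \<Longrightarrow> smooth_on T (\<lambda>x. f (a + L x))"
  unfolding smooth_on_def using Ck_on_compose_affine by blast

lemma smooth_on_bounded_linear: "bounded_linear L \<Longrightarrow> smooth_on S L"
  unfolding smooth_on_def using Ck_on_bounded_linear by blast

lemma smooth_on_fd: "smooth_on S f \<Longrightarrow> smooth_on S (\<lambda>x. fd f x v)"
  unfolding smooth_on_def using Ck_on.simps(2) by blast

lemma smooth_on_has_derivative:
  "smooth_on S f \<Longrightarrow> x \<in> S \<Longrightarrow> (f has_derivative fd f x) (at x)"
  unfolding smooth_on_def by (metis Ck_on.simps(2) frechet_derivative_works)

lemma smooth_on_continuous_on: "smooth_on S f \<Longrightarrow> continuous_on S f"
  unfolding smooth_on_def using Ck_on.simps(1) by blast

lemma fd_linear: "smooth_on S f \<Longrightarrow> x \<in> S \<Longrightarrow> linear (fd f x)"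
  using smooth_on_has_derivative has_derivative_linear by blast

lemma linear_euclidean_representation:
  fixes f :: "'e::euclidean_space \<Rightarrow> 'f::real_vector"
  assumes "linear f"
  shows "f v = (\<Sum>b\<in>Basis. (v \<bullet> b) *\<^sub>R f b)"
proof -
  have "f v = f (\<Sum>b\<in>Basis. (v \<bullet> b) *\<^sub>R b)" by (simp add: euclidean_representation)
  also have "\<dots> = (\<Sum>b\<in>Basis. (v \<bullet> b) *\<^sub>R f b)"
    using assms by (simp add: linear_sum linear_scale)
  finally show ?thesis .
qed

text \<open>Smoothness only gives continuity of the derivative in a fixed direction. Expanding the
  moving direction in the basis turns the joint dependence into a finite sum of products.\<close>

lemma continuous_on_fd:
  fixes f :: "'e::euclidean_space \<Rightarrow> 'f::real_normed_vector"
  assumes "smooth_on S f" "continuous_on T y" "continuous_on T v" "\<And>t. t \<in> T \<Longrightarrow> y t \<in> S"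
  shows "continuous_on T (\<lambda>t. fd f (y t) (v t))"
proof -
  have "continuous_on T (\<lambda>t. fd f (y t) b)" for b
    using continuous_on_compose2[OF smooth_on_continuous_on[OF smooth_on_fd[OF assms(1)]] assms(2)] assms(4)
    by blast
  then have "continuous_on T (\<lambda>t. \<Sum>b\<in>Basis. (v t \<bullet> b) *\<^sub>R fd f (y t) b)"
    using assms(3) by (intro continuous_intros)
  then show ?thesis
    using linear_euclidean_representation[OF fd_linear[OF assms(1) assms(4)]]
    by (subst continuous_on_cong[OF refl]) auto
qed

section \<open>Symmetry of second derivatives\<close>

lemma mixed_difference_mvt:
  fixes f :: "'e::real_normed_vector \<Rightarrow> real"
  assumes sm: "smooth_on (ball x r) f" and h: "h > 0" "h * (norm v + norm w) < r"
  obtains z where "dist x z \<le> h * (norm v + norm w)"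
    "f (x + h *\<^sub>R v + h *\<^sub>R w) - f (x + h *\<^sub>R v) - f (x + h *\<^sub>R w) + f x = h * h * fd (\<lambda>y. fd f y v) z w"
proof -
  have bnd: "dist x (x + a *\<^sub>R v + b *\<^sub>R w) \<le> h * (norm v + norm w)" if "0 \<le> a" "a \<le> h" "0 \<le> b" "b \<le> h" for a b
  proof -
    have "x - (x + a *\<^sub>R v + b *\<^sub>R w) = - (a *\<^sub>R v + b *\<^sub>R w)" by simp
    then have "dist x (x + a *\<^sub>R v + b *\<^sub>R w) = norm (a *\<^sub>R v + b *\<^sub>R w)"
      by (simp only: dist_norm norm_minus_cancel)
    also have "\<dots> \<le> a * norm v + b * norm w" using norm_triangle_ineq[of "a *\<^sub>R v" "b *\<^sub>R w"] that by simp
    also have "\<dots> \<le> h * norm v + h * norm w" using that by (intro add_mono mult_right_mono) auto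
    finally show ?thesis by (simp add: algebra_simps)
  qed
  have inb: "x + a *\<^sub>R v + b *\<^sub>R w \<in> ball x r" if "0 \<le> a" "a \<le> h" "0 \<le> b" "b \<le> h" for a b
    using bnd[OF that] h by (simp only: mem_ball)
  have D1: "((\<lambda>a. f (x + a *\<^sub>R v + b *\<^sub>R w)) has_real_derivative fd f (x + a *\<^sub>R v + b *\<^sub>R w) v) (at a)"
    if "0 \<le> a" "a \<le> h" "0 \<le> b" "b \<le> h" for a b
  proof -
    have 1: "((\<lambda>a. x + a *\<^sub>R v + b *\<^sub>R w) has_derivative (\<lambda>t. t *\<^sub>R v)) (at a)"
      by (auto intro!: derivative_eq_intros)
    note 2 = smooth_on_has_derivative[OF sm inb[OF that]]
    show ?thesis
      using has_derivative_compose[OF 1 2] linear_scale[OF has_derivative_linear[OF 2]]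
      by (simp add: has_field_derivative_def mult_commute_abs)
  qed
  have D2: "((\<lambda>b. fd f (x + a *\<^sub>R v + b *\<^sub>R w) v) has_real_derivative fd (\<lambda>y. fd f y v) (x + a *\<^sub>R v + b *\<^sub>R w) w) (at b)"
    if "0 \<le> a" "a \<le> h" "0 \<le> b" "b \<le> h" for a b
  proof -
    have 1: "((\<lambda>b. x + a *\<^sub>R v + b *\<^sub>R w) has_derivative (\<lambda>t. t *\<^sub>R w)) (at b)"
      by (auto intro!: derivative_eq_intros)
    note 2 = smooth_on_has_derivative[OF smooth_on_fd[OF sm, of v] inb[OF that]]
    show ?thesis
      using has_derivative_compose[OF 1 2] linear_scale[OF has_derivative_linear[OF 2]]
      by (simp add: has_field_derivative_def mult_commute_abs)
  qed
  have "\<exists>a>0. a < h \<and> (f (x + h *\<^sub>R v + h *\<^sub>R w) - f (x + h *\<^sub>R v + 0 *\<^sub>R w)) - (f (x + 0 *\<^sub>R v + h *\<^sub>R w) - f (x + 0 *\<^sub>R v + 0 *\<^sub>R w))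
      = (h - 0) * (fd f (x + a *\<^sub>R v + h *\<^sub>R w) v - fd f (x + a *\<^sub>R v + 0 *\<^sub>R w) v)"
    using h by (intro MVT2[where f = "\<lambda>a. f (x + a *\<^sub>R v + h *\<^sub>R w) - f (x + a *\<^sub>R v + 0 *\<^sub>R w)"] DERIV_diff D1) auto
  then obtain a where a: "0 < a" "a < h" and e1: "f (x + h *\<^sub>R v + h *\<^sub>R w) - f (x + h *\<^sub>R v) - f (x + h *\<^sub>R w) + f x
      = h * (fd f (x + a *\<^sub>R v + h *\<^sub>R w) v - fd f (x + a *\<^sub>R v + 0 *\<^sub>R w) v)"
    by (auto simp: algebra_simps)
  have "\<exists>b>0. b < h \<and> fd f (x + a *\<^sub>R v + h *\<^sub>R w) v - fd f (x + a *\<^sub>R v + 0 *\<^sub>R w) v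
      = (h - 0) * fd (\<lambda>y. fd f y v) (x + a *\<^sub>R v + b *\<^sub>R w) w"
    using h a by (intro MVT2[where f = "\<lambda>b. fd f (x + a *\<^sub>R v + b *\<^sub>R w) v"] D2) auto
  then obtain b where b: "0 < b" "b < h" and e2: "fd f (x + a *\<^sub>R v + h *\<^sub>R w) v - fd f (x + a *\<^sub>R v + 0 *\<^sub>R w) v
      = h * fd (\<lambda>y. fd f y v) (x + a *\<^sub>R v + b *\<^sub>R w) w" by auto
  show thesis
    by (rule that[of "x + a *\<^sub>R v + b *\<^sub>R w"]) (use a b e1 e2 bnd in auto)
qed

text \<open>The mixed second difference is symmetric in \<open>v\<close> and \<open>w\<close>.
  Applying the mean value theorem in one direction and then in the other represents it by either
  mixed derivative at some nearby point, and continuity brings both points to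
  \<open>x\<close>.\<close>

lemma second_fd_commute_real:
  fixes f :: "'e::real_normed_vector \<Rightarrow> real"
  assumes "open S" "smooth_on S f" "x \<in> S"
  shows "fd (\<lambda>y. fd f y v) x w = fd (\<lambda>y. fd f y w) x v"
proof (rule ccontr)
  let ?p = "\<lambda>z. fd (\<lambda>y. fd f y v) z w" and ?q = "\<lambda>z. fd (\<lambda>y. fd f y w) z v"
  assume ne: "?p x \<noteq> ?q x"
  \<comment> \<open>Half the gap: values closer than \<open>e\<close> to the two sides cannot
    coincide.\<close>
  define e where "e = \<bar>?p x - ?q x\<bar> / 2"
  have e: "e > 0" using ne by (simp add: e_def)
  obtain r where r: "r > 0" "ball x r \<subseteq> S" using assms by (meson open_contains_ball)
  have cp: "isCont ?p x" "isCont ?q x"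
    using smooth_on_continuous_on[OF smooth_on_fd[OF smooth_on_fd[OF assms(2)]]] assms
    by (metis continuous_on_eq_continuous_at)+
  obtain d1 where d1: "d1 > 0" "\<And>z. dist z x < d1 \<Longrightarrow> dist (?p z) (?p x) < e"
    using cp(1) e unfolding continuous_at_eps_delta by metis
  obtain d2 where d2: "d2 > 0" "\<And>z. dist z x < d2 \<Longrightarrow> dist (?q z) (?q x) < e"
    using cp(2) e unfolding continuous_at_eps_delta by metis
  define m where "m = min r (min d1 d2)"
  \<comment> \<open>This step keeps both intermediate points within distance less than
    \<open>m\<close> of \<open>x\<close>; the summand 1 covers the case that \<open>v\<close> and
    \<open>w\<close> both vanish.\<close>
  define h where "h = m / (norm v + norm w + 1)"
  have m: "m > 0" using r d1 d2 by (simp add: m_def)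
  have pos: "norm v + norm w + 1 > 0" by (smt (verit) norm_ge_zero)
  have h: "h > 0" using m pos by (simp add: h_def)
  have hm: "h * (norm v + norm w) < m"
  proof -
    have "h * (norm v + norm w + 1) = m" using pos by (simp add: h_def)
    then show ?thesis using h by (simp add: algebra_simps)
  qed
  have sm: "smooth_on (ball x r) f" using assms(2) r(2) smooth_on_subset by blast
  obtain z1 where z1: "dist x z1 \<le> h * (norm v + norm w)"
    "f (x + h *\<^sub>R v + h *\<^sub>R w) - f (x + h *\<^sub>R v) - f (x + h *\<^sub>R w) + f x = h * h * ?p z1"
    using mixed_difference_mvt[OF sm h, of v w] hm m_def by (smt (verit) min_less_iff_conj)
  obtain z2 where z2: "dist x z2 \<le> h * (norm w + norm v)"
    "f (x + h *\<^sub>R w + h *\<^sub>R v) - f (x + h *\<^sub>R w) - f (x + h *\<^sub>R v) + f x = h * h * ?q z2"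
    using mixed_difference_mvt[OF sm h, of w v] hm m_def by (smt (verit) min_less_iff_conj)
  have "x + h *\<^sub>R v + h *\<^sub>R w = x + h *\<^sub>R w + h *\<^sub>R v" by (simp add: algebra_simps)
  then have "h * h * ?p z1 = h * h * ?q z2" unfolding z1(2)[symmetric] z2(2)[symmetric] by (simp only:)
  then have eq: "?p z1 = ?q z2" using h by simp
  have "dist (?p z1) (?p x) < e" "dist (?q z2) (?q x) < e"
    by (rule d1(2) d2(2), use z1(1) z2(1) hm in \<open>simp add: m_def dist_commute algebra_simps\<close>)+
  then show False using eq e_def unfolding dist_real_def by argo
qed

lemma second_fd_commute:
  fixes f :: "'e::real_normed_vector \<Rightarrow> 'f::euclidean_space"
  assumes "open S" "smooth_on S f" "x \<in> S"
  shows "fd (\<lambda>y. fd f y v) x w = fd (\<lambda>y. fd f y w) x v"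
proof (rule euclidean_eqI)
  fix b :: 'f assume "b \<in> Basis"
  have bl: "bounded_linear (\<lambda>z. z \<bullet> b)" by (rule bounded_linear_inner_left)
  have D1: "fd (\<lambda>y. f y \<bullet> b) y u = fd f y u \<bullet> b" if "y \<in> S" for y u
    using fd_eqI[OF bounded_linear.has_derivative[OF bl smooth_on_has_derivative[OF assms(2) that]]] by simp
  have D2: "fd (\<lambda>y. fd (\<lambda>y. f y \<bullet> b) y u) x s = fd (\<lambda>y. fd f y u) x s \<bullet> b" for u s
  proof -
    have "((\<lambda>y. fd f y u \<bullet> b) has_derivative (\<lambda>s. fd (\<lambda>y. fd f y u) x s \<bullet> b)) (at x)"
      by (rule bounded_linear.has_derivative[OF bl smooth_on_has_derivative[OF smooth_on_fd[OF assms(2)] assms(3)]])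
    then have "((\<lambda>y. fd (\<lambda>y. f y \<bullet> b) y u) has_derivative (\<lambda>s. fd (\<lambda>y. fd f y u) x s \<bullet> b)) (at x)"
      by (rule has_derivative_transform_within_open[OF _ assms(1,3)]) (simp add: D1)
    from fd_eqI[OF this] show ?thesis by simp
  qed
  have "smooth_on S (\<lambda>y. f y \<bullet> b)" using smooth_on_bounded_linear_compose[OF bl assms(1,2)] .
  from second_fd_commute_real[OF assms(1) this assms(3), of v w]
  show "fd (\<lambda>y. fd f y v) x w \<bullet> b = fd (\<lambda>y. fd f y w) x v \<bullet> b" by (simp add: D2)
qed

section \<open>Bounds and Lipschitz constants on compact sets\<close>

lemma smooth_on_fd_bounded:
  fixes f :: "'e::euclidean_space \<Rightarrow> 'f::real_normed_vector"
  assumes "smooth_on S f" "compact K" "K \<subseteq> S"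
  obtains B where "B \<ge> 0" "\<And>x v. x \<in> K \<Longrightarrow> norm (fd f x v) \<le> B * norm v"
proof -
  let ?B = "\<lambda>x. \<Sum>b\<in>(Basis::'e set). norm (fd f x b)"
  have "continuous_on K ?B"
    using continuous_on_subset[OF smooth_on_continuous_on[OF smooth_on_fd[OF assms(1)]] assms(3)]
    by (intro continuous_intros)
  then have "bounded (?B ` K)" using assms(2) compact_continuous_image compact_imp_bounded by blast
  then obtain M where M: "\<And>x. x \<in> K \<Longrightarrow> ?B x \<le> M" by (auto simp: bounded_real abs_le_iff)
  show thesis
  \<comment> \<open>If \<open>K\<close> is empty, \<open>M\<close> is arbitrary and may be
    negative.\<close>
  proof (rule that[of "max M 0"])
    fix x v assume x: "x \<in> K"
    have "norm (fd f x v) = norm (\<Sum>b\<in>Basis. (v \<bullet> b) *\<^sub>R fd f x b)"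
      using linear_euclidean_representation[OF fd_linear[OF assms(1)], of x v] x assms(3) by auto
    also have "\<dots> \<le> (\<Sum>b\<in>Basis. norm v * norm (fd f x b))"
      by (rule order_trans[OF norm_sum sum_mono]) (simp add: Basis_le_norm mult_right_mono)
    also have "\<dots> = norm v * ?B x" by (simp add: sum_distrib_left)
    also have "\<dots> \<le> norm v * max M 0" using M[OF x] by (intro mult_left_mono) auto
    finally show "norm (fd f x v) \<le> max M 0 * norm v" by (simp add: mult.commute)
  qed simp
qed

lemma smooth_on_lipschitz:
  fixes f :: "'e::euclidean_space \<Rightarrow> 'f::real_normed_vector"
  assumes "smooth_on S f" "convex K" "compact K" "K \<subseteq> S"
  obtains L where "L-lipschitz_on K f"
proof -
  obtain B where B: "B \<ge> 0" "\<And>x v. x \<in> K \<Longrightarrow> norm (fd f x v) \<le> B * norm v"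
    by (rule smooth_on_fd_bounded[OF assms(1,3,4)]) (rule that)
  have "norm (f x - f y) \<le> B * norm (x - y)" if "x \<in> K" "y \<in> K" for x y
    using differentiable_bound[OF assms(2) _ onorm_le[OF B(2)], of f] smooth_on_has_derivative[OF assms(1)] that assms(4)
    by (meson has_derivative_at_withinI subset_iff)
  then have "B-lipschitz_on K f" using B(1) by (auto intro!: lipschitz_onI simp: dist_norm)
  then show thesis by (rule that)
qed

section \<open>Charts and tangent vectors\<close>

abbreviation transition :: "('a, 'e) chart \<Rightarrow> ('a, 'f) chart \<Rightarrow> 'e \<Rightarrow> 'f" where
  "transition c c' \<equiv> snd c' \<circ> chart_inv c"

locale smooth_mfd =
  fixes A :: "('a::topological_space, 'e::euclidean_space) chart set"
  assumes atlas: "smooth_atlas A"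
begin

lemma chart_cover: obtains c where "c \<in> A" "p \<in> fst c"
  using atlas unfolding smooth_atlas_def by (metis UNIV_I UN_E)

lemma chart_homeomorphism: "c \<in> A \<Longrightarrow> homeomorphism (fst c) (snd c ` fst c) (snd c) (chart_inv c)"
  using atlas unfolding smooth_atlas_def is_chart_def by blast

lemma open_domain: "c \<in> A \<Longrightarrow> open (fst c)"
  using atlas unfolding smooth_atlas_def is_chart_def by blast

lemma open_image: "c \<in> A \<Longrightarrow> open (snd c ` fst c)"
  using atlas unfolding smooth_atlas_def is_chart_def by blast

lemma chart_inv_chart: "c \<in> A \<Longrightarrow> p \<in> fst c \<Longrightarrow> chart_inv c (snd c p) = p"
  using chart_homeomorphism[of c] unfolding homeomorphism_def by blast

lemma chart_chart_inv: "c \<in> A \<Longrightarrow> y \<in> snd c ` fst c \<Longrightarrow> snd c (chart_inv c y) = y"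
  using chart_homeomorphism[of c] unfolding homeomorphism_def by blast

lemma chart_inv_domain: "c \<in> A \<Longrightarrow> y \<in> snd c ` fst c \<Longrightarrow> chart_inv c y \<in> fst c"
  using chart_homeomorphism[of c] unfolding homeomorphism_def by blast

lemma continuous_on_chart: "c \<in> A \<Longrightarrow> continuous_on (fst c) (snd c)"
  using chart_homeomorphism by (auto simp: homeomorphism_def)

lemma continuous_on_chart_inv: "c \<in> A \<Longrightarrow> continuous_on (snd c ` fst c) (chart_inv c)"
  using chart_homeomorphism by (auto simp: homeomorphism_def)

lemma open_chart_image:
  assumes "c \<in> A" "open W" shows "open (snd c ` (fst c \<inter> W))"
proof -
  have "openin (top_of_set (snd c ` fst c)) (snd c ` (fst c \<inter> W))"
    using homeomorphism_imp_open_map[OF chart_homeomorphism[OF assms(1)]] assms(2)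
    by (metis openin_open_Int)
  then show ?thesis using open_image[OF assms(1)] openin_open_trans by blast
qed

lemma smooth_transition:
  "c \<in> A \<Longrightarrow> c' \<in> A \<Longrightarrow> smooth_on (snd c ` (fst c \<inter> fst c')) (transition c c')"
  using atlas unfolding smooth_atlas_def by blast

lemma transition_has_derivative:
  assumes "c \<in> A" "c' \<in> A" "p \<in> fst c" "p \<in> fst c'"
  shows "(transition c c' has_derivative fd (transition c c') (snd c p)) (at (snd c p))"
  using smooth_on_has_derivative[OF smooth_transition[OF assms(1,2)], of "snd c p"] assms by auto

text \<open>A tangent vector is 0 by convention on functions that are not smooth near
  \<open>p\<close>, so this is what allows coordinate functions to read off the components of a
  vector.\<close>

lemma smooth_near_coordinate:
  assumes "c \<in> A" "p \<in> fst c"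
  shows "smooth_near A p (\<lambda>q. snd c q \<bullet> b)"
proof -
  have "smooth_on (snd c' ` (fst c' \<inter> fst c)) ((\<lambda>q. snd c q \<bullet> b) \<circ> chart_inv c')" if "c' \<in> A" for c'
    using smooth_on_bounded_linear_compose[OF bounded_linear_inner_left
        open_chart_image[OF that open_domain[OF assms(1)]] smooth_transition[OF that assms(1)], of b]
    by (simp add: o_def)
  then show ?thesis
    unfolding smooth_near_def smooth_fun_on_def using assms open_domain by blast
qed

lemma smooth_near_chart:
  assumes "smooth_near A p f" "c \<in> A" "p \<in> fst c"
  obtains S where "open S" "snd c p \<in> S" "S \<subseteq> snd c ` fst c" "smooth_on S (f \<circ> chart_inv c)"
proof -
  obtain W where "open W" "p \<in> W" "smooth_fun_on A W f"
    using assms(1) unfolding smooth_near_def by blast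
  then show thesis
    using assms open_chart_image[of c W] unfolding smooth_fun_on_def
    by (intro that[of "snd c ` (fst c \<inter> W)"]) auto
qed

lemma smooth_near_has_derivative:
  assumes "smooth_near A p f" "c \<in> A" "p \<in> fst c"
  shows "((f \<circ> chart_inv c) has_derivative fd (f \<circ> chart_inv c) (snd c p)) (at (snd c p))"
  by (rule smooth_near_chart[OF assms]) (rule smooth_on_has_derivative)

lemma coord_vec_apply:
  "smooth_near A p f \<Longrightarrow> coord_vec A c p e f = fd (f \<circ> chart_inv c) (snd c p) e"
  by (simp add: coord_vec_def)

lemma coord_vec_coordinate:
  assumes "c \<in> A" "p \<in> fst c"
  shows "coord_vec A c p e (\<lambda>q. snd c q \<bullet> b) = e \<bullet> b"
proof -
  have "((\<lambda>y. y \<bullet> b) has_derivative (\<lambda>v. v \<bullet> b)) (at (snd c p))"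
    by (auto intro!: derivative_eq_intros)
  then have "(((\<lambda>q. snd c q \<bullet> b) \<circ> chart_inv c) has_derivative (\<lambda>v. v \<bullet> b)) (at (snd c p))"
    by (rule has_derivative_transform_within_open[OF _ open_image[OF assms(1)]])
      (use assms chart_chart_inv in auto)
  from fd_eqI[OF this] show ?thesis
    using coord_vec_apply[OF smooth_near_coordinate[OF assms]] by metis
qed

lemma coord_vec_inject:
  assumes "c \<in> A" "p \<in> fst c"
  shows "coord_vec A c p e = coord_vec A c p e' \<longleftrightarrow> e = e'"
  using coord_vec_coordinate[OF assms] by (metis euclidean_eqI)

lemma coord_vec_linear:
  assumes "c \<in> A" "p \<in> fst c"
  shows "coord_vec A c p (a *\<^sub>R e + b *\<^sub>R e') = (\<lambda>f. a * coord_vec A c p e f + b * coord_vec A c p e' f)"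
proof
  fix f
  show "coord_vec A c p (a *\<^sub>R e + b *\<^sub>R e') f = a * coord_vec A c p e f + b * coord_vec A c p e' f"
  proof (cases "smooth_near A p f")
    case True
    then have "linear (fd (f \<circ> chart_inv c) (snd c p))"
      using smooth_near_has_derivative[OF True assms] has_derivative_linear by blast
    then show ?thesis using True by (simp add: coord_vec_apply linear_add linear_scale)
  qed (simp add: coord_vec_def)
qed

lemma coord_vec_zero:
  assumes "c \<in> A" "p \<in> fst c" shows "coord_vec A c p 0 = (\<lambda>f. 0)"
  using coord_vec_linear[OF assms, of 0 0 0 0] by simp

section \<open>The chain rule along curves\<close>

lemma eventually_in_chart:
  assumes "c \<in> A" "\<gamma> t \<in> fst c" "continuous (at t within X) \<gamma>"
  shows "\<forall>\<^sub>F s in at t within X. \<gamma> s \<in> fst c"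
  using assms(3) open_domain[OF assms(1)] assms(2)
  unfolding continuous_within by (rule topological_tendstoD)

text \<open>The filter \<open>at t within X\<close> serves two-sided derivatives as well as
  one-sided ones at the end points of a piece of a curve. Continuity of the curve enters because
  \<open>h \<circ> \<gamma>\<close> factors through the chart only as long as the curve stays in its
  domain.\<close>

lemma chain_rule_chart:
  assumes "c \<in> A" "t \<in> X" "\<gamma> t \<in> fst c" "continuous (at t within X) \<gamma>"
    and x': "((snd c \<circ> \<gamma>) has_vector_derivative x') (at t within X)"
    and h: "((h \<circ> chart_inv c) has_derivative D) (at (snd c (\<gamma> t)))"
  shows "((h \<circ> \<gamma>) has_vector_derivative D x') (at t within X)"
proof -
  have 1: "(((h \<circ> chart_inv c) \<circ> (snd c \<circ> \<gamma>)) has_vector_derivative D x') (at t within X)"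
    using has_derivative_compose[OF x'[unfolded has_vector_derivative_def], of "h \<circ> chart_inv c" D] h
      linear_scale[OF has_derivative_linear[OF h]]
    by (simp add: has_vector_derivative_def o_def)
  have "\<forall>\<^sub>F s in at t within X. ((h \<circ> chart_inv c) \<circ> (snd c \<circ> \<gamma>)) s = (h \<circ> \<gamma>) s"
    using eventually_in_chart[OF assms(1,3,4)] by eventually_elim (simp add: chart_inv_chart assms(1))
  then show ?thesis
    using has_derivative_transform_eventually[OF 1[unfolded has_vector_derivative_def]] assms(1-3)
    unfolding has_vector_derivative_def by (simp add: chart_inv_chart)
qed

lemma coord_vec_change:
  assumes "c \<in> A" "c' \<in> A" "p \<in> fst c" "p \<in> fst c'"
  shows "coord_vec A c p e = coord_vec A c' p (fd (transition c c') (snd c p) e)"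
proof
  fix f
  show "coord_vec A c p e f = coord_vec A c' p (fd (transition c c') (snd c p) e) f"
  proof (cases "smooth_near A p f")
    case True
    have e: "transition c c' (snd c p) = snd c' p" using assms by (simp add: chart_inv_chart)
    have "((f \<circ> chart_inv c') has_derivative fd (f \<circ> chart_inv c') (snd c' p)) (at (transition c c' (snd c p)))"
      using smooth_near_has_derivative[OF True assms(2,4)] e by simp
    from diff_chain_at[OF transition_has_derivative[OF assms] this]
    have "((f \<circ> chart_inv c) has_derivative fd (f \<circ> chart_inv c') (snd c' p) \<circ> fd (transition c c') (snd c p)) (at (snd c p))"
      by (rule has_derivative_transform_within_open[OF _ open_chart_image[OF assms(1) open_domain[OF assms(2)]]])
        (use assms in \<open>auto simp: chart_inv_chart\<close>)
    from fd_eqI[OF this] show ?thesis using True by (simp add: coord_vec_apply)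
  qed (simp add: coord_vec_def)
qed

text \<open>The tangent space is a union over all charts at \<open>p\<close>; by the change of
  coordinates one chart yields all of it. Quantifying over tangent vectors thus becomes quantifying
  over \<open>'e\<close>.\<close>

lemma tangent_space_chart:
  assumes "c \<in> A" "p \<in> fst c"
  shows "tangent_space A p = range (coord_vec A c p)"
  unfolding tangent_space_def using assms coord_vec_change[OF _ assms(1) _ assms(2)] by blast

lemma chain_rule_smooth_near:
  assumes "c \<in> A" "t \<in> X" "\<gamma> t \<in> fst c" "continuous (at t within X) \<gamma>"
    and "((snd c \<circ> \<gamma>) has_vector_derivative x') (at t within X)"
    and "smooth_near A (\<gamma> t) f"
  shows "((f \<circ> \<gamma>) has_vector_derivative coord_vec A c (\<gamma> t) x' f) (at t within X)"
  using chain_rule_chart[OF assms(1-5) smooth_near_has_derivative[OF assms(6,1,3)]]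
  by (simp add: coord_vec_apply assms(6))

lemma chain_rule_transition:
  assumes "c \<in> A" "c' \<in> A" "t \<in> X" "\<gamma> t \<in> fst c" "\<gamma> t \<in> fst c'" "continuous (at t within X) \<gamma>"
    and "((snd c \<circ> \<gamma>) has_vector_derivative x') (at t within X)"
  shows "((snd c' \<circ> \<gamma>) has_vector_derivative fd (transition c c') (snd c (\<gamma> t)) x') (at t within X)"
  using chain_rule_chart[OF assms(1,3,4,6,7) transition_has_derivative[OF assms(1,2,4,5)]] .

lemma velocity_chart:
  assumes "c \<in> A" "\<gamma> t \<in> fst c" "isCont \<gamma> t"
    and "((snd c \<circ> \<gamma>) has_vector_derivative x') (at t)"
  shows "velocity A \<gamma> t = coord_vec A c (\<gamma> t) x'"
proof
  fix f
  show "velocity A \<gamma> t f = coord_vec A c (\<gamma> t) x' f"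
  proof (cases "smooth_near A (\<gamma> t) f")
    case True
    have "((f \<circ> \<gamma>) has_real_derivative coord_vec A c (\<gamma> t) x' f) (at t)"
      using chain_rule_smooth_near[OF assms(1) UNIV_I assms(2-4) True]
      by (simp add: has_real_derivative_iff_has_vector_derivative)
    then show ?thesis using True by (simp add: velocity_def DERIV_imp_deriv)
  qed (simp add: velocity_def coord_vec_def)
qed

end

section \<open>Metric coefficients and the geodesic equation\<close>

text \<open>A product rule for a directional derivative with moving base point and moving direction.
  It is proved on basis directions; the fact \<open>D2\<close> then reassembles the first half of
  the sum as the derivative with the direction frozen at \<open>v x\<close>. It yields the
  acceleration of a curve in a new chart.\<close>

lemma fd_has_derivative:
  fixes \<phi> :: "'e::euclidean_space \<Rightarrow> 'f::real_normed_vector"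
  assumes sm: "smooth_on S \<phi>" and S: "open S" "y x \<in> S"
    and y: "(y has_derivative y') (at x within X)" and v: "(v has_derivative v') (at x within X)"
    and x: "x \<in> X"
  shows "((\<lambda>x. fd \<phi> (y x) (v x)) has_derivative
     (\<lambda>h. fd (\<lambda>z. fd \<phi> z (v x)) (y x) (y' h) + fd \<phi> (y x) (v' h))) (at x within X)"
proof -
  have lin: "linear (fd \<phi> z)" if "z \<in> S" for z using fd_linear[OF sm that] .
  have D: "((\<lambda>z. fd \<phi> z b) has_derivative fd (\<lambda>z. fd \<phi> z b) (y x)) (at (y x))" for b
    using smooth_on_has_derivative[OF smooth_on_fd[OF sm] S(2)] .
  have "((\<lambda>z. \<Sum>b\<in>Basis. (v x \<bullet> b) *\<^sub>R fd \<phi> z b) has_derivative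
      (\<lambda>h. \<Sum>b\<in>Basis. (v x \<bullet> b) *\<^sub>R fd (\<lambda>z. fd \<phi> z b) (y x) h)) (at (y x))"
    by (auto intro!: derivative_eq_intros D)
  then have "((\<lambda>z. fd \<phi> z (v x)) has_derivative
      (\<lambda>h. \<Sum>b\<in>Basis. (v x \<bullet> b) *\<^sub>R fd (\<lambda>z. fd \<phi> z b) (y x) h)) (at (y x))"
    by (rule has_derivative_transform_within_open[OF _ S]) (use linear_euclidean_representation[OF lin] in metis)
  note D2 = fd_eqI[OF this]
  have 1: "((\<lambda>x. fd \<phi> (y x) b) has_derivative (\<lambda>h. fd (\<lambda>z. fd \<phi> z b) (y x) (y' h))) (at x within X)" for b
    using has_derivative_compose[OF y D] .
  have d: "((\<lambda>x. \<Sum>b\<in>Basis. (v x \<bullet> b) *\<^sub>R fd \<phi> (y x) b) has_derivative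
     (\<lambda>h. \<Sum>b\<in>Basis. (v x \<bullet> b) *\<^sub>R fd (\<lambda>z. fd \<phi> z b) (y x) (y' h) + (v' h \<bullet> b) *\<^sub>R fd \<phi> (y x) b)) (at x within X)"
    by (auto intro!: derivative_eq_intros 1 v)
  have eq: "(\<lambda>h. \<Sum>b\<in>Basis. (v x \<bullet> b) *\<^sub>R fd (\<lambda>z. fd \<phi> z b) (y x) (y' h) + (v' h \<bullet> b) *\<^sub>R fd \<phi> (y x) b)
     = (\<lambda>h. fd (\<lambda>z. fd \<phi> z (v x)) (y x) (y' h) + fd \<phi> (y x) (v' h))"
    by (rule ext) (simp add: D2 sum.distrib flip: linear_euclidean_representation[OF lin[OF S(2)]])
  have "\<forall>\<^sub>F s in at x within X. y s \<in> S"
    using has_derivative_continuous[OF y] S unfolding continuous_within by (rule topological_tendstoD)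
  then have ev: "\<forall>\<^sub>F s in at x within X. (\<Sum>b\<in>Basis. (v s \<bullet> b) *\<^sub>R fd \<phi> (y s) b) = fd \<phi> (y s) (v s)"
    by eventually_elim (simp flip: linear_euclidean_representation[OF lin])
  show ?thesis
    using has_derivative_transform_eventually[OF d ev _ x] unfolding eq
    by (simp flip: linear_euclidean_representation[OF lin] add: S(2))
qed

locale semi_riem =
  fixes A :: "('a::topological_space, 'e::euclidean_space) chart set" and g :: "'a tensor2"
  assumes semi_riemannian: "semi_riemannian_manifold A g"

sublocale semi_riem \<subseteq> smooth_mfd A
  using semi_riemannian by unfold_locales (simp add: semi_riemannian_manifold_def)

context semi_riem
begin

abbreviation G where "G \<equiv> metric_coord A g"
abbreviation DG where "DG c y d v w \<equiv> fd (\<lambda>x. G c x v w) y d"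

lemma coord_vec_tangent: "c \<in> A \<Longrightarrow> p \<in> fst c \<Longrightarrow> coord_vec A c p e \<in> tangent_space A p"
  using tangent_space_chart by blast

lemma metric_coord_sym:
  assumes "c \<in> A" "y \<in> snd c ` fst c" shows "G c y v w = G c y w v"
  using semi_riemannian coord_vec_tangent[OF assms(1) chart_inv_domain[OF assms]]
  unfolding semi_riemannian_manifold_def metric_coord_def by blast

lemma metric_coord_linear_left:
  assumes "c \<in> A" "y \<in> snd c ` fst c" shows "linear (\<lambda>v. G c y v w)"
proof -
  note t = coord_vec_tangent[OF assms(1) chart_inv_domain[OF assms]]
    and l = coord_vec_linear[OF assms(1) chart_inv_domain[OF assms]]
  have *: "G c y (a *\<^sub>R v + b *\<^sub>R v') w = a * G c y v w + b * G c y v' w" for a b v v'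
    using semi_riemannian t unfolding semi_riemannian_manifold_def metric_coord_def l by blast
  show ?thesis
    using *[of 1 _ 1] *[of _ _ 0] by (intro linearI) auto
qed

lemma metric_coord_linear_right:
  assumes "c \<in> A" "y \<in> snd c ` fst c" shows "linear (G c y v)"
proof -
  have "G c y v = (\<lambda>w. G c y w v)" by (rule ext) (rule metric_coord_sym[OF assms])
  then show ?thesis using metric_coord_linear_left[OF assms, of v] by simp
qed

lemma metric_coord_nondegenerate:
  assumes "c \<in> A" "y \<in> snd c ` fst c" "\<And>w. G c y v w = 0" shows "v = 0"
proof -
  note d = assms(1) chart_inv_domain[OF assms(1,2)]
  have "\<forall>W\<in>tangent_space A (chart_inv c y). g (chart_inv c y) (coord_vec A c (chart_inv c y) v) W = 0"
    using assms(3) unfolding tangent_space_chart[OF d] metric_coord_def by blast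
  then have "coord_vec A c (chart_inv c y) v = (\<lambda>f. 0)"
    using semi_riemannian coord_vec_tangent[OF d] unfolding semi_riemannian_manifold_def by blast
  then show ?thesis using coord_vec_inject[OF d] coord_vec_zero[OF d] by metis
qed

lemma smooth_metric_coord: "c \<in> A \<Longrightarrow> smooth_on (snd c ` fst c) (\<lambda>y. G c y v w)"
  using semi_riemannian unfolding semi_riemannian_manifold_def by blast

lemma metric_coord_chart:
  "c \<in> A \<Longrightarrow> p \<in> fst c \<Longrightarrow> G c (snd c p) v w = g p (coord_vec A c p v) (coord_vec A c p w)"
  by (simp add: metric_coord_def chart_inv_chart)

lemma metric_coord_change:
  assumes "c \<in> A" "c' \<in> A" "y \<in> snd c ` (fst c \<inter> fst c')"
  shows "G c y v w = G c' (transition c c' y) (fd (transition c c') y v) (fd (transition c c') y w)"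
proof -
  obtain p where p: "p \<in> fst c" "p \<in> fst c'" "y = snd c p" using assms(3) by blast
  then show ?thesis
    using coord_vec_change[OF assms(1,2) p(1,2)] metric_coord_chart[OF assms(1) p(1)]
      metric_coord_chart[OF assms(2) p(2)] by (simp add: chart_inv_chart assms(1))
qed

lemma metric_coord_expand:
  assumes "c \<in> A" "y \<in> snd c ` fst c"
  shows "G c y v w = (\<Sum>i\<in>Basis. \<Sum>j\<in>Basis. (v \<bullet> i) * (w \<bullet> j) * G c y i j)"
  using linear_euclidean_representation[OF metric_coord_linear_left[OF assms], of v w]
    linear_euclidean_representation[OF metric_coord_linear_right[OF assms], of _ w]
  by (simp add: sum_distrib_left mult.assoc)

lemma metric_coord_deriv_expand:
  assumes "c \<in> A" "y \<in> snd c ` fst c"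
  shows "DG c y d v w = (\<Sum>i\<in>Basis. \<Sum>j\<in>Basis. (v \<bullet> i) * (w \<bullet> j) * DG c y d i j)"
proof -
  have D: "((\<lambda>y. G c y i j) has_derivative (\<lambda>h. DG c y h i j)) (at y)" for i j
    using smooth_on_has_derivative[OF smooth_metric_coord[OF assms(1)] assms(2)] .
  have "((\<lambda>y. \<Sum>i\<in>Basis. \<Sum>j\<in>Basis. (v \<bullet> i) * (w \<bullet> j) * G c y i j) has_derivative
     (\<lambda>h. \<Sum>i\<in>Basis. \<Sum>j\<in>Basis. (v \<bullet> i) * (w \<bullet> j) * DG c y h i j)) (at y)"
    by (auto intro!: derivative_eq_intros D)
  then have "((\<lambda>y. G c y v w) has_derivative
     (\<lambda>h. \<Sum>i\<in>Basis. \<Sum>j\<in>Basis. (v \<bullet> i) * (w \<bullet> j) * DG c y h i j)) (at y)"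
    by (rule has_derivative_transform_within_open[OF _ open_image[OF assms(1)] assms(2)])
      (simp add: metric_coord_expand[OF assms(1), of _ v w])
  from fd_eqI[OF this] show ?thesis by simp
qed

lemma metric_coord_deriv_linear1:
  assumes "c \<in> A" "y \<in> snd c ` fst c" shows "linear (\<lambda>d. DG c y d v w)"
  using fd_linear[OF smooth_metric_coord[OF assms(1)] assms(2)] .

lemma metric_coord_deriv_linear2:
  assumes "c \<in> A" "y \<in> snd c ` fst c" shows "linear (\<lambda>v. DG c y d v w)"
proof (rule linearI)
  note ex = metric_coord_deriv_expand[OF assms, where d = d and w = w]
  show "DG c y d (v + v') w = DG c y d v w + DG c y d v' w" for v v'
    unfolding ex by (simp add: inner_add_left distrib_right sum.distrib)
  show "DG c y d (r *\<^sub>R v) w = r *\<^sub>R DG c y d v w" for r v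
    unfolding ex by (simp add: sum_distrib_left mult.assoc)
qed

lemma metric_coord_deriv_linear3:
  assumes "c \<in> A" "y \<in> snd c ` fst c" shows "linear (\<lambda>w. DG c y d v w)"
proof (rule linearI)
  note ex = metric_coord_deriv_expand[OF assms, where d = d and v = v]
  show "DG c y d v (w + w') = DG c y d v w + DG c y d v w'" for w w'
    unfolding ex by (simp add: inner_add_left distrib_right distrib_left sum.distrib)
  show "DG c y d v (r *\<^sub>R w) = r *\<^sub>R DG c y d v w" for r w
    unfolding ex by (simp add: sum_distrib_left mult_ac)
qed

text \<open>The Leibniz rule for the metric with moving base point and moving arguments. The metric
  is known to be smooth for fixed arguments only, hence the detour through its components.\<close>

lemma metric_coord_has_derivative:
  assumes c: "c \<in> A" "z x \<in> snd c ` fst c" and x: "x \<in> X"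
    and z: "(z has_derivative z') (at x within X)" and v: "(v has_derivative v') (at x within X)"
    and w: "(w has_derivative w') (at x within X)"
  shows "((\<lambda>x. G c (z x) (v x) (w x)) has_derivative
     (\<lambda>h. DG c (z x) (z' h) (v x) (w x) + G c (z x) (v' h) (w x) + G c (z x) (v x) (w' h))) (at x within X)"
proof -
  have D: "((\<lambda>x. G c (z x) i j) has_derivative (\<lambda>h. DG c (z x) (z' h) i j)) (at x within X)" for i j
    using has_derivative_compose[OF z smooth_on_has_derivative[OF smooth_metric_coord c(2)]] c(1) .
  have d: "((\<lambda>x. \<Sum>i\<in>Basis. \<Sum>j\<in>Basis. (v x \<bullet> i) * (w x \<bullet> j) * G c (z x) i j) has_derivative
     (\<lambda>h. \<Sum>i\<in>Basis. \<Sum>j\<in>Basis. (v x \<bullet> i) * (w x \<bullet> j) * DG c (z x) (z' h) i j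
        + (v' h \<bullet> i) * (w x \<bullet> j) * G c (z x) i j + (v x \<bullet> i) * (w' h \<bullet> j) * G c (z x) i j)) (at x within X)"
    by (auto intro!: derivative_eq_intros D v w simp: algebra_simps)
  have eq: "(\<lambda>h. \<Sum>i\<in>Basis. \<Sum>j\<in>Basis. (v x \<bullet> i) * (w x \<bullet> j) * DG c (z x) (z' h) i j
        + (v' h \<bullet> i) * (w x \<bullet> j) * G c (z x) i j + (v x \<bullet> i) * (w' h \<bullet> j) * G c (z x) i j)
    = (\<lambda>h. DG c (z x) (z' h) (v x) (w x) + G c (z x) (v' h) (w x) + G c (z x) (v x) (w' h))"
    by (rule ext, subst metric_coord_deriv_expand[OF c, of "v x" "w x"],
        subst metric_coord_expand[OF c, of _ "w x"], subst metric_coord_expand[OF c, of "v x"])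
      (simp add: sum.distrib)
  have "\<forall>\<^sub>F s in at x within X. z s \<in> snd c ` fst c"
    using has_derivative_continuous[OF z] open_image[OF c(1)] c(2)
    unfolding continuous_within by (rule topological_tendstoD)
  then have ev: "\<forall>\<^sub>F s in at x within X.
      (\<Sum>i\<in>Basis. \<Sum>j\<in>Basis. (v s \<bullet> i) * (w s \<bullet> j) * G c (z s) i j) = G c (z s) (v s) (w s)"
    by eventually_elim (simp add: metric_coord_expand[OF c(1), of _ "v _" "w _"])
  show ?thesis
    using has_derivative_transform_eventually[OF d ev _ x] unfolding eq
    by (simp add: metric_coord_expand[OF c, of "v x" "w x"])
qed

text \<open>The musical isomorphism that lowers an index, with covectors identified with vectors
  through the Euclidean inner product; this makes it an endomorphism of \<open>'e\<close>.\<close>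

definition flat :: "('a, 'e) chart \<Rightarrow> 'e \<Rightarrow> 'e \<Rightarrow> 'e" where
  "flat c y z = (\<Sum>b\<in>Basis. G c y z b *\<^sub>R b)"

lemma flat_inner_Basis: "b \<in> Basis \<Longrightarrow> flat c y z \<bullet> b = G c y z b"
  unfolding flat_def by (simp add: inner_sum_left inner_Basis if_distrib cong: if_cong)

lemma flat_inner:
  assumes "c \<in> A" "y \<in> snd c ` fst c" shows "flat c y z \<bullet> e = G c y z e"
  using linear_euclidean_representation[OF metric_coord_linear_right[OF assms], of z e]
  by (subst euclidean_inner) (simp add: flat_inner_Basis mult.commute)

lemma linear_flat:
  assumes "c \<in> A" "y \<in> snd c ` fst c" shows "linear (flat c y)"
proof (rule linearI)
  note l = metric_coord_linear_left[OF assms]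
  show "flat c y (u + v) = flat c y u + flat c y v" for u v
    unfolding flat_def by (simp add: linear_add[OF l] scaleR_add_left sum.distrib)
  show "flat c y (r *\<^sub>R u) = r *\<^sub>R flat c y u" for r u
    unfolding flat_def by (simp add: linear_scale[OF l] scaleR_sum_right)
qed

lemma inj_flat:
  assumes "c \<in> A" "y \<in> snd c ` fst c" shows "inj (flat c y)"
proof -
  have "z = 0" if "flat c y z = 0" for z
    using metric_coord_nondegenerate[OF assms, of z] flat_inner[OF assms, of z] that by simp
  then show ?thesis using linear_injective_0[OF linear_flat[OF assms]] by blast
qed

text \<open>Nondegeneracy makes \<open>flat\<close> injective and therefore, in finite dimension,
  onto. The definite description in \<open>christoffel\<close> rests on this unique
  existence.\<close>

lemma riesz_metric:
  assumes "c \<in> A" "y \<in> snd c ` fst c" "linear r"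
  shows "\<exists>!z. \<forall>e. G c y z e = r e"
proof -
  have "surj (flat c y)"
    using linear_injective_imp_surjective[OF linear_flat inj_flat] assms(1,2) by blast
  then obtain z where z: "flat c y z = (\<Sum>b\<in>Basis. r b *\<^sub>R b)" by (metis surjD)
  have "G c y z e = r e" for e
  proof -
    have "G c y z e = (\<Sum>b\<in>Basis. r b *\<^sub>R b) \<bullet> e" using flat_inner[OF assms(1,2)] z by metis
    also have "\<dots> = r e"
      using linear_euclidean_representation[OF assms(3), of e]
      by (simp add: inner_sum_left inner_commute[of e] mult.commute)
    finally show ?thesis .
  qed
  moreover have "z1 = z2" if "\<forall>e. G c y z1 e = r e" "\<forall>e. G c y z2 e = r e" for z1 z2
  proof (rule injD[OF inj_flat[OF assms(1,2)]])
    show "flat c y z1 = flat c y z2" unfolding flat_def using that by simp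
  qed
  ultimately show ?thesis by blast
qed

text \<open>The pairing of \<open>e\<close> with the covariant acceleration. It avoids the inverse of the metric, which
  makes it easy to transform between charts.\<close>

definition EL :: "('a, 'e) chart \<Rightarrow> 'e \<Rightarrow> 'e \<Rightarrow> 'e \<Rightarrow> 'e \<Rightarrow> real" where
  "EL c y v a e = G c y a e + DG c y v v e - DG c y e v v / 2"

lemma linear_EL_force:
  assumes "c \<in> A" "y \<in> snd c ` fst c"
  shows "linear (\<lambda>e. DG c y v v e - DG c y e v v / 2)"
  using metric_coord_deriv_linear1[OF assms, of v v] metric_coord_deriv_linear3[OF assms, of v v]
  unfolding linear_iff by (simp add: algebra_simps add_divide_distrib)

text \<open>For equal arguments the first two terms of the Koszul formula coincide, and only the
  third keeps the factor 1/2.\<close>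

lemma christoffel_metric:
  assumes "c \<in> A" "y \<in> snd c ` fst c"
  shows "G c y (christoffel A g c y v v) e = DG c y v v e - DG c y e v v / 2"
proof -
  let ?r = "\<lambda>e. (DG c y v v e + DG c y v v e - DG c y e v v) / 2"
  have r: "?r = (\<lambda>e. DG c y v v e - DG c y e v v / 2)" by (auto simp: field_simps)
  have "linear ?r" unfolding r by (rule linear_EL_force[OF assms])
  from theI'[OF riesz_metric[OF assms this]]
  have "G c y (christoffel A g c y v v) e = ?r e" unfolding christoffel_def by blast
  also have "\<dots> = DG c y v v e - DG c y e v v / 2" using r by (rule fun_cong)
  finally show ?thesis .
qed

lemma geodesic_equation_iff:
  assumes "c \<in> A" "y \<in> snd c ` fst c"
  shows "a + christoffel A g c y v v = 0 \<longleftrightarrow> (\<forall>e. EL c y v a e = 0)"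
proof -
  have "EL c y v a e = G c y (a + christoffel A g c y v v) e" for e
    unfolding EL_def by (simp add: linear_add[OF metric_coord_linear_left[OF assms]] christoffel_metric[OF assms])
  then show ?thesis
    using metric_coord_nondegenerate[OF assms] linear_0[OF metric_coord_linear_left[OF assms]] by metis
qed

text \<open>Differentiating the transformation rule of the metric produces three kinds of terms with
  second derivatives of \<open>\<phi>\<close>. The one with both derivatives in direction
  \<open>v\<close> is exactly the inhomogeneous part of the transformed acceleration. The other two,
  with one derivative along \<open>v\<close> and one along \<open>e\<close>, come with opposite
  signs and cancel, because second derivatives commute and the metric is symmetric.\<close>

lemma EL_change:
  assumes c: "c \<in> A" "c' \<in> A" and y: "y \<in> snd c ` (fst c \<inter> fst c')"
  defines "\<phi> \<equiv> transition c c'"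
  shows "EL c y v a e = EL c' (\<phi> y) (fd \<phi> y v) (fd (\<lambda>x. fd \<phi> x v) y v + fd \<phi> y a) (fd \<phi> y e)"
proof -
  let ?S = "snd c ` (fst c \<inter> fst c')"
  have S: "open ?S" using open_chart_image[OF c(1) open_domain[OF c(2)]] .
  have sm: "smooth_on ?S \<phi>" unfolding \<phi>_def using smooth_transition[OF c] .
  have yc: "y \<in> snd c ` fst c" using y by blast
  have yc': "\<phi> y \<in> snd c' ` fst c'" using y c by (auto simp: \<phi>_def chart_inv_chart)
  have D: "DG c y d v w = DG c' (\<phi> y) (fd \<phi> y d) (fd \<phi> y v) (fd \<phi> y w)
      + G c' (\<phi> y) (fd (\<lambda>x. fd \<phi> x v) y d) (fd \<phi> y w) + G c' (\<phi> y) (fd \<phi> y v) (fd (\<lambda>x. fd \<phi> x w) y d)" for d v w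
  proof -
    have "((\<lambda>x. G c' (\<phi> x) (fd \<phi> x v) (fd \<phi> x w)) has_derivative (\<lambda>d. DG c' (\<phi> y) (fd \<phi> y d) (fd \<phi> y v) (fd \<phi> y w)
      + G c' (\<phi> y) (fd (\<lambda>x. fd \<phi> x v) y d) (fd \<phi> y w) + G c' (\<phi> y) (fd \<phi> y v) (fd (\<lambda>x. fd \<phi> x w) y d))) (at y)"
      by (rule metric_coord_has_derivative[where z = \<phi>]; (rule c yc' UNIV_I smooth_on_has_derivative[OF _ y] sm smooth_on_fd)+)
    then have "((\<lambda>x. G c x v w) has_derivative (\<lambda>d. DG c' (\<phi> y) (fd \<phi> y d) (fd \<phi> y v) (fd \<phi> y w)
      + G c' (\<phi> y) (fd (\<lambda>x. fd \<phi> x v) y d) (fd \<phi> y w) + G c' (\<phi> y) (fd \<phi> y v) (fd (\<lambda>x. fd \<phi> x w) y d))) (at y)"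
      by (rule has_derivative_transform_within_open[OF _ S y]) (simp only: \<phi>_def metric_coord_change[OF c])
    from fd_eqI[OF this] show ?thesis by simp
  qed
  have sym: "fd (\<lambda>x. fd \<phi> x v) y e = fd (\<lambda>x. fd \<phi> x e) y v"
    using second_fd_commute[OF S sm y] .
  have GA: "G c y a e = G c' (\<phi> y) (fd \<phi> y a) (fd \<phi> y e)"
    using metric_coord_change[OF c y] unfolding \<phi>_def .
  have GS: "G c' (\<phi> y) (fd \<phi> y v) (fd (\<lambda>x. fd \<phi> x v) y e) = G c' (\<phi> y) (fd (\<lambda>x. fd \<phi> x v) y e) (fd \<phi> y v)"
    using metric_coord_sym[OF c(2) yc'] .
  show ?thesis
    unfolding EL_def D GA using sym GS metric_coord_sym[OF c(2) yc', of "fd \<phi> y v" "fd (\<lambda>x. fd \<phi> x e) y v"]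
    by (simp add: linear_add[OF metric_coord_linear_left[OF c(2) yc']] field_simps)
qed

text \<open>The force is quadratic in the velocity; this is why a geodesic stays one when time runs
  backwards.\<close>

lemma EL_uminus:
  assumes "c \<in> A" "y \<in> snd c ` fst c" shows "EL c y (- v) a e = EL c y v a e"
  unfolding EL_def
  by (simp add: linear_neg[OF metric_coord_deriv_linear1[OF assms]]
      linear_neg[OF metric_coord_deriv_linear2[OF assms]] linear_neg[OF metric_coord_deriv_linear3[OF assms]])

end

section \<open>Geodesics at a point: change of chart and time reversal\<close>

lemma has_vector_derivative_transform_nhds:
  assumes "(f has_vector_derivative f') (at t)" "\<forall>\<^sub>F s in nhds t. f s = g s"
  shows "(g has_vector_derivative f') (at t)"
proof -
  obtain S where "open S" "t \<in> S" "\<And>s. s \<in> S \<Longrightarrow> f s = g s"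
    using assms(2) unfolding eventually_nhds by blast
  then show ?thesis using assms(1) has_vector_derivative_transform_within_open by blast
qed

lemma isCont_transform_nhds:
  assumes "isCont f t" "\<forall>\<^sub>F s in nhds t. f s = g s" shows "isCont g t"
  using isCont_cong[OF assms(2)] assms(1) by blast

lemma isCont_eventually_in_open:
  assumes "isCont f t" "open S" "f t \<in> S" shows "\<forall>\<^sub>F s in nhds t. f s \<in> S"
  using assms unfolding isCont_def tendsto_at_iff_tendsto_nhds by (simp add: topological_tendstoD)

context smooth_mfd
begin

text \<open>The first derivative must be known near \<open>t\<close>, since otherwise
  \<open>z'\<close> would not be the velocity on a neighbourhood and its derivative at
  \<open>t\<close> would not be the acceleration. The second derivative matters at \<open>t\<close>
  alone.\<close>

lemma curve_chart_change:
  assumes c: "c \<in> A" "c' \<in> A" and t: "\<gamma> t \<in> fst c" "\<gamma> t \<in> fst c'"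
    and cont: "\<forall>\<^sub>F s in nhds t. isCont \<gamma> s"
    and x': "\<forall>\<^sub>F s in nhds t. ((snd c \<circ> \<gamma>) has_vector_derivative x' s) (at s)"
    and x'': "(x' has_vector_derivative x'') (at t)"
  defines "\<phi> \<equiv> transition c c'"
  defines "z' \<equiv> \<lambda>s. fd \<phi> (snd c (\<gamma> s)) (x' s)"
  shows "\<forall>\<^sub>F s in nhds t. ((snd c' \<circ> \<gamma>) has_vector_derivative z' s) (at s)"
    and "(z' has_vector_derivative fd (\<lambda>x. fd \<phi> x (x' t)) (snd c (\<gamma> t)) (x' t) + fd \<phi> (snd c (\<gamma> t)) x'') (at t)"
proof -
  let ?S = "snd c ` (fst c \<inter> fst c')"
  have "isCont \<gamma> t" using cont eventually_nhds_x_imp_x by blast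
  then have "\<forall>\<^sub>F s in nhds t. \<gamma> s \<in> fst c" "\<forall>\<^sub>F s in nhds t. \<gamma> s \<in> fst c'"
    using isCont_eventually_in_open open_domain c t by blast+
  with cont x' show "\<forall>\<^sub>F s in nhds t. ((snd c' \<circ> \<gamma>) has_vector_derivative z' s) (at s)"
    unfolding z'_def \<phi>_def
    by eventually_elim (rule chain_rule_transition[OF c UNIV_I]; simp)
  have y: "((snd c \<circ> \<gamma>) has_vector_derivative x' t) (at t)" using x' eventually_nhds_x_imp_x by blast
  have S: "open ?S" "(snd c \<circ> \<gamma>) t \<in> ?S" using open_chart_image[OF c(1) open_domain[OF c(2)]] t by auto
  have sm: "smooth_on ?S \<phi>" unfolding \<phi>_def using smooth_transition[OF c] .
  have l: "linear (\<lambda>h. fd (\<lambda>x. fd \<phi> x (x' t)) (snd c (\<gamma> t)) h)" "linear (fd \<phi> (snd c (\<gamma> t)))"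
    using fd_linear[OF smooth_on_fd[OF sm] S(2)] fd_linear[OF sm S(2)] by simp_all
  show "(z' has_vector_derivative fd (\<lambda>x. fd \<phi> x (x' t)) (snd c (\<gamma> t)) (x' t) + fd \<phi> (snd c (\<gamma> t)) x'') (at t)"
    using fd_has_derivative[where y = "snd c \<circ> \<gamma>" and v = x', OF sm S y[unfolded has_vector_derivative_def]
        x''[unfolded has_vector_derivative_def]]
    unfolding has_vector_derivative_def z'_def
    by (simp add: linear_scale[OF l(1)] linear_scale[OF l(2)] scaleR_add_right)
qed

end

context semi_riem
begin

text \<open>A condition on the germ of the curve in a single chart. Unlike \<open>geodesic\<close>
  it can be glued, moved to another chart and checked point by point.\<close>

definition geodesic_at :: "('a, 'e) chart \<Rightarrow> (real \<Rightarrow> 'a) \<Rightarrow> real \<Rightarrow> bool" where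
  "geodesic_at c \<gamma> t \<longleftrightarrow> \<gamma> t \<in> fst c \<and> (\<forall>\<^sub>F s in nhds t. isCont \<gamma> s) \<and>
     (\<exists>x' x''. (\<forall>\<^sub>F s in nhds t. ((snd c \<circ> \<gamma>) has_vector_derivative x' s) (at s)) \<and>
        (x' has_vector_derivative x'') (at t) \<and>
        x'' + christoffel A g c (snd c (\<gamma> t)) (x' t) (x' t) = 0)"

text \<open>The velocity in \<open>geodesic_at\<close> is only asserted to exist near
  \<open>t\<close>; by uniqueness it is the canonical \<open>vector_derivative\<close>, so that
  choices made at different points fit together.\<close>

lemma geodesic_at_vector_derivative:
  assumes "geodesic_at c \<gamma> t"
  defines "x' \<equiv> \<lambda>s. vector_derivative (snd c \<circ> \<gamma>) (at s)"
  obtains x'' where "\<forall>\<^sub>F s in nhds t. ((snd c \<circ> \<gamma>) has_vector_derivative x' s) (at s)"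
    "(x' has_vector_derivative x'') (at t)"
    "x'' + christoffel A g c (snd c (\<gamma> t)) (x' t) (x' t) = 0"
proof -
  obtain w' w'' where w': "\<forall>\<^sub>F s in nhds t. ((snd c \<circ> \<gamma>) has_vector_derivative w' s) (at s)"
    and w'': "(w' has_vector_derivative w'') (at t)"
      "w'' + christoffel A g c (snd c (\<gamma> t)) (w' t) (w' t) = 0"
    using assms(1) unfolding geodesic_at_def by blast
  have "\<forall>\<^sub>F s in nhds t. w' s = x' s"
    using w' by eventually_elim (simp add: x'_def vector_derivative_at)
  then show thesis
    using w'' eventually_nhds_x_imp_x[of "\<lambda>s. w' s = x' s"]
      has_vector_derivative_transform_nhds[of w' w'' t x']
    by (intro that[of w''])
      (auto intro: eventually_mono[OF w'] simp: x'_def vector_derivative_at)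
qed

text \<open>The equation in \<open>c'\<close> has to be tested with every vector \<open>e\<close> of
  that chart. Applying \<open>EL_change\<close> from \<open>c'\<close> back to \<open>c\<close>
  pushes \<open>e\<close> forward and so spares the inverse of the Jacobian. The price is a round
  trip: velocity and acceleration, taken to \<open>c'\<close> and back, must be the original ones,
  which follows from uniqueness of derivatives.\<close>

lemma geodesic_at_transfer:
  assumes \<gamma>: "geodesic_at c \<gamma> t" and c: "c \<in> A" "c' \<in> A" "\<gamma> t \<in> fst c'"
  shows "geodesic_at c' \<gamma> t"
proof -
  have t: "\<gamma> t \<in> fst c" and cont: "\<forall>\<^sub>F s in nhds t. isCont \<gamma> s" using \<gamma> unfolding geodesic_at_def by auto
  obtain x' x'' where x': "\<forall>\<^sub>F s in nhds t. ((snd c \<circ> \<gamma>) has_vector_derivative x' s) (at s)"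
    and x'': "(x' has_vector_derivative x'') (at t)"
    and eq: "x'' + christoffel A g c (snd c (\<gamma> t)) (x' t) (x' t) = 0"
    using \<gamma> unfolding geodesic_at_def by blast
  define z' where "z' s = fd (transition c c') (snd c (\<gamma> s)) (x' s)" for s
  note z = curve_chart_change[where \<gamma> = \<gamma>, OF c(1,2) t c(3) cont x' x'', folded z'_def]
  obtain z'' where z'': "(z' has_vector_derivative z'') (at t)" using z(2) by blast
  define \<psi> where "\<psi> = transition c' c"
  define w' where "w' s = fd \<psi> (snd c' (\<gamma> s)) (z' s)" for s
  note w = curve_chart_change[where \<gamma> = \<gamma>, OF c(2,1) c(3) t cont z(1) z'', folded \<psi>_def, folded w'_def]
  have "\<forall>\<^sub>F s in nhds t. w' s = x' s"
    using w(1) x' by eventually_elim (rule vector_derivative_unique_at)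
  then have wx: "w' t = x' t"
    and wx'': "fd (\<lambda>x. fd \<psi> x (z' t)) (snd c' (\<gamma> t)) (z' t) + fd \<psi> (snd c' (\<gamma> t)) z'' = x''"
    using eventually_nhds_x_imp_x[of "\<lambda>s. w' s = x' s"] 
      vector_derivative_unique_at[OF has_vector_derivative_transform_nhds[OF w(2)] x''] by auto
  have \<psi>: "\<psi> (snd c' (\<gamma> t)) = snd c (\<gamma> t)" using c by (simp add: \<psi>_def chart_inv_chart)
  have "EL c' (snd c' (\<gamma> t)) (z' t) z'' e = 0" for e
    using EL_change[OF c(2,1), of "snd c' (\<gamma> t)" "z' t" z'' e, folded \<psi>_def, unfolded wx'' \<psi>]
      eq geodesic_equation_iff[OF c(1), of "snd c (\<gamma> t)"] t c(3) wx w'_def by auto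
  then have "z'' + christoffel A g c' (snd c' (\<gamma> t)) (z' t) (z' t) = 0"
    using geodesic_equation_iff[OF c(2), of "snd c' (\<gamma> t)"] c(3) by blast
  then show ?thesis unfolding geodesic_at_def using c(3) cont z(1) z'' by blast
qed

lemma geodesic_at_cong:
  assumes "geodesic_at c \<gamma> t" "\<forall>\<^sub>F s in nhds t. \<gamma> s = \<delta> s"
  shows "geodesic_at c \<delta> t"
proof -
  have "\<gamma> t = \<delta> t" using assms(2) eventually_nhds_x_imp_x by blast
  have ee: "\<forall>\<^sub>F s in nhds t. \<forall>\<^sub>F r in nhds s. \<gamma> r = \<delta> r" using assms(2) by (simp add: eventually_eventually)
  obtain x' x'' where x': "\<forall>\<^sub>F s in nhds t. ((snd c \<circ> \<gamma>) has_vector_derivative x' s) (at s)"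
    and x'': "(x' has_vector_derivative x'') (at t)" "x'' + christoffel A g c (snd c (\<gamma> t)) (x' t) (x' t) = 0"
    and cont: "\<forall>\<^sub>F s in nhds t. isCont \<gamma> s" and t: "\<gamma> t \<in> fst c"
    using assms(1) unfolding geodesic_at_def by blast
  have 1: "\<forall>\<^sub>F s in nhds t. isCont \<delta> s"
    using cont ee by eventually_elim (rule isCont_transform_nhds)
  have 2: "\<forall>\<^sub>F s in nhds t. ((snd c \<circ> \<delta>) has_vector_derivative x' s) (at s)"
    using x' ee
  proof eventually_elim
    case (elim s)
    show ?case
      by (rule has_vector_derivative_transform_nhds[OF elim(1)])
        (use elim(2) in eventually_elim, simp)
  qed
  show ?thesis unfolding geodesic_at_def using 1 2 x'' t \<open>\<gamma> t = \<delta> t\<close> by auto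
qed

lemma geodesic_at_reverse:
  assumes c: "c \<in> A" and \<gamma>: "geodesic_at c \<gamma> t"
  shows "geodesic_at c (\<lambda>s. \<gamma> (- s)) (- t)"
proof -
  obtain x' x'' where x': "\<forall>\<^sub>F s in nhds t. ((snd c \<circ> \<gamma>) has_vector_derivative x' s) (at s)"
    and x'': "(x' has_vector_derivative x'') (at t)" "x'' + christoffel A g c (snd c (\<gamma> t)) (x' t) (x' t) = 0"
    and cont: "\<forall>\<^sub>F s in nhds t. isCont \<gamma> s" and t: "\<gamma> t \<in> fst c"
    using \<gamma> unfolding geodesic_at_def by blast
  have lim: "filterlim uminus (nhds t) (nhds (- t))"
    using tendsto_minus[of "\<lambda>x. x" "- t" "nhds (- t)"] by (simp add: filterlim_ident)
  have minus: "(uminus has_vector_derivative - 1) (at s)" for s :: real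
    by (auto intro!: derivative_eq_intros)
  have rev: "((\<lambda>s. f (- s)) has_vector_derivative - f') (at s)"
    if "(f has_vector_derivative f') (at (- s))" for f :: "real \<Rightarrow> 'e" and f' s
    using vector_diff_chain_at[OF minus[of s] that] by (simp add: o_def)
  have 1: "\<forall>\<^sub>F s in nhds (- t). isCont (\<lambda>s. \<gamma> (- s)) s"
    using eventually_compose_filterlim[OF cont lim]
    by eventually_elim (rule isCont_o2[of _ uminus], auto)
  have 2: "\<forall>\<^sub>F s in nhds (- t). ((snd c \<circ> (\<lambda>s. \<gamma> (- s))) has_vector_derivative - x' (- s)) (at s)"
    using eventually_compose_filterlim[OF x' lim]
    by eventually_elim (use rev[of "snd c \<circ> \<gamma>"] in \<open>simp add: o_def\<close>)
  have 3: "((\<lambda>s. - x' (- s)) has_vector_derivative x'') (at (- t))"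
    using has_vector_derivative_minus[OF rev[of x' x'' "- t"]] x''(1) by simp
  have y: "snd c (\<gamma> t) \<in> snd c ` fst c" using t by blast
  have 4: "x'' + christoffel A g c (snd c (\<gamma> t)) (- x' t) (- x' t) = 0"
    using x''(2) unfolding geodesic_equation_iff[OF c y] EL_uminus[OF c y] .
  show ?thesis unfolding geodesic_at_def
    by (intro conjI exI[of _ "\<lambda>s. - x' (- s)"] exI[of _ x'']) (use t 1 2 3 4 in auto)
qed

text \<open>From right to left, the two functions demanded by \<open>geodesic\<close> on all of
  \<open>I\<close> are iterated vector derivatives; at each time the chart provided by the local
  condition is exchanged for the given one.\<close>

lemma geodesic_iff:
  "geodesic A g I \<gamma> \<longleftrightarrow> open I \<and> is_interval I \<and> I \<noteq> {} \<and> (\<forall>t\<in>I. \<exists>c\<in>A. geodesic_at c \<gamma> t)"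
proof
  assume geo: "geodesic A g I \<gamma>"
  then have I: "open I" "is_interval I" "I \<noteq> {}" "continuous_on I \<gamma>" unfolding geodesic_def by auto
  have "\<exists>c\<in>A. geodesic_at c \<gamma> t" if t: "t \<in> I" for t
  proof -
    obtain c where c: "c \<in> A" "\<gamma> t \<in> fst c" by (rule chart_cover)
    obtain x' x'' where x: "\<And>t. t \<in> I \<Longrightarrow> \<gamma> t \<in> fst c \<Longrightarrow>
        ((snd c \<circ> \<gamma>) has_vector_derivative x' t) (at t) \<and>
        (x' has_vector_derivative x'' t) (at t) \<and> x'' t + christoffel A g c (snd c (\<gamma> t)) (x' t) (x' t) = 0"
      using geo c(1) unfolding geodesic_def by blast
    have ev: "\<forall>\<^sub>F s in nhds t. s \<in> I" using I(1) t by (rule eventually_nhds_in_open)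
    have cont: "isCont \<gamma> s" if "s \<in> I" for s
      using I(1,4) that continuous_on_eq_continuous_at by blast
    have evc: "\<forall>\<^sub>F s in nhds t. \<gamma> s \<in> fst c"
      using isCont_eventually_in_open[OF cont[OF t] open_domain[OF c(1)] c(2)] .
    have "\<forall>\<^sub>F s in nhds t. ((snd c \<circ> \<gamma>) has_vector_derivative x' s) (at s)"
      using ev evc by eventually_elim (use x in blast)
    moreover have "\<forall>\<^sub>F s in nhds t. isCont \<gamma> s" using ev by eventually_elim (rule cont)
    ultimately have "geodesic_at c \<gamma> t" unfolding geodesic_at_def using x[OF t c(2)] c(2) by blast
    then show ?thesis using c(1) by blast
  qed
  then show "open I \<and> is_interval I \<and> I \<noteq> {} \<and> (\<forall>t\<in>I. \<exists>c\<in>A. geodesic_at c \<gamma> t)" using I by blast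
next
  assume R: "open I \<and> is_interval I \<and> I \<noteq> {} \<and> (\<forall>t\<in>I. \<exists>c\<in>A. geodesic_at c \<gamma> t)"
  have cont: "isCont \<gamma> t" if "t \<in> I" for t
    using R that eventually_nhds_x_imp_x unfolding geodesic_at_def by blast
  have "\<exists>x' x''. \<forall>t\<in>I. \<gamma> t \<in> fst c \<longrightarrow>
        ((snd c \<circ> \<gamma>) has_vector_derivative x' t) (at t) \<and>
        (x' has_vector_derivative x'' t) (at t) \<and>
        x'' t + christoffel A g c (snd c (\<gamma> t)) (x' t) (x' t) = 0" if c: "c \<in> A" for c
  proof -
    let ?x' = "\<lambda>s. vector_derivative (snd c \<circ> \<gamma>) (at s)"
    let ?x'' = "\<lambda>s. vector_derivative ?x' (at s)"
    have *: "((snd c \<circ> \<gamma>) has_vector_derivative ?x' t) (at t) \<and>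
        (?x' has_vector_derivative ?x'' t) (at t) \<and>
        ?x'' t + christoffel A g c (snd c (\<gamma> t)) (?x' t) (?x' t) = 0" if t: "t \<in> I" "\<gamma> t \<in> fst c" for t
    proof -
      obtain c\<^sub>0 where "geodesic_at c\<^sub>0 \<gamma> t" "c\<^sub>0 \<in> A" using R t(1) by blast
      then have "geodesic_at c \<gamma> t" using geodesic_at_transfer c t(2) by blast
      then obtain w where w: "\<forall>\<^sub>F s in nhds t. ((snd c \<circ> \<gamma>) has_vector_derivative ?x' s) (at s)"
        "(?x' has_vector_derivative w) (at t)" "w + christoffel A g c (snd c (\<gamma> t)) (?x' t) (?x' t) = 0"
        by (rule geodesic_at_vector_derivative)
      show ?thesis
        unfolding vector_derivative_at[OF w(2)] using eventually_nhds_x_imp_x[OF w(1)] w(2,3) by blast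
    qed
    show ?thesis by (rule exI[of _ ?x'], rule exI[of _ ?x''], intro ballI impI, rule *)
  qed
  then show "geodesic A g I \<gamma>"
    unfolding geodesic_def using R cont by (auto intro: continuous_at_imp_continuous_on)
qed

text \<open>Through this lemma it suffices to continue geodesics at right end points.\<close>

lemma geodesic_reverse:
  assumes "geodesic A g I \<gamma>" shows "geodesic A g (uminus ` I) (\<lambda>s. \<gamma> (- s))"
proof -
  have "\<exists>c\<in>A. geodesic_at c (\<lambda>s. \<gamma> (- s)) t" if "t \<in> uminus ` I" for t
    using that assms geodesic_at_reverse unfolding geodesic_iff by fastforce
  then show ?thesis
    using assms unfolding geodesic_iff by (simp add: open_negations)
qed

end

section \<open>Ordinary differential equations\<close>

text \<open>Banach's fixed point theorem on the bounded continuous functions of the whole line. For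
  the integral operator to be defined on that entire space, \<open>F\<close> is composed with the
  projection to the ball and time is clamped to the interval. The fixed point stays in the ball,
  where the projection is the identity, so it solves the original equation.\<close>

lemma picard_local_solution:
  fixes F :: "'x::euclidean_space \<Rightarrow> 'x"
  assumes F: "L-lipschitz_on (cball x\<^sub>0 r) F" and r: "r > 0"
  obtains \<epsilon> W where "\<epsilon> > 0" "W t\<^sub>0 = x\<^sub>0"
    "\<And>t. t \<in> {t\<^sub>0..t\<^sub>0+\<epsilon>} \<Longrightarrow> W t \<in> cball x\<^sub>0 r"
    "\<And>t. t \<in> {t\<^sub>0..t\<^sub>0+\<epsilon>} \<Longrightarrow> (W has_vector_derivative F (W t)) (at t within {t\<^sub>0..t\<^sub>0+\<epsilon>})"
proof -
  define \<pi> where "\<pi> = closest_point (cball x\<^sub>0 r)"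
  define FF where "FF x = F (\<pi> x)" for x
  have L: "L \<ge> 0" using F lipschitz_on_nonneg by blast
  have \<pi>: "\<pi> x \<in> cball x\<^sub>0 r" for x
    unfolding \<pi>_def by (rule closest_point_in_set) (use r in auto)
  have \<pi>_lip: "dist (\<pi> x) (\<pi> y) \<le> dist x y" for x y
    unfolding \<pi>_def by (rule closest_point_lipschitz) (use r in auto)
  have FF_lip: "dist (FF x) (FF y) \<le> L * dist x y" for x y
    unfolding FF_def using lipschitz_onD[OF F \<pi> \<pi>, of x y] mult_left_mono[OF \<pi>_lip[of x y] L]
    by linarith
  \<comment> \<open>A bound for the modified field on the whole space; the summand 1 makes it
    positive, so that division by it is safe.\<close>
  define M where "M = norm (F x\<^sub>0) + L * r + 1"
  have M: "M > 0" using L r unfolding M_def by (simp add: add_nonneg_pos)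
  have FF_bound: "norm (FF x) \<le> M" for x
  proof -
    have "dist (F (\<pi> x)) (F x\<^sub>0) \<le> L * dist (\<pi> x) x\<^sub>0"
      by (rule lipschitz_onD[OF F \<pi>]) (use r in auto)
    also have "\<dots> \<le> L * r" using \<pi>[of x] L by (intro mult_left_mono) (auto simp: dist_commute)
    finally have "norm (F (\<pi> x)) \<le> norm (F x\<^sub>0) + L * r"
      unfolding dist_norm using norm_triangle_ineq2[of "F (\<pi> x)" "F x\<^sub>0"] by linarith
    then show ?thesis unfolding FF_def M_def by linarith
  qed
  \<comment> \<open>The first entry makes the operator a contraction with factor 1/2, also when
    \<open>L\<close> is 0; the second keeps its values within distance \<open>r\<close> of the
    centre.\<close>
  define \<epsilon> where "\<epsilon> = min (1 / (2 * (L + 1))) (r / M)"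
  have \<epsilon>: "\<epsilon> > 0" using L M r unfolding \<epsilon>_def by simp
  have \<epsilon>L: "\<epsilon> * L \<le> 1/2"
  proof -
    have "\<epsilon> * L \<le> (1 / (2 * (L + 1))) * L" unfolding \<epsilon>_def using L by (intro mult_right_mono) auto
    also have "\<dots> \<le> 1/2" using L by (simp add: field_simps)
    finally show ?thesis .
  qed
  have \<epsilon>M: "M * \<epsilon> \<le> r"
  proof -
    have "M * \<epsilon> \<le> M * (r / M)" unfolding \<epsilon>_def using M by (intro mult_left_mono) auto
    then show ?thesis using M by simp
  qed
  let ?I = "{t\<^sub>0..t\<^sub>0+\<epsilon>}"
  define cl where "cl t = max t\<^sub>0 (min t (t\<^sub>0 + \<epsilon>))" for t
  have cl: "cl t \<in> ?I" for t using \<epsilon> unfolding cl_def by auto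
  have cl_id: "cl t = t" if "t \<in> ?I" for t using that unfolding cl_def by auto
  have cl_cont: "continuous_on UNIV cl" unfolding cl_def by (intro continuous_intros)
  have FF_cont: "continuous_on X (\<lambda>s. FF (apply_bcontfun f s))" for X and f :: "real \<Rightarrow>\<^sub>C 'x"
  proof -
    have "continuous_on UNIV FF"
      using FF_lip by (intro lipschitz_on_continuous_on[of L] lipschitz_onI L) auto
    then show ?thesis by (rule continuous_on_compose2) auto
  qed
  define \<Phi> where "\<Phi> f t = x\<^sub>0 + integral {t\<^sub>0..cl t} (\<lambda>s. FF (apply_bcontfun f s))" for f :: "real \<Rightarrow>\<^sub>C 'x" and t
  have \<Phi>_near: "norm (\<Phi> f t - x\<^sub>0) \<le> r" for f t
  proof -
    have "norm (integral {t\<^sub>0..cl t} (\<lambda>s. FF (apply_bcontfun f s))) \<le> M * (cl t - t\<^sub>0)"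
      using cl[of t] FF_bound by (intro integral_bound FF_cont) auto
    also have "\<dots> \<le> M * \<epsilon>" using cl[of t] M by (intro mult_left_mono) auto
    finally show ?thesis unfolding \<Phi>_def using \<epsilon>M by simp
  qed
  have \<Phi>_cont: "continuous_on UNIV (\<Phi> f)" for f
  proof -
    have "continuous_on ?I (\<lambda>x. integral {t\<^sub>0..x} (\<lambda>s. FF (apply_bcontfun f s)))"
      by (intro indefinite_integral_continuous_1 integrable_continuous_real FF_cont)
    then have "continuous_on UNIV (\<lambda>t. integral {t\<^sub>0..cl t} (\<lambda>s. FF (apply_bcontfun f s)))"
      by (rule continuous_on_compose2[OF _ cl_cont]) (use cl in auto)
    then show ?thesis unfolding \<Phi>_def by (intro continuous_intros)
  qed
  have \<Phi>_bcontfun: "\<Phi> f \<in> bcontfun" for f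
  proof (rule bcontfun_normI[OF \<Phi>_cont])
    show "norm (\<Phi> f t) \<le> norm x\<^sub>0 + r" for t
      using \<Phi>_near[of f t] norm_triangle_ineq2[of "\<Phi> f t" x\<^sub>0] by linarith
  qed
  have contr: "dist (Bcontfun (\<Phi> f)) (Bcontfun (\<Phi> h)) \<le> 1/2 * dist f h" for f h
  proof (rule dist_bound)
    fix t
    have "dist (\<Phi> f t) (\<Phi> h t)
      = norm (integral {t\<^sub>0..cl t} (\<lambda>s. FF (apply_bcontfun f s) - FF (apply_bcontfun h s)))"
      unfolding \<Phi>_def dist_norm
      by (subst integral_diff) (auto intro!: integrable_continuous_real FF_cont)
    also have "\<dots> \<le> (L * dist f h) * (cl t - t\<^sub>0)"
    proof (rule integral_bound)
      show "norm (FF (apply_bcontfun f s) - FF (apply_bcontfun h s)) \<le> L * dist f h" for s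
        using FF_lip[of "apply_bcontfun f s" "apply_bcontfun h s"]
          mult_left_mono[OF dist_bounded[of f s h] L] unfolding dist_norm by linarith
    qed (use cl[of t] in \<open>auto intro!: continuous_intros FF_cont\<close>)
    also have "\<dots> \<le> (L * dist f h) * \<epsilon>" using cl[of t] L by (intro mult_left_mono) auto
    also have "\<dots> = (\<epsilon> * L) * dist f h" by simp
    also have "\<dots> \<le> 1/2 * dist f h" using \<epsilon>L by (intro mult_right_mono) auto
    finally show "dist (apply_bcontfun (Bcontfun (\<Phi> f)) t) (apply_bcontfun (Bcontfun (\<Phi> h)) t) \<le> 1/2 * dist f h"
      by (simp add: Bcontfun_inverse[OF \<Phi>_bcontfun])
  qed
  obtain f where f: "Bcontfun (\<Phi> f) = f"
    using banach_fix_type[of "1/2" "\<lambda>f. Bcontfun (\<Phi> f)"] contr by auto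
  define W where "W = apply_bcontfun f"
  have W: "W t = \<Phi> f t" for t
    unfolding W_def using f Bcontfun_inverse[OF \<Phi>_bcontfun, of f] by metis
  have Wint: "W t = x\<^sub>0 + integral {t\<^sub>0..cl t} (\<lambda>s. FF (W s))" for t
    using W[of t] unfolding \<Phi>_def W_def .
  have Wr: "W t \<in> cball x\<^sub>0 r" for t
    using \<Phi>_near[of f t] by (simp add: W dist_norm norm_minus_commute)
  then have FFW: "FF (W t) = F (W t)" for t unfolding FF_def \<pi>_def by (simp only: closest_point_self)
  show thesis
  proof (rule that[of \<epsilon> W])
    show "W t\<^sub>0 = x\<^sub>0" using cl_id[of t\<^sub>0] \<epsilon> by (simp add: W \<Phi>_def)
    fix t assume t: "t \<in> ?I"
    have "((\<lambda>u. integral {t\<^sub>0..u} (\<lambda>s. FF (W s))) has_vector_derivative FF (W t)) (at t within ?I)"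
      using FF_cont t unfolding W_def by (rule integral_has_vector_derivative)
    then have "((\<lambda>u. x\<^sub>0 + integral {t\<^sub>0..u} (\<lambda>s. FF (W s))) has_vector_derivative F (W t)) (at t within ?I)"
      by (auto intro!: derivative_eq_intros simp: FFW)
    then show "(W has_vector_derivative F (W t)) (at t within ?I)"
      by (rule has_vector_derivative_transform[OF t, rotated]) (metis Wint cl_id)
  qed (use \<epsilon> Wr in auto)
qed

text \<open>The old solution and a Picard solution are glued at \<open>b\<close>. The result is
  continuous, but differentiability at \<open>b\<close> itself is not yet clear. The fundamental
  theorem of calculus tolerates this one point and gives the integral equation across
  \<open>b\<close>; differentiating it supplies the missing derivative.\<close>

lemma ode_continuation:
  fixes F :: "'x::euclidean_space \<Rightarrow> 'x"
  assumes F: "L-lipschitz_on (cball x\<^sub>0 r) F" and r: "r > 0" and ab: "a < b"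
    and lim: "(w \<longlongrightarrow> x\<^sub>0) (at_left b)"
    and w: "\<And>t. t \<in> {a<..<b} \<Longrightarrow> (w has_vector_derivative F (w t)) (at t)"
  obtains s \<epsilon> W where "a \<le> s" "s < b" "\<epsilon> > 0" "\<And>t. t < b \<Longrightarrow> W t = w t"
    "\<And>t. t \<in> {s<..<b+\<epsilon>} \<Longrightarrow> W t \<in> cball x\<^sub>0 r"
    "\<And>t. t \<in> {s<..<b+\<epsilon>} \<Longrightarrow> (W has_vector_derivative F (W t)) (at t)"
proof -
  obtain \<epsilon> V where \<epsilon>: "\<epsilon> > 0" and Vb: "V b = x\<^sub>0" and Vr: "\<And>t. t \<in> {b..b+\<epsilon>} \<Longrightarrow> V t \<in> cball x\<^sub>0 r"
    and V: "\<And>t. t \<in> {b..b+\<epsilon>} \<Longrightarrow> (V has_vector_derivative F (V t)) (at t within {b..b+\<epsilon>})"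
    using picard_local_solution[OF F r, of b] by metis
  have "\<forall>\<^sub>F t in at_left b. w t \<in> cball x\<^sub>0 r"
    using topological_tendstoD[OF lim open_ball, of x\<^sub>0 r] r by (auto elim: eventually_mono)
  then obtain s0 where s0: "s0 < b" "\<And>t. s0 < t \<Longrightarrow> t < b \<Longrightarrow> w t \<in> cball x\<^sub>0 r"
    unfolding eventually_at_left_field by blast
  define s where "s = max a s0"
  define W where "W t = (if t < b then w t else V t)" for t
  have s: "a \<le> s" "s < b" using s0 ab unfolding s_def by auto
  have Wr: "W t \<in> cball x\<^sub>0 r" if "t \<in> {s<..<b+\<epsilon>}" for t
    using that s0(2)[of t] Vr[of t] unfolding W_def s_def by auto
  have W1: "(W has_vector_derivative F (W t)) (at t)" if "t \<in> {s<..<b}" for t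
  proof -
    have "(w has_vector_derivative F (w t)) (at t)" using w that s by auto
    then have "(W has_vector_derivative F (w t)) (at t)"
      by (rule has_vector_derivative_transform_within_open[of _ _ _ "{..<b}"]) (use that in \<open>auto simp: W_def\<close>)
    then show ?thesis using that by (simp add: W_def)
  qed
  have W2: "(W has_vector_derivative F (W t)) (at t)" if "t \<in> {b<..<b+\<epsilon>}" for t
  proof -
    have "(V has_vector_derivative F (V t)) (at t within {b..b+\<epsilon>})" using V that by auto
    then have "(V has_vector_derivative F (V t)) (at t)"
      using that by (simp add: at_within_Icc_at)
    then have "(W has_vector_derivative F (V t)) (at t)"
      by (rule has_vector_derivative_transform_within_open[of _ _ _ "{b<..}"]) (use that in \<open>auto simp: W_def\<close>)
    then show ?thesis using that by (simp add: W_def)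
  qed
  have Wb: "isCont W b"
  proof -
    have "(W \<longlongrightarrow> x\<^sub>0) (at_left b)"
      using lim by (rule Lim_transform_eventually) (use lt_ex[of b] in \<open>auto simp: eventually_at_left_field W_def\<close>)
    moreover have "(V \<longlongrightarrow> V b) (at_right b)"
      using has_vector_derivative_continuous[OF V[of b]] \<epsilon>
      by (simp add: continuous_within at_within_Icc_at_right)
    then have "(W \<longlongrightarrow> x\<^sub>0) (at_right b)"
      unfolding Vb by (rule Lim_transform_eventually) (use gt_ex[of b] in \<open>auto simp: eventually_at_right_field W_def\<close>)
    ultimately show ?thesis
      unfolding isCont_def using filterlim_split_at by (auto simp: W_def Vb)
  qed
  have Wcont: "continuous_on {s<..<b+\<epsilon>} W"
  proof (rule continuous_at_imp_continuous_on, intro ballI)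
    fix t assume "t \<in> {s<..<b+\<epsilon>}"
    then consider "t \<in> {s<..<b}" | "t = b" | "t \<in> {b<..<b+\<epsilon>}" by fastforce
    then show "isCont W t" using W1 W2 Wb has_vector_derivative_continuous by cases blast+
  qed
  have FWcont: "continuous_on {s<..<b+\<epsilon>} (\<lambda>t. F (W t))"
    by (rule continuous_on_compose2[OF lipschitz_on_continuous_on[OF F] Wcont]) (use Wr in blast)
  have "(W has_vector_derivative F (W t)) (at t)" if t: "t \<in> {s<..<b+\<epsilon>}" for t
  proof -
    obtain l u where lu: "s < l" "l < t" "t < u" "u < b + \<epsilon>"
      using t dense[of s t] dense[of t "b + \<epsilon>"] by auto
    have sub: "{l..u} \<subseteq> {s<..<b+\<epsilon>}" using lu by auto
    have "((\<lambda>t. F (W t)) has_integral (W v - W l)) {l..v}" if "v \<in> {l..u}" for v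
    proof (rule fundamental_theorem_of_calculus_interior_strong[of "{b}"])
      show "(W has_vector_derivative F (W x)) (at x)" if "x \<in> {l<..<v} - {b}" for x
        using W1[of x] W2[of x] that \<open>v \<in> {l..u}\<close> lu by force
      show "continuous_on {l..v} W" by (rule continuous_on_subset[OF Wcont]) (use sub that in auto)
    qed (use that in auto)
    from integral_unique[OF this]
    have eq: "W v = W l + integral {l..v} (\<lambda>t. F (W t))" if "v \<in> {l..u}" for v
      using that by simp
    have "((\<lambda>v. integral {l..v} (\<lambda>t. F (W t))) has_vector_derivative F (W t)) (at t within {l..u})"
      using continuous_on_subset[OF FWcont sub] lu by (intro integral_has_vector_derivative) auto
    then have "((\<lambda>v. W l + integral {l..v} (\<lambda>t. F (W t))) has_vector_derivative F (W t)) (at t within {l..u})"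
      by (auto intro!: derivative_eq_intros)
    then have "(W has_vector_derivative F (W t)) (at t within {l..u})"
      using has_vector_derivative_transform[of t "{l..u}" W, OF _ eq] lu by simp
    then show ?thesis using lu by (simp add: at_within_Icc_at)
  qed
  then show thesis using that[of s \<epsilon> W] s \<epsilon> Wr by (simp add: W_def)
qed

section \<open>Stability of bounded Lipschitz functions\<close>

text \<open>Products of bounded Lipschitz functions are Lipschitz, which makes the class stable under the
  polynomial expressions in metric coefficients that form the geodesic equation.\<close>

definition bounded_lipschitz :: "'a::metric_space set \<Rightarrow> ('a \<Rightarrow> 'b::real_normed_vector) \<Rightarrow> bool" where
  "bounded_lipschitz X f \<longleftrightarrow> bounded (f ` X) \<and> (\<exists>L. L-lipschitz_on X f)"

lemma bounded_lipschitz_const: "bounded_lipschitz X (\<lambda>x. c)"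
  unfolding bounded_lipschitz_def using lipschitz_on_constant by (auto simp: image_constant_conv)

lemma bounded_lipschitz_add:
  "bounded_lipschitz X f \<Longrightarrow> bounded_lipschitz X g \<Longrightarrow> bounded_lipschitz X (\<lambda>x. f x + g x)"
  unfolding bounded_lipschitz_def using lipschitz_on_add bounded_plus_comp by blast

lemma bounded_lipschitz_sum:
  "(\<And>i. i \<in> I \<Longrightarrow> bounded_lipschitz X (f i)) \<Longrightarrow> bounded_lipschitz X (\<lambda>x. \<Sum>i\<in>I. f i x)"
  by (induction I rule: infinite_finite_induct) (auto intro: bounded_lipschitz_const bounded_lipschitz_add)

lemma bounded_lipschitz_scaleR:
  fixes g :: "'a::metric_space \<Rightarrow> 'b::real_normed_vector"
  assumes "bounded_lipschitz X f" "bounded_lipschitz X g"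
  shows "bounded_lipschitz X (\<lambda>x. f x *\<^sub>R g x)"
proof -
  obtain Bf Lf where f: "\<forall>z\<in>f ` X. norm z \<le> Bf" "Lf-lipschitz_on X f"
    using assms(1) unfolding bounded_lipschitz_def bounded_iff by blast
  obtain Bg Lg where g: "\<forall>z\<in>g ` X. norm z \<le> Bg" "Lg-lipschitz_on X g"
    using assms(2) unfolding bounded_lipschitz_def bounded_iff by blast
  have B: "norm (f x) \<le> Bf" "norm (g x) \<le> Bg" if "x \<in> X" for x using f(1) g(1) that by auto
  note L = f(2) g(2)
  define C where "C = max Bf 0 * Lg + max Bg 0 * Lf"
  have nn: "0 \<le> Lf" "0 \<le> Lg" using L lipschitz_on_nonneg by auto
  have "norm (f x *\<^sub>R g x) \<le> max Bf 0 * max Bg 0" if "x \<in> X" for x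
    using B[OF that] by (auto intro!: mult_mono)
  then have 1: "bounded ((\<lambda>x. f x *\<^sub>R g x) ` X)" unfolding bounded_iff by blast
  have "C-lipschitz_on X (\<lambda>x. f x *\<^sub>R g x)"
  proof (rule lipschitz_onI)
    fix x y assume xy: "x \<in> X" "y \<in> X"
    have "f x *\<^sub>R g x - f y *\<^sub>R g y = f x *\<^sub>R (g x - g y) + (f x - f y) *\<^sub>R g y"
      by (simp add: algebra_simps)
    then have "norm (f x *\<^sub>R g x - f y *\<^sub>R g y) \<le> \<bar>f x\<bar> * norm (g x - g y) + \<bar>f x - f y\<bar> * norm (g y)"
      using norm_triangle_ineq[of "f x *\<^sub>R (g x - g y)" "(f x - f y) *\<^sub>R g y"] by simp
    also have "\<dots> \<le> max Bf 0 * (Lg * dist x y) + (Lf * dist x y) * max Bg 0"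
      using B(1)[OF xy(1)] B(2)[OF xy(2)] lipschitz_onD[OF L(1) xy] lipschitz_onD[OF L(2) xy] nn
      by (intro add_mono mult_mono) (auto simp: dist_norm)
    finally show "dist (f x *\<^sub>R g x) (f y *\<^sub>R g y) \<le> C * dist x y"
      unfolding C_def dist_norm[of "f x *\<^sub>R g x"] by (simp add: algebra_simps)
  qed (use nn in \<open>simp add: C_def\<close>)
  then show ?thesis using 1 unfolding bounded_lipschitz_def by blast
qed

lemma bounded_lipschitz_mult:
  "bounded_lipschitz X f \<Longrightarrow> bounded_lipschitz X g \<Longrightarrow> bounded_lipschitz X (\<lambda>x. f x * g x :: real)"
  using bounded_lipschitz_scaleR[of X f g] by simp

lemma bounded_lipschitz_bounded_linear:
  assumes "bounded_linear f" "bounded X" shows "bounded_lipschitz X f"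
proof -
  obtain K where K: "K \<ge> 0" "\<And>x. norm (f x) \<le> norm x * K"
    using bounded_linear.nonneg_bounded[OF assms(1)] by blast
  have "norm (f x - f y) \<le> K * norm (x - y)" for x y
    using K(2)[of "x - y"] linear_diff[OF bounded_linear.linear[OF assms(1)]] by (simp add: mult.commute)
  then have "K-lipschitz_on X f" using K(1) by (auto intro!: lipschitz_onI simp: dist_norm)
  then show ?thesis
    unfolding bounded_lipschitz_def using bounded_linear_image[OF assms(2,1)] by blast
qed

lemma bounded_lipschitz_smooth:
  fixes f :: "'e::euclidean_space \<Rightarrow> 'f::real_normed_vector"
  assumes "smooth_on S f" "convex K" "compact K" "K \<subseteq> S"
  shows "bounded_lipschitz K f"
  using smooth_on_lipschitz[OF assms] compact_imp_bounded[OF compact_continuous_image[OF _ assms(3)]]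
    continuous_on_subset[OF smooth_on_continuous_on[OF assms(1)] assms(4)]
  unfolding bounded_lipschitz_def by metis

lemma bounded_lipschitz_fst:
  assumes "bounded_lipschitz K f" shows "bounded_lipschitz (K \<times> R) (\<lambda>x. f (fst x))"
proof -
  obtain L where L: "L-lipschitz_on K f" and b: "bounded (f ` K)"
    using assms unfolding bounded_lipschitz_def by blast
  have "L-lipschitz_on (K \<times> R) (\<lambda>x. f (fst x))"
  proof (rule lipschitz_onI)
    fix x y assume "x \<in> K \<times> R" "y \<in> K \<times> R"
    then have "dist (f (fst x)) (f (fst y)) \<le> L * dist (fst x) (fst y)" using lipschitz_onD[OF L] by auto
    also have "\<dots> \<le> L * dist x y"
      using lipschitz_on_nonneg[OF L] by (intro mult_left_mono dist_fst_le)
    finally show "dist (f (fst x)) (f (fst y)) \<le> L * dist x y" .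
  qed (use lipschitz_on_nonneg[OF L] in auto)
  moreover have "bounded ((\<lambda>x. f (fst x)) ` (K \<times> R))" by (rule bounded_subset[OF b]) auto
  ultimately show ?thesis unfolding bounded_lipschitz_def by blast
qed

section \<open>Continuation of geodesics\<close>

lemma bounded_lipschitz_cong:
  assumes "bounded_lipschitz X f" "\<And>x. x \<in> X \<Longrightarrow> f x = g x" shows "bounded_lipschitz X g"
proof -
  have "f ` X = g ` X" using assms(2) by (rule image_cong[OF refl])
  then show ?thesis
    using assms(1) lipschitz_on_transform[of _ X f g] assms(2) unfolding bounded_lipschitz_def by metis
qed

lemma bounded_lipschitz_minus: "bounded_lipschitz X f \<Longrightarrow> bounded_lipschitz X (\<lambda>x. - f x)"
  using bounded_lipschitz_scaleR[OF bounded_lipschitz_const[of X "- 1 :: real"], of f] by simp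

lemma lipschitz_of_bounded_vector_derivative:
  fixes f :: "real \<Rightarrow> 'b::real_normed_vector"
  assumes "a < b" and f: "\<And>t. t \<in> {a<..<b} \<Longrightarrow> (f has_vector_derivative f' t) (at t)"
    and B: "\<And>t. t \<in> {a<..<b} \<Longrightarrow> norm (f' t) \<le> B"
  shows "B-lipschitz_on {a<..<b} f"
proof (rule lipschitz_onI)
  show "dist (f x) (f y) \<le> B * dist x y" if "x \<in> {a<..<b}" "y \<in> {a<..<b}" for x y
    unfolding dist_norm
  proof (rule differentiable_bound)
    fix t assume t: "t \<in> {a<..<b}"
    show "(f has_derivative (\<lambda>h. h *\<^sub>R f' t)) (at t within {a<..<b})"
      using f[OF t] by (simp add: has_vector_derivative_def has_derivative_at_withinI)
    show "onorm (\<lambda>h. h *\<^sub>R f' t) \<le> B"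
      by (rule onorm_le) (use B[OF t] in \<open>simp add: mult_left_mono mult.commute[of B]\<close>)
  qed (use that in auto)
  obtain t where "t \<in> {a<..<b}" using dense[OF assms(1)] by auto
  then show "0 \<le> B" using B norm_ge_zero order_trans by blast
qed

text \<open>Uniform continuity extends \<open>f\<close> to the closed interval, and the value of the
  extension at \<open>b\<close> is the limit.\<close>

lemma lipschitz_tendsto_at_left:
  fixes f :: "real \<Rightarrow> 'b::complete_space"
  assumes "B-lipschitz_on {a<..<b} f" "a < b"
  obtains l where "(f \<longlongrightarrow> l) (at_left b)"
proof -
  obtain g where g: "uniformly_continuous_on (closure {a<..<b}) g" "\<And>x. x \<in> {a<..<b} \<Longrightarrow> f x = g x"
    using uniformly_continuous_on_extension_on_closure[OF lipschitz_on_uniformly_continuous[OF assms(1)]]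
    by metis
  have "continuous_on {a..b} g" using uniformly_continuous_imp_continuous[OF g(1)] assms(2) by simp
  then have "(g \<longlongrightarrow> g b) (at_left b)"
    using assms(2) by (simp add: continuous_on_Icc_at_leftD)
  moreover have "\<forall>\<^sub>F x in at_left b. g x = f x"
    using g(2) assms(2) by (intro eventually_at_leftI[of a]) auto
  ultimately have "(f \<longlongrightarrow> g b) (at_left b)" by (rule Lim_transform_eventually)
  then show thesis by (rule that)
qed

context semi_riem
begin

lemma continuous_on_metric_coord:
  assumes "c \<in> A" "continuous_on T y" "continuous_on T v" "continuous_on T w"
    "\<And>t. t \<in> T \<Longrightarrow> y t \<in> snd c ` fst c"
  shows "continuous_on T (\<lambda>t. G c (y t) (v t) (w t))"
proof -
  have "continuous_on T (\<lambda>t. G c (y t) i j)" for i j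
    by (rule continuous_on_compose2[OF smooth_on_continuous_on[OF smooth_metric_coord[OF assms(1)]] assms(2)])
      (use assms(5) in blast)
  then have "continuous_on T (\<lambda>t. \<Sum>i\<in>Basis. \<Sum>j\<in>Basis. (v t \<bullet> i) * (w t \<bullet> j) * G c (y t) i j)"
    using assms(3,4) by (intro continuous_intros)
  then show ?thesis
    by (rule continuous_on_cong[THEN iffD1, OF refl, rotated])
      (rule metric_coord_expand[symmetric, OF assms(1,5)])
qed

text \<open>The minimum over \<open>K\<close> times the unit sphere is positive by nondegeneracy.
  The bound plays the part of a uniform estimate for the inverse metric.\<close>

lemma flat_lower_bound:
  assumes c: "c \<in> A" and K: "compact K" "K \<subseteq> snd c ` fst c"
  obtains \<mu> where "\<mu> > 0" "\<And>y z. y \<in> K \<Longrightarrow> \<mu> * norm z \<le> norm (flat c y z)"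
proof (cases "K = {}")
  case True
  then show thesis using that[of 1] by simp
next
  case False
  let ?S = "sphere 0 1 :: 'e set"
  obtain b :: 'e where "b \<in> Basis" using nonempty_Basis by blast
  then have S: "K \<times> ?S \<noteq> {}" using False by (auto intro: exI[of _ b])
  have cont: "continuous_on (K \<times> ?S) (\<lambda>x. norm (flat c (fst x) (snd x)))"
    unfolding flat_def by (intro continuous_intros continuous_on_metric_coord c) (use K(2) in auto)
  have "compact (K \<times> ?S)" using K(1) by (intro compact_Times) auto
  from continuous_attains_inf[OF this S cont] obtain y0 z0 where yz: "y0 \<in> K" "norm z0 = 1"
    and min: "\<And>y z. y \<in> K \<Longrightarrow> norm z = 1 \<Longrightarrow> norm (flat c y0 z0) \<le> norm (flat c y z)"
    by auto
  have l: "linear (flat c y)" if "y \<in> K" for y using linear_flat[OF c] that K(2) by blast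
  have "flat c y0 z0 \<noteq> 0"
    using inj_flat[OF c, of y0] yz K(2) linear_injective_0[OF l[OF yz(1)]] by auto
  moreover have "norm (flat c y0 z0) * norm z \<le> norm (flat c y z)" if "y \<in> K" for y z
  proof (cases "z = 0")
    case False
    then have "norm (flat c y0 z0) \<le> norm (flat c y ((1 / norm z) *\<^sub>R z))"
      using that by (intro min) auto
    also have "\<dots> = norm (flat c y z) / norm z" by (simp add: linear_scale[OF l[OF that]])
    finally show ?thesis using False by (simp add: pos_le_divide_eq)
  qed simp
  ultimately show thesis by (intro that[of "norm (flat c y0 z0)"]) simp_all
qed

text \<open>The lowered vector \<open>\<rho>\<close> is polynomial in the velocity with smooth
  coefficients, hence in the stable class. Raising the index is done by estimates:
  \<open>\<mu>\<close> times the norm of \<open>?\<Gamma> x\<close> is at most the norm of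
  \<open>\<rho> x\<close>, and the difference of two values of \<open>?\<Gamma>\<close>, lowered at
  the first point, is the difference of the values of \<open>\<rho>\<close> minus the effect of
  lowering the second value at two different points.\<close>

lemma bounded_lipschitz_christoffel:
  assumes c: "c \<in> A" and K: "convex K" "compact K" "K \<subseteq> snd c ` fst c"
  shows "bounded_lipschitz (K \<times> cball 0 R) (\<lambda>x. christoffel A g c (fst x) (snd x) (snd x))"
proof -
  let ?X = "K \<times> cball (0::'e) R"
  let ?\<Gamma> = "\<lambda>x. christoffel A g c (fst x) (snd x) (snd x)"
  obtain \<mu> where \<mu>: "\<mu> > 0" "\<And>y z. y \<in> K \<Longrightarrow> \<mu> * norm z \<le> norm (flat c y z)"
    by (rule flat_lower_bound[OF c K(2,3)]) blast
  have "bounded_lipschitz K (\<lambda>y. flat c y i)" for i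
    unfolding flat_def
    by (intro bounded_lipschitz_sum bounded_lipschitz_scaleR bounded_lipschitz_const
        bounded_lipschitz_smooth[OF smooth_metric_coord[OF c] K])
  then obtain \<Lambda> where \<Lambda>: "\<And>i. (\<Lambda> i)-lipschitz_on K (\<lambda>y. flat c y i)"
    unfolding bounded_lipschitz_def by metis
  define \<Lambda>s where "\<Lambda>s = (\<Sum>i\<in>(Basis::'e set). \<Lambda> i)"
  have \<Lambda>s: "\<Lambda>s \<ge> 0" unfolding \<Lambda>s_def using \<Lambda> lipschitz_on_nonneg by (intro sum_nonneg) blast
  have flat_lip: "norm (flat c y z - flat c y' z) \<le> \<Lambda>s * dist y y' * norm z" if y: "y \<in> K" "y' \<in> K" for y y' z
  proof -
    have e: "flat c y z = (\<Sum>i\<in>Basis. (z \<bullet> i) *\<^sub>R flat c y i)" if "y \<in> K" for y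
      using linear_euclidean_representation[OF linear_flat[OF c]] that K(3) by blast
    have "norm (flat c y z - flat c y' z) = norm (\<Sum>i\<in>Basis. (z \<bullet> i) *\<^sub>R (flat c y i - flat c y' i))"
      by (simp only: e[OF y(1)] e[OF y(2)] scaleR_diff_right sum_subtractf)
    also have "\<dots> \<le> (\<Sum>i\<in>Basis. norm z * (\<Lambda> i * dist y y'))"
    proof (rule order_trans[OF norm_sum sum_mono])
      fix i :: 'e assume i: "i \<in> Basis"
      have "norm (flat c y i - flat c y' i) \<le> \<Lambda> i * dist y y'"
        using lipschitz_onD[OF \<Lambda> y, of i] by (simp add: dist_norm)
      then show "norm ((z \<bullet> i) *\<^sub>R (flat c y i - flat c y' i)) \<le> norm z * (\<Lambda> i * dist y y')"
        using Basis_le_norm[OF i, of z] by (auto intro!: mult_mono)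
    qed
    also have "\<dots> = \<Lambda>s * dist y y' * norm z"
      unfolding \<Lambda>s_def by (simp add: sum_distrib_right sum_distrib_left mult_ac)
    finally show ?thesis .
  qed
  define \<rho> where "\<rho> x = flat c (fst x) (?\<Gamma> x)" for x
  have inn: "bounded_lipschitz ?X (\<lambda>x. snd x \<bullet> i)" for i
    by (intro bounded_lipschitz_bounded_linear bounded_Times compact_imp_bounded[OF K(2)])
      (auto intro: bounded_linear_compose[OF bounded_linear_inner_left bounded_linear_snd])
  have dg: "bounded_lipschitz ?X (\<lambda>x. DG c (fst x) k i j)" for k i j
    by (rule bounded_lipschitz_fst)
      (rule bounded_lipschitz_smooth[OF smooth_on_fd[OF smooth_metric_coord[OF c]] K])
  \<comment> \<open>The expression is \<open>\<rho>\<close> with all vectors expanded in the basis,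
    so that only coordinates of the velocity and derivatives of fixed metric coefficients
    remain.\<close>
  have "bounded_lipschitz ?X (\<lambda>x. \<Sum>b\<in>Basis. ((\<Sum>k\<in>Basis. (snd x \<bullet> k) * (\<Sum>i\<in>Basis. \<Sum>j\<in>Basis. (snd x \<bullet> i) * (b \<bullet> j) * DG c (fst x) k i j))
      + (- 1 / 2) * (\<Sum>i\<in>Basis. \<Sum>j\<in>Basis. (snd x \<bullet> i) * (snd x \<bullet> j) * DG c (fst x) b i j)) *\<^sub>R b)"
    by (intro bounded_lipschitz_sum bounded_lipschitz_add bounded_lipschitz_scaleR
        bounded_lipschitz_mult bounded_lipschitz_const inn dg)
  then have \<rho>: "bounded_lipschitz ?X \<rho>"
  proof (rule bounded_lipschitz_cong)
    fix x assume "x \<in> ?X"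
    then have y: "fst x \<in> snd c ` fst c" using K(3) by auto
    have 1: "DG c (fst x) (snd x) (snd x) b = (\<Sum>k\<in>Basis. (snd x \<bullet> k) * (\<Sum>i\<in>Basis. \<Sum>j\<in>Basis. (snd x \<bullet> i) * (b \<bullet> j) * DG c (fst x) k i j))" for b
      using linear_euclidean_representation[OF metric_coord_deriv_linear1[OF c y, of "snd x" b], of "snd x"]
      by (simp only: metric_coord_deriv_expand[OF c y, of "snd x" b, symmetric] real_scaleR_def)
    show "(\<Sum>b\<in>Basis. ((\<Sum>k\<in>Basis. (snd x \<bullet> k) * (\<Sum>i\<in>Basis. \<Sum>j\<in>Basis. (snd x \<bullet> i) * (b \<bullet> j) * DG c (fst x) k i j))
      + (- 1 / 2) * (\<Sum>i\<in>Basis. \<Sum>j\<in>Basis. (snd x \<bullet> i) * (snd x \<bullet> j) * DG c (fst x) b i j)) *\<^sub>R b) = \<rho> x"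
      unfolding \<rho>_def flat_def christoffel_metric[OF c y] 1
      by (simp only: metric_coord_deriv_expand[OF c y, of "snd x" "snd x", symmetric]) simp
  qed
  obtain B L where B: "\<forall>z\<in>\<rho> ` ?X. norm z \<le> B" and L: "L-lipschitz_on ?X \<rho>"
    using \<rho> unfolding bounded_lipschitz_def bounded_iff by blast
  have bound: "norm (?\<Gamma> x) \<le> B / \<mu>" if "x \<in> ?X" for x
  proof -
    have "\<mu> * norm (?\<Gamma> x) \<le> norm (\<rho> x)" unfolding \<rho>_def by (rule \<mu>(2)) (use that in auto)
    also have "\<dots> \<le> B" using B that by blast
    finally show ?thesis using \<mu>(1) by (simp add: field_simps)
  qed
  \<comment> \<open>\<open>B / \<mu>\<close> bounds \<open>?\<Gamma>\<close> only at points of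
    \<open>?X\<close>; the maximum with 0 keeps \<open>C\<close> nonnegative even if there are
    none.\<close>
  define C where "C = (L + \<Lambda>s * max (B / \<mu>) 0) / \<mu>"
  have "C-lipschitz_on ?X ?\<Gamma>"
  proof (rule lipschitz_onI)
    fix x x' assume x: "x \<in> ?X" "x' \<in> ?X"
    have y: "fst x \<in> K" "fst x' \<in> K" using x by auto
    have "\<mu> * norm (?\<Gamma> x - ?\<Gamma> x') \<le> norm (flat c (fst x) (?\<Gamma> x - ?\<Gamma> x'))" by (rule \<mu>(2)[OF y(1)])
    also have "flat c (fst x) (?\<Gamma> x - ?\<Gamma> x') = \<rho> x - \<rho> x' - (flat c (fst x) (?\<Gamma> x') - flat c (fst x') (?\<Gamma> x'))"
      unfolding \<rho>_def using linear_diff[OF linear_flat[OF c]] y(1) K(3) by auto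
    also have "norm \<dots> \<le> norm (\<rho> x - \<rho> x') + norm (flat c (fst x) (?\<Gamma> x') - flat c (fst x') (?\<Gamma> x'))"
      by (rule norm_triangle_ineq4)
    also have "\<dots> \<le> L * dist x x' + \<Lambda>s * dist x x' * max (B / \<mu>) 0"
    proof (rule add_mono)
      show "norm (\<rho> x - \<rho> x') \<le> L * dist x x'" using lipschitz_onD[OF L x] by (simp add: dist_norm)
      have "norm (flat c (fst x) (?\<Gamma> x') - flat c (fst x') (?\<Gamma> x')) \<le> \<Lambda>s * dist (fst x) (fst x') * norm (?\<Gamma> x')"
        by (rule flat_lip[OF y])
      also have "\<dots> \<le> \<Lambda>s * dist x x' * max (B / \<mu>) 0"
        using \<Lambda>s bound[OF x(2)] by (intro mult_mono dist_fst_le) auto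
      finally show "norm (flat c (fst x) (?\<Gamma> x') - flat c (fst x') (?\<Gamma> x')) \<le> \<Lambda>s * dist x x' * max (B / \<mu>) 0" .
    qed
    finally show "dist (?\<Gamma> x) (?\<Gamma> x') \<le> C * dist x x'"
      unfolding C_def dist_norm[of "?\<Gamma> x"] using \<mu>(1) by (simp add: field_simps)
  qed (use lipschitz_on_nonneg[OF L] \<Lambda>s \<mu>(1) in \<open>simp add: C_def\<close>)
  moreover have "bounded (?\<Gamma> ` ?X)" unfolding bounded_iff using bound by blast
  ultimately show ?thesis unfolding bounded_lipschitz_def by blast
qed

text \<open>With position and velocity in a compact set, the geodesic equation bounds the
  acceleration. So the velocity is Lipschitz and converges as well, and the first order system for
  the pair of position and velocity can be continued beyond its limit state.\<close>

lemma geodesic_extend_right: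
  assumes geo: "geodesic A g I \<gamma>" and ab: "a < b" "{a<..<b} \<subseteq> I" "\<And>t. t \<in> I \<Longrightarrow> t < b"
    and c: "c \<in> A" "p \<in> fst c" and lim: "(\<gamma> \<longlongrightarrow> p) (at_left b)"
    and dom: "\<And>t. t \<in> {a<..<b} \<Longrightarrow> \<gamma> t \<in> fst c"
    and bd: "\<And>t. t \<in> {a<..<b} \<Longrightarrow> norm (vector_derivative (snd c \<circ> \<gamma>) (at t)) \<le> K"
  obtains J \<delta> where "geodesic A g J \<delta>" "I \<subset> J" "\<And>t. t \<in> I \<Longrightarrow> \<delta> t = \<gamma> t"
proof -
  let ?y = "snd c \<circ> \<gamma>" and ?v = "\<lambda>s. vector_derivative (snd c \<circ> \<gamma>) (at s)"
  let ?F = "\<lambda>x. (snd x, - christoffel A g c (fst x) (snd x) (snd x))"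
  define yb where "yb = snd c p"
  have I: "open I" "is_interval I" "I \<noteq> {}" "\<And>t. t \<in> I \<Longrightarrow> \<exists>c\<in>A. geodesic_at c \<gamma> t"
    using geo unfolding geodesic_iff by auto
  have at: "geodesic_at c \<gamma> t" if "t \<in> {a<..<b}" for t
    using I(4)[of t] geodesic_at_transfer c(1) dom[OF that] that ab(2) by blast
  have y': "(?y has_vector_derivative ?v t) (at t)"
    and v': "(?v has_vector_derivative - christoffel A g c (?y t) (?v t) (?v t)) (at t)" if t: "t \<in> {a<..<b}" for t
  proof -
    obtain x'' where x: "\<forall>\<^sub>F s in nhds t. (?y has_vector_derivative ?v s) (at s)"
      "(?v has_vector_derivative x'') (at t)" "x'' + christoffel A g c (snd c (\<gamma> t)) (?v t) (?v t) = 0"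
      by (rule geodesic_at_vector_derivative[OF at[OF t]])
    show "(?y has_vector_derivative ?v t) (at t)" by (rule eventually_nhds_x_imp_x[OF x(1)])
    show "(?v has_vector_derivative - christoffel A g c (?y t) (?v t) (?v t)) (at t)"
      using x(2,3) by (simp add: add_eq_0_iff2)
  qed
  have "\<forall>\<^sub>F t in at_left b. \<gamma> t \<in> fst c" using dom ab(1) by (rule eventually_at_leftI)
  then have ylim: "(?y \<longlongrightarrow> yb) (at_left b)"
    unfolding yb_def o_def using continuous_on_tendsto_compose[OF continuous_on_chart[OF c(1)] lim c(2)] by blast
  obtain \<rho> where \<rho>: "\<rho> > 0" "cball yb \<rho> \<subseteq> snd c ` fst c"
    using open_image[OF c(1)] c(2) unfolding yb_def by (meson image_eqI open_contains_cball)
  have "\<forall>\<^sub>F t in at_left b. ?y t \<in> ball yb \<rho>"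
    by (rule topological_tendstoD[OF ylim]) (use \<rho> in auto)
  then obtain a' where a': "a' < b" "\<And>t. a' < t \<Longrightarrow> t < b \<Longrightarrow> ?y t \<in> ball yb \<rho>"
    unfolding eventually_at_left_field by blast
  define a1 where "a1 = max a a'"
  have a1: "a1 < b" "a \<le> a1" using a' ab unfolding a1_def by auto
  have yr: "?y t \<in> cball yb \<rho>" if "t \<in> {a1<..<b}" for t
    using a'(2)[of t] that unfolding a1_def by auto
  \<comment> \<open>The limit velocity has norm at most \<open>K\<close>; the margin 1 leaves room
    for a ball of radius at most 1 around it.\<close>
  let ?X = "cball yb \<rho> \<times> cball (0::'e) (K + 1)"
  have bl: "bounded_lipschitz ?X (\<lambda>x. christoffel A g c (fst x) (snd x) (snd x))"
    by (rule bounded_lipschitz_christoffel[OF c(1)]) (use \<rho> in auto)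
  obtain B where "\<forall>z\<in>(\<lambda>x. christoffel A g c (fst x) (snd x) (snd x)) ` ?X. norm z \<le> B"
    using bl unfolding bounded_lipschitz_def bounded_iff by blast
  then have B: "norm (christoffel A g c y v v) \<le> B" if "(y, v) \<in> ?X" for y v
    using that by force
  have inX: "(?y t, ?v t) \<in> ?X" if "t \<in> {a1<..<b}" for t
    using yr[OF that] bd[of t] that a1 by simp
  have "B-lipschitz_on {a1<..<b} ?v"
    by (rule lipschitz_of_bounded_vector_derivative[OF a1(1) v']) (use a1 B[OF inX] in auto)
  then obtain vb where vlim: "(?v \<longlongrightarrow> vb) (at_left b)"
    using lipschitz_tendsto_at_left[OF _ a1(1)] by blast
  have vb: "norm vb \<le> K"
  proof (rule Lim_norm_ubound[OF _ vlim])
    show "\<forall>\<^sub>F t in at_left b. norm (?v t) \<le> K" using bd ab(1) by (rule eventually_at_leftI)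
  qed simp
  define r where "r = min \<rho> 1"
  have r: "r > 0" using \<rho> unfolding r_def by simp
  have sub: "cball (yb, vb) r \<subseteq> ?X"
  proof
    fix x assume x: "x \<in> cball (yb, vb) r"
    have "dist yb (fst x) \<le> r" "dist vb (snd x) \<le> r"
      using dist_fst_le[of "(yb, vb)" x] dist_snd_le[of "(yb, vb)" x] x by auto
    moreover have "norm (snd x) \<le> norm vb + dist vb (snd x)"
      using norm_triangle_sub[of "snd x" vb] by (simp add: dist_norm norm_minus_commute)
    ultimately show "x \<in> ?X" using vb unfolding r_def by (cases x) auto
  qed
  obtain L where "L-lipschitz_on ?X (\<lambda>x. - christoffel A g c (fst x) (snd x) (snd x))"
    using bounded_lipschitz_minus[OF bl] unfolding bounded_lipschitz_def by blast
  moreover have "1-lipschitz_on ?X snd" by (rule lipschitz_onI) (simp_all add: dist_snd_le)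
  ultimately have "(sqrt (1\<^sup>2 + L\<^sup>2))-lipschitz_on ?X ?F" by (intro lipschitz_on_Pair)
  then have Flip: "(sqrt (1\<^sup>2 + L\<^sup>2))-lipschitz_on (cball (yb, vb) r) ?F"
    using sub lipschitz_on_subset by blast
  define w where "w t = (?y t, ?v t)" for t
  have wlim: "(w \<longlongrightarrow> (yb, vb)) (at_left b)" unfolding w_def by (rule tendsto_Pair[OF ylim vlim])
  have w': "(w has_vector_derivative ?F (w t)) (at t)" if "t \<in> {a1<..<b}" for t
  proof -
    have "t \<in> {a<..<b}" using that a1 by auto
    from has_vector_derivative_Pair[OF y'[OF this] v'[OF this]] show ?thesis
      unfolding w_def by simp
  qed
  obtain s \<epsilon> W where s: "a1 \<le> s" "s < b" "\<epsilon> > 0" and Ww: "\<And>t. t < b \<Longrightarrow> W t = w t"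
    and Wr: "\<And>t. t \<in> {s<..<b+\<epsilon>} \<Longrightarrow> W t \<in> cball (yb, vb) r"
    and W': "\<And>t. t \<in> {s<..<b+\<epsilon>} \<Longrightarrow> (W has_vector_derivative ?F (W t)) (at t)"
    using ode_continuation[OF Flip r a1(1) wlim w'] by metis
  \<comment> \<open>Both branches agree on \<open>{s<..<b}\<close>, because \<open>W\<close> extends
    \<open>w\<close> there. So every time in the extended interval has a neighbourhood on which
    \<open>\<delta>\<close> is either the old geodesic or the solution read in the chart.\<close>
  define \<delta> where "\<delta> t = (if t < b then \<gamma> t else chart_inv c (fst (W t)))" for t
  have img: "fst (W t) \<in> snd c ` fst c" if "t \<in> {s<..<b+\<epsilon>}" for t
  proof -
    have "W t \<in> ?X" using Wr[OF that] sub by blast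
    then show ?thesis using \<rho>(2) by (auto simp: mem_Times_iff)
  qed
  have \<delta>W: "\<delta> t = chart_inv c (fst (W t))" if "t \<in> {s<..<b+\<epsilon>}" for t
    using dom[of t] that s a1 Ww[of t] c(1) by (auto simp: \<delta>_def w_def chart_inv_chart)
  have \<delta>c: "snd c (\<delta> t) = fst (W t)" "\<delta> t \<in> fst c" if "t \<in> {s<..<b+\<epsilon>}" for t
    using \<delta>W[OF that] chart_chart_inv[OF c(1) img[OF that]] chart_inv_domain[OF c(1) img[OF that]] by auto
  have new: "geodesic_at c \<delta> t" if t: "t \<in> {s<..<b+\<epsilon>}" for t
  proof -
    have ev: "\<forall>\<^sub>F r in nhds t. r \<in> {s<..<b+\<epsilon>}"
      using eventually_nhds_in_open[OF open_greaterThanLessThan t] .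
    have cont: "isCont \<delta> r" if r: "r \<in> {s<..<b+\<epsilon>}" for r
    proof -
      have "isCont (\<lambda>t. fst (W t)) r" using has_vector_derivative_continuous[OF W'[OF r]] by (intro continuous_intros)
      moreover have "isCont (chart_inv c) (fst (W r))"
        using continuous_on_chart_inv[OF c(1)] open_image[OF c(1)] img[OF r] continuous_on_eq_continuous_at by blast
      ultimately have "isCont (\<lambda>t. chart_inv c (fst (W t))) r" by (rule isCont_o2)
      moreover have "\<forall>\<^sub>F u in nhds r. chart_inv c (fst (W u)) = \<delta> u"
        using eventually_nhds_in_open[OF open_greaterThanLessThan r] by eventually_elim (simp add: \<delta>W)
      ultimately show ?thesis by (rule isCont_transform_nhds)
    qed
    have d: "((snd c \<circ> \<delta>) has_vector_derivative snd (W r)) (at r)" if r: "r \<in> {s<..<b+\<epsilon>}" for r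
    proof -
      have "((\<lambda>t. fst (W t)) has_vector_derivative snd (W r)) (at r)"
        using bounded_linear.has_vector_derivative[OF bounded_linear_fst W'[OF r]] by simp
      then show ?thesis
        by (rule has_vector_derivative_transform_nhds)
          (use eventually_nhds_in_open[OF open_greaterThanLessThan r] in eventually_elim, simp add: \<delta>c)
    qed
    have d2: "((\<lambda>t. snd (W t)) has_vector_derivative - christoffel A g c (fst (W t)) (snd (W t)) (snd (W t))) (at t)"
      using bounded_linear.has_vector_derivative[OF bounded_linear_snd W'[OF t]] by simp
    show ?thesis unfolding geodesic_at_def
    proof (intro conjI exI)
      show "\<forall>\<^sub>F r in nhds t. isCont \<delta> r" using ev by eventually_elim (rule cont)
      show "\<forall>\<^sub>F r in nhds t. ((snd c \<circ> \<delta>) has_vector_derivative snd (W r)) (at r)"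
        using ev by eventually_elim (rule d)
      show "((\<lambda>t. snd (W t)) has_vector_derivative - christoffel A g c (fst (W t)) (snd (W t)) (snd (W t))) (at t)"
        by (rule d2)
    qed (simp_all add: \<delta>c[OF t])
  qed
  have old: "\<exists>c\<in>A. geodesic_at c \<delta> t" if t: "t \<in> I" for t
  proof -
    have "\<forall>\<^sub>F s in nhds t. s \<in> {..<b}" using ab(3)[OF t] by (intro eventually_nhds_in_open) auto
    then have "\<forall>\<^sub>F s in nhds t. \<gamma> s = \<delta> s" by eventually_elim (simp add: \<delta>_def)
    then show ?thesis using I(4)[OF t] geodesic_at_cong by blast
  qed
  define J where "J = I \<union> {s<..<b+\<epsilon>}"
  have "is_interval J" unfolding is_interval_1
  proof (intro ballI allI impI)
    fix l u x assume lu: "l \<in> J" "u \<in> J" "l \<le> x \<and> x \<le> u"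
    \<comment> \<open>A point in the overlap of \<open>I\<close> with the added interval; it ties
      the two together.\<close>
    obtain m where m: "s < m" "m < b" using dense[OF s(2)] by blast
    have mI: "m \<in> I" using m s a1 ab(2) by auto
    show "x \<in> J"
    proof (cases "x \<in> {s<..<b+\<epsilon>}")
      case False
      moreover have "u < b + \<epsilon>" using lu(2) ab(3)[of u] s(3) unfolding J_def by auto
      ultimately have "x \<le> s" using lu(3) by auto
      then have "l \<in> I" "x \<le> m" using lu m unfolding J_def by auto
      then have "x \<in> I" using I(2) mI lu(3) unfolding is_interval_1 by blast
      then show ?thesis unfolding J_def by blast
    qed (simp add: J_def)
  qed
  moreover have "open J" unfolding J_def using I(1) by auto
  moreover have "\<forall>t\<in>J. \<exists>c\<in>A. geodesic_at c \<delta> t" "J \<noteq> {}" unfolding J_def using old new c(1) I(3) by blast+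
  ultimately have "geodesic A g J \<delta>" unfolding geodesic_iff by blast
  moreover have "b \<in> J" "b \<notin> I" using s ab(3) unfolding J_def by auto
  then have "I \<subset> J" unfolding J_def by blast
  moreover have "\<delta> t = \<gamma> t" if "t \<in> I" for t using ab(3)[OF that] by (simp add: \<delta>_def)
  ultimately show thesis using that by blast
qed

end

section \<open>Lengths of piecewise smooth curves\<close>

locale riem =
  fixes A :: "('a::t2_space, 'e::euclidean_space) chart set" and g :: "'a tensor2"
  assumes riemannian: "riemannian_manifold A g"

sublocale riem \<subseteq> semi_riem
  using riemannian by unfold_locales (simp add: riemannian_manifold_def)

context riem
begin

lemma metric_coord_pos:
  assumes "c \<in> A" "y \<in> snd c ` fst c" "v \<noteq> 0" shows "G c y v v > 0"
proof -
  note d = assms(1) chart_inv_domain[OF assms(1,2)]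
  have "coord_vec A c (chart_inv c y) v \<noteq> (\<lambda>f. 0)"
    using coord_vec_inject[OF d] coord_vec_zero[OF d] assms(3) by metis
  then show ?thesis
    using riemannian coord_vec_tangent[OF d] unfolding riemannian_manifold_def metric_coord_def by blast
qed

lemma metric_coord_nonneg:
  assumes "c \<in> A" "y \<in> snd c ` fst c" shows "G c y v v \<ge> 0"
  using metric_coord_pos[OF assms, of v] linear_0[OF metric_coord_linear_left[OF assms, of 0]]
  by (cases "v = 0") auto

lemma metric_coord_Cauchy_Schwarz:
  assumes "c \<in> A" "y \<in> snd c ` fst c"
  shows "\<bar>G c y v w\<bar> \<le> sqrt (G c y v v) * sqrt (G c y w w)"
proof (cases "w = 0")
  case True
  then show ?thesis
    using linear_0[OF metric_coord_linear_right[OF assms, of v]] linear_0[OF metric_coord_linear_right[OF assms, of 0]] by simp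
next
  case False
  then have pos: "G c y w w > 0" using metric_coord_pos[OF assms] by blast
  let ?t = "G c y v w / G c y w w"
  note l = metric_coord_linear_left[OF assms] and r = metric_coord_linear_right[OF assms]
  have "0 \<le> G c y (v - ?t *\<^sub>R w) (v - ?t *\<^sub>R w)" by (rule metric_coord_nonneg[OF assms])
  also have "\<dots> = G c y v v - ?t * G c y v w - ?t * (G c y v w - ?t * G c y w w)"
    using metric_coord_sym[OF assms, of w v]
    by (simp add: linear_diff[OF l] linear_diff[OF r] linear_scale[OF l] linear_scale[OF r] algebra_simps)
  also have "\<dots> = G c y v v - (G c y v w)\<^sup>2 / G c y w w" using pos by (simp add: power2_eq_square)
  finally have "(G c y v w)\<^sup>2 \<le> G c y v v * G c y w w" using pos by (simp add: field_simps)
  from real_sqrt_le_mono[OF this] show ?thesis by (simp add: real_sqrt_mult)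
qed

text \<open>Unlike the norm of \<^const>\<open>velocity\<close>, this is one-sided at the end points of an interval \<open>X\<close>
  and hence continuous up to them.\<close>

definition speed :: "(real \<Rightarrow> 'a) \<Rightarrow> real set \<Rightarrow> real \<Rightarrow> real" where
  "speed \<gamma> X t = tnorm g (\<gamma> t)
     (\<lambda>f. if smooth_near A (\<gamma> t) f then vector_derivative (f \<circ> \<gamma>) (at t within X) else 0)"

lemma speed_chart:
  assumes c: "c \<in> A" "\<gamma> t \<in> fst c" and ab: "a < b" "t \<in> {a..b}"
    and cont: "continuous (at t within {a..b}) \<gamma>"
    and x': "((snd c \<circ> \<gamma>) has_vector_derivative x') (at t within {a..b})"
  shows "speed \<gamma> {a..b} t = sqrt (G c (snd c (\<gamma> t)) x' x')"
proof -
  have "(\<lambda>f. if smooth_near A (\<gamma> t) f then vector_derivative (f \<circ> \<gamma>) (at t within {a..b}) else 0)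
      = coord_vec A c (\<gamma> t) x'"
  proof
    fix f
    show "(if smooth_near A (\<gamma> t) f then vector_derivative (f \<circ> \<gamma>) (at t within {a..b}) else 0)
      = coord_vec A c (\<gamma> t) x' f"
    proof (cases "smooth_near A (\<gamma> t) f")
      case True
      then show ?thesis
        using vector_derivative_within_cbox[of a b t "f \<circ> \<gamma>"] ab
          chain_rule_smooth_near[OF c(1) ab(2) c(2) cont x' True] by simp
    qed (simp add: coord_vec_def)
  qed
  then show ?thesis unfolding speed_def tnorm_def by (simp add: metric_coord_chart[OF c])
qed

lemma speed_interior:
  assumes "a < t" "t < b" shows "tnorm g (\<gamma> t) (velocity A \<gamma> t) = speed \<gamma> {a..b} t"
proof -
  have "deriv f t = vector_derivative f (at t)" for f :: "real \<Rightarrow> real"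
    unfolding deriv_def vector_derivative_def by (simp add: has_real_derivative_iff_has_vector_derivative)
  then show ?thesis unfolding speed_def velocity_def at_within_Icc_at[OF assms] by (simp cong: if_cong)
qed

lemma C1_curveD:
  assumes "C1_curve A \<gamma> a b" "t \<in> {a..b}"
  shows "continuous (at t within {a..b}) \<gamma>"
  using assms unfolding C1_curve_def continuous_on_eq_continuous_within by blast

lemma C1_curve_chartE:
  assumes "C1_curve A \<gamma> a b" "a < b" "c \<in> A"
  obtains x' where "continuous_on {t\<in>{a..b}. \<gamma> t \<in> fst c} x'"
    "\<And>t. t \<in> {a..b} \<Longrightarrow> \<gamma> t \<in> fst c \<Longrightarrow> ((snd c \<circ> \<gamma>) has_vector_derivative x' t) (at t within {a..b})"
    "\<And>t. t \<in> {a..b} \<Longrightarrow> \<gamma> t \<in> fst c \<Longrightarrow> speed \<gamma> {a..b} t = sqrt (G c (snd c (\<gamma> t)) (x' t) (x' t))"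
proof -
  obtain x' where x: "continuous_on {t\<in>{a..b}. \<gamma> t \<in> fst c} x'"
    "\<And>t. t \<in> {a..b} \<Longrightarrow> \<gamma> t \<in> fst c \<Longrightarrow> ((snd c \<circ> \<gamma>) has_vector_derivative x' t) (at t within {a..b})"
    using assms(1,3) unfolding C1_curve_def by blast
  then show thesis
    using speed_chart[OF assms(3) _ assms(2) _ C1_curveD[OF assms(1)]] by (intro that[of x']) auto
qed

lemma continuous_on_speed:
  assumes C1: "C1_curve A \<gamma> a b" "a < b" shows "continuous_on {a..b} (speed \<gamma> {a..b})"
  unfolding continuous_on_eq_continuous_within
proof
  fix t assume t: "t \<in> {a..b}"
  obtain c where c: "c \<in> A" "\<gamma> t \<in> fst c" by (rule chart_cover)
  let ?T = "{t\<in>{a..b}. \<gamma> t \<in> fst c}"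
  obtain x' where x': "continuous_on ?T x'"
    "\<And>t. t \<in> {a..b} \<Longrightarrow> \<gamma> t \<in> fst c \<Longrightarrow> speed \<gamma> {a..b} t = sqrt (G c (snd c (\<gamma> t)) (x' t) (x' t))"
    by (rule C1_curve_chartE[OF C1 c(1)]) blast
  have \<gamma>: "continuous_on ?T \<gamma>"
    by (rule continuous_on_subset[of "{a..b}"]) (use C1 in \<open>auto simp: C1_curve_def\<close>)
  have "continuous_on ?T (\<lambda>t. snd c (\<gamma> t))"
    by (rule continuous_on_compose2[OF continuous_on_chart[OF c(1)] \<gamma>]) auto
  then have "continuous_on ?T (\<lambda>t. sqrt (G c (snd c (\<gamma> t)) (x' t) (x' t)))"
    by (intro continuous_on_real_sqrt continuous_on_metric_coord c x') auto
  then have "continuous_on ?T (speed \<gamma> {a..b})"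
    by (rule continuous_on_cong[THEN iffD1, OF refl, rotated]) (use x'(2) in auto)
  then have cont: "continuous (at t within ?T) (speed \<gamma> {a..b})"
    using t c(2) by (simp add: continuous_on_eq_continuous_within)
  have "\<forall>\<^sub>F s in at t within {a..b}. \<gamma> s \<in> fst c"
    by (rule eventually_in_chart[OF c C1_curveD[OF C1(1) t]])
  then obtain S where S: "open S" "t \<in> S" "\<And>s. s \<in> S \<Longrightarrow> s \<in> {a..b} \<Longrightarrow> \<gamma> s \<in> fst c"
    unfolding eventually_at_topological using c(2) by metis
  have "at t within ?T = at t within {a..b}"
    by (rule at_within_nhd[OF S(2,1)]) (use S in auto)
  then show "continuous (at t within {a..b}) (speed \<gamma> {a..b})" using cont by simp
qed

text \<open>An inductive form of the partitions in \<open>piecewise_C1_curve\<close>, carrying the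
  length along: statements about lengths are proved for one piece and for concatenation. Every piece
  has its own one-sided speed, so corners need no attention.\<close>

inductive pw_length :: "(real \<Rightarrow> 'a) \<Rightarrow> real \<Rightarrow> real \<Rightarrow> real \<Rightarrow> bool" for \<gamma> where
  piece: "C1_curve A \<gamma> a b \<Longrightarrow> a < b \<Longrightarrow> (speed \<gamma> {a..b} has_integral L) {a..b} \<Longrightarrow> pw_length \<gamma> a b L"
| join: "pw_length \<gamma> a b L \<Longrightarrow> pw_length \<gamma> b c L' \<Longrightarrow> pw_length \<gamma> a c (L + L')"

lemma pw_length_less: "pw_length \<gamma> a b L \<Longrightarrow> a < b"
  by (induction rule: pw_length.induct) auto

lemma pw_length_C1:
  assumes "C1_curve A \<gamma> a b" "a < b" shows "pw_length \<gamma> a b (integral {a..b} (speed \<gamma> {a..b}))"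
  by (intro piece assms integrable_integral integrable_continuous_real continuous_on_speed)

text \<open>Where a curve has a corner, \<open>velocity\<close> is built from derivatives that need
  not exist. The integral only sees the interiors of the pieces, where it agrees with
  \<open>speed\<close>.\<close>

lemma pw_length_has_integral:
  "pw_length \<gamma> a b L \<Longrightarrow> ((\<lambda>t. tnorm g (\<gamma> t) (velocity A \<gamma> t)) has_integral L) {a..b}"
proof (induction rule: pw_length.induct)
  case (piece a b L)
  then show ?case
    using has_integral_spike_interior[of "speed \<gamma> {a..b}" L a b] speed_interior by simp
next
  case (join a b L c L')
  have "a \<le> b" "b \<le> c" using join.hyps pw_length_less by fastforce+
  then show ?case using join.IH by (rule has_integral_combine)
qed

lemma speed_nonneg:
  assumes "C1_curve A \<gamma> a b" "a < b" "t \<in> {a..b}" shows "speed \<gamma> {a..b} t \<ge> 0"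
proof -
  obtain c where c: "c \<in> A" "\<gamma> t \<in> fst c" by (rule chart_cover)
  show ?thesis
    by (rule C1_curve_chartE[OF assms(1,2) c(1)]) (use assms(3) c metric_coord_nonneg in auto)
qed

lemma pw_length_nonneg: "pw_length \<gamma> a b L \<Longrightarrow> L \<ge> 0"
proof (induction rule: pw_length.induct)
  case (piece a b L)
  then show ?case using has_integral_nonneg[OF piece(3)] speed_nonneg by blast
qed simp

lemma C1_curve_cong:
  assumes "C1_curve A \<gamma> a b" "\<And>t. t \<in> {a..b} \<Longrightarrow> \<gamma> t = \<delta> t"
  shows "C1_curve A \<delta> a b"
  unfolding C1_curve_def
proof (intro conjI ballI)
  have "continuous_on {a..b} \<gamma>" using assms(1) unfolding C1_curve_def by blast
  then show "continuous_on {a..b} \<delta>"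
    by (rule continuous_on_cong[THEN iffD1, OF refl, rotated]) (rule assms(2))
  fix c assume "c \<in> A"
  then obtain x' where x: "continuous_on {t\<in>{a..b}. \<gamma> t \<in> fst c} x'"
    "\<And>t. t \<in> {a..b} \<Longrightarrow> \<gamma> t \<in> fst c \<Longrightarrow> ((snd c \<circ> \<gamma>) has_vector_derivative x' t) (at t within {a..b})"
    using assms(1) unfolding C1_curve_def by blast
  have "{t\<in>{a..b}. \<delta> t \<in> fst c} = {t\<in>{a..b}. \<gamma> t \<in> fst c}" using assms(2) by auto
  moreover have "((snd c \<circ> \<delta>) has_vector_derivative x' t) (at t within {a..b})"
    if "t \<in> {a..b}" "\<delta> t \<in> fst c" for t
    by (rule has_vector_derivative_transform[OF that(1) _ x(2)]) (use that assms(2) in auto)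
  ultimately show "\<exists>x'. continuous_on {t\<in>{a..b}. \<delta> t \<in> fst c} x' \<and>
      (\<forall>t\<in>{a..b}. \<delta> t \<in> fst c \<longrightarrow> ((snd c \<circ> \<delta>) has_vector_derivative x' t) (at t within {a..b}))"
    using x(1) by metis
qed

lemma speed_cong:
  assumes C1: "C1_curve A \<gamma> a b" "a < b" and eq: "\<And>t. t \<in> {a..b} \<Longrightarrow> \<gamma> t = \<delta> t" and t: "t \<in> {a..b}"
  shows "speed \<delta> {a..b} t = speed \<gamma> {a..b} t"
proof -
  obtain c where c: "c \<in> A" "\<gamma> t \<in> fst c" by (rule chart_cover)
  obtain x' where x': "((snd c \<circ> \<gamma>) has_vector_derivative x' t) (at t within {a..b})"
    "speed \<gamma> {a..b} t = sqrt (G c (snd c (\<gamma> t)) (x' t) (x' t))"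
    by (rule C1_curve_chartE[OF C1 c(1)]) (use t c(2) in blast)
  have "((snd c \<circ> \<delta>) has_vector_derivative x' t) (at t within {a..b})"
    by (rule has_vector_derivative_transform[OF t _ x'(1)]) (use eq in auto)
  then have "speed \<delta> {a..b} t = sqrt (G c (snd c (\<delta> t)) (x' t) (x' t))"
    using c eq[OF t] by (intro speed_chart C1(2) t C1_curveD[OF C1_curve_cong[OF C1(1) eq]]) auto
  then show ?thesis using x'(2) eq[OF t] by simp
qed

lemma pw_length_cong:
  assumes "pw_length \<gamma> a b L" "\<And>t. t \<in> {a..b} \<Longrightarrow> \<gamma> t = \<delta> t"
  shows "pw_length \<delta> a b L"
  using assms
proof (induction rule: pw_length.induct)
  case (piece a b L)
  then have "(speed \<delta> {a..b} has_integral L) {a..b}"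
    using speed_cong[OF piece(1,2,4)] by (subst has_integral_cong) auto
  then show ?case using C1_curve_cong piece pw_length.piece by blast
next
  case (join a b L c L')
  then show ?case using pw_length_less[OF join(1)] pw_length_less[OF join(2)]
    by (intro pw_length.join[of \<delta> a b]) auto
qed

text \<open>The intervals are related through the image of the affine map, so that positive and
  negative \<open>m\<close>, that is shifts, rescalings and reversal of orientation, are covered
  together.\<close>

lemma C1_curve_affine:
  assumes C1: "C1_curve A \<gamma> a b" "a < b" and m: "m \<noteq> 0" and im: "(\<lambda>t. m * t + k) ` {a'..b'} = {a..b}"
  shows "C1_curve A (\<lambda>t. \<gamma> (m * t + k)) a' b'"
    and "\<And>t. t \<in> {a'..b'} \<Longrightarrow> speed (\<lambda>t. \<gamma> (m * t + k)) {a'..b'} t = \<bar>m\<bar> * speed \<gamma> {a..b} (m * t + k)"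
proof -
  let ?s = "\<lambda>t. m * t + k"
  have s: "?s t \<in> {a..b}" if "t \<in> {a'..b'}" for t using im that by blast
  have ab': "a' < b'"
  proof (rule ccontr)
    assume "\<not> a' < b'"
    then have "{a'..b'} \<subseteq> {a'}" by auto
    then have "?s ` {a'..b'} \<subseteq> {?s a'}" by blast
    then have "{a..b} \<subseteq> {?s a'}" using im by simp
    then have "a = b" using C1(2) by (metis atLeastAtMost_iff less_imp_le order_refl singletonD subsetD)
    then show False using C1(2) by simp
  qed
  have ds: "(?s has_vector_derivative m) (at t within X)" for t X
    by (auto intro!: derivative_eq_intros)
  have cs: "continuous_on X ?s" for X by (intro continuous_intros)
  have d: "((snd c \<circ> (\<lambda>t. \<gamma> (?s t))) has_vector_derivative m *\<^sub>R x') (at t within {a'..b'})"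
    if "((snd c \<circ> \<gamma>) has_vector_derivative x') (at (?s t) within {a..b})" for c :: "('a,'e) chart" and x' t
    using vector_diff_chain_within[OF ds, of "snd c \<circ> \<gamma>" x' t "{a'..b'}"] that
    unfolding im by (simp add: o_def)
  show C1': "C1_curve A (\<lambda>t. \<gamma> (?s t)) a' b'"
    unfolding C1_curve_def
  proof (intro conjI ballI)
    show "continuous_on {a'..b'} (\<lambda>t. \<gamma> (?s t))"
      using C1(1) unfolding C1_curve_def by (intro continuous_on_compose2[OF _ cs]) (use s in auto)
    fix c assume c: "c \<in> A"
    obtain x' where x: "continuous_on {t\<in>{a..b}. \<gamma> t \<in> fst c} x'"
      "\<And>t. t \<in> {a..b} \<Longrightarrow> \<gamma> t \<in> fst c \<Longrightarrow> ((snd c \<circ> \<gamma>) has_vector_derivative x' t) (at t within {a..b})"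
      using C1(1) c unfolding C1_curve_def by blast
    have "continuous_on {t\<in>{a'..b'}. \<gamma> (?s t) \<in> fst c} (\<lambda>t. m *\<^sub>R x' (?s t))"
      by (intro continuous_on_scaleR continuous_on_const continuous_on_compose2[OF x(1) cs]) (use s in auto)
    then show "\<exists>x'. continuous_on {t\<in>{a'..b'}. \<gamma> (?s t) \<in> fst c} x' \<and>
      (\<forall>t\<in>{a'..b'}. \<gamma> (?s t) \<in> fst c \<longrightarrow> ((snd c \<circ> (\<lambda>t. \<gamma> (?s t))) has_vector_derivative x' t) (at t within {a'..b'}))"
      using d x(2) s by (intro exI[of _ "\<lambda>t. m *\<^sub>R x' (?s t)"]) blast
  qed
  fix t assume t: "t \<in> {a'..b'}"
  obtain c where c: "c \<in> A" "\<gamma> (?s t) \<in> fst c" by (rule chart_cover)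
  obtain x' where x': "((snd c \<circ> \<gamma>) has_vector_derivative x' (?s t)) (at (?s t) within {a..b})"
    "speed \<gamma> {a..b} (?s t) = sqrt (G c (snd c (\<gamma> (?s t))) (x' (?s t)) (x' (?s t)))"
    by (rule C1_curve_chartE[OF C1 c(1)]) (use s[OF t] c(2) in blast)
  have y: "snd c (\<gamma> (?s t)) \<in> snd c ` fst c" using c by blast
  have "speed (\<lambda>t. \<gamma> (?s t)) {a'..b'} t = sqrt (G c (snd c (\<gamma> (?s t))) (m *\<^sub>R x' (?s t)) (m *\<^sub>R x' (?s t)))"
    using c by (intro speed_chart d x' ab' t C1_curveD[OF C1']) auto
  then show "speed (\<lambda>t. \<gamma> (?s t)) {a'..b'} t = \<bar>m\<bar> * speed \<gamma> {a..b} (?s t)"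
    unfolding x'(2)
    by (simp add: linear_scale[OF metric_coord_linear_left[OF c(1) y]] real_sqrt_mult
        linear_scale[OF metric_coord_linear_right[OF c(1) y]] flip: mult.assoc)
qed

text \<open>Length does not depend on the parameter: the factor \<open>\<bar>m\<bar>\<close> of the
  speed cancels the one from the substitution in the integral.\<close>

lemma pw_length_piece_affine:
  assumes C1: "C1_curve A \<gamma> a b" "a < b" and m: "m \<noteq> 0" and im: "(\<lambda>t. m * t + k) ` {a'..b'} = {a..b}"
    and L: "(speed \<gamma> {a..b} has_integral L) {a..b}" and ab': "a' < b'"
  shows "pw_length (\<lambda>t. \<gamma> (m * t + k)) a' b' L"
proof -
  have "(\<lambda>x. (1 / m) *\<^sub>R x + - ((1 / m) *\<^sub>R k)) ` {a..b} = {a'..b'}"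
    unfolding im[symmetric] image_image using m by (simp add: field_simps)
  then have "((\<lambda>x. speed \<gamma> {a..b} (m * x + k)) has_integral (1 / \<bar>m\<bar>) * L) {a'..b'}"
    using has_integral_affinity[of "speed \<gamma> {a..b}" L a b m k] L m by simp
  from has_integral_mult_right[OF this, of "\<bar>m\<bar>"]
  have "((\<lambda>x. \<bar>m\<bar> * speed \<gamma> {a..b} (m * x + k)) has_integral L) {a'..b'}" using m by simp
  then have "(speed (\<lambda>t. \<gamma> (m * t + k)) {a'..b'} has_integral L) {a'..b'}"
    by (rule has_integral_eq[rotated]) (simp add: C1_curve_affine(2)[OF C1 m im])
  then show ?thesis using C1_curve_affine(1)[OF C1 m im] ab' piece by blast
qed

lemma pw_length_affine:
  assumes "pw_length \<gamma> a b L" "m > 0"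
  shows "pw_length (\<lambda>t. \<gamma> (m * t + k)) ((a - k) / m) ((b - k) / m) L"
  using assms(1)
proof (induction rule: pw_length.induct)
  case (piece a b L)
  have le: "(a - k) / m < (b - k) / m" using assms(2) piece(2) by (simp add: divide_strict_right_mono)
  have im: "(\<lambda>t. m * t + k) ` {(a - k) / m..(b - k) / m} = {a..b}"
    using assms(2) le unfolding image_affinity_atLeastAtMost by auto
  show ?case
    using pw_length_piece_affine[OF piece(1,2) _ im piece(3) le] assms(2) by simp
next
  case (join a b L c L')
  show ?case by (rule pw_length.join[OF join.IH])
qed

lemma pw_length_reverse:
  assumes "pw_length \<gamma> a b L"
  shows "pw_length (\<lambda>t. \<gamma> (- t)) (- b) (- a) L"
  using assms
proof (induction rule: pw_length.induct)
  case (piece a b L)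
  have im: "(\<lambda>t. - 1 * t + 0) ` {- b..- a} = {a..b}" by simp
  have "- b < - a" using piece(2) by simp
  from pw_length_piece_affine[OF piece(1,2) _ im piece(3) this] show ?case by simp
next
  case (join a b L c L')
  show ?case using pw_length.join[OF join.IH(2) join.IH(1)] by (simp add: add.commute)
qed

end

section \<open>The Riemannian distance\<close>

context riem
begin

text \<open>Induction on the number of points of the partition; the last piece starts at the second
  largest point \<open>m\<close>.\<close>

lemma pw_length_of_partition:
  assumes "finite S" "a \<in> S" "b \<in> S" "S \<subseteq> {a..b}" "a < b"
    and "\<And>s t. s \<in> S \<Longrightarrow> t \<in> S \<Longrightarrow> s < t \<Longrightarrow> S \<inter> {s<..<t} = {} \<Longrightarrow> C1_curve A \<gamma> s t"
  shows "\<exists>L. pw_length \<gamma> a b L"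
  using assms
proof (induction "card S" arbitrary: S b)
  case 0
  then show ?case by auto
next
  case (Suc n)
  let ?S = "S - {b}"
  define m where "m = Max ?S"
  have fin: "finite ?S" "a \<in> ?S" using Suc.prems by auto
  have m: "m \<in> ?S" "\<And>s. s \<in> ?S \<Longrightarrow> s \<le> m"
    unfolding m_def using Max_in[OF fin(1)] Max_ge[OF fin(1)] fin(2) by blast+
  have mb: "m < b" using m(1) Suc.prems(4) by auto
  have "S \<inter> {m<..<b} = {}" using m(2) by fastforce
  then have C1: "C1_curve A \<gamma> m b" using Suc.prems m(1) mb by blast
  show ?case
  proof (cases "m = a")
    case True
    then show ?thesis using pw_length_C1[OF C1 mb] by blast
  next
    case False
    then have am: "a < m" using m(1) Suc.prems(4) by fastforce
    have "C1_curve A \<gamma> s t" if "s \<in> ?S" "t \<in> ?S" "s < t" "?S \<inter> {s<..<t} = {}" for s t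
    proof -
      have "b \<notin> {s<..<t}" using that Suc.prems(4) by auto
      then have "S \<inter> {s<..<t} = {}" using that(4) by blast
      then show ?thesis using Suc.prems(6) that by blast
    qed
    moreover have "?S \<subseteq> {a..m}"
    proof
      fix s assume "s \<in> ?S"
      then show "s \<in> {a..m}" using m(2)[of s] Suc.prems(4) by auto
    qed
    moreover have "n = card ?S" using Suc.hyps(2) Suc.prems(1,3) by simp
    ultimately obtain L where "pw_length \<gamma> a m L"
      using Suc.hyps(1)[of ?S m] fin m(1) am by blast
    then show ?thesis using pw_length.join pw_length_C1[OF C1 mb] by blast
  qed
qed

lemma partition_of_pw_length:
  assumes "pw_length \<gamma> a b L"
  shows "\<exists>S. finite S \<and> {a, b} \<subseteq> S \<and> S \<subseteq> {a..b} \<and>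
     (\<forall>s\<in>S. \<forall>t\<in>S. s < t \<and> S \<inter> {s<..<t} = {} \<longrightarrow> C1_curve A \<gamma> s t)"
  using assms
proof (induction rule: pw_length.induct)
  case (piece a b L)
  then show ?case by (intro exI[of _ "{a, b}"]) auto
next
  case (join a b L c L')
  obtain S where S: "finite S" "{a, b} \<subseteq> S" "S \<subseteq> {a..b}"
    "\<forall>s\<in>S. \<forall>t\<in>S. s < t \<and> S \<inter> {s<..<t} = {} \<longrightarrow> C1_curve A \<gamma> s t"
    using join.IH(1) by blast
  obtain T where T: "finite T" "{b, c} \<subseteq> T" "T \<subseteq> {b..c}"
    "\<forall>s\<in>T. \<forall>t\<in>T. s < t \<and> T \<inter> {s<..<t} = {} \<longrightarrow> C1_curve A \<gamma> s t"
    using join.IH(2) by blast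
  have ab: "a < b" "b < c" using join.hyps pw_length_less by blast+
  have "C1_curve A \<gamma> s t" if st: "s \<in> S \<union> T" "t \<in> S \<union> T" "s < t" "(S \<union> T) \<inter> {s<..<t} = {}" for s t
  proof -
    have "b \<notin> {s<..<t}" using st(4) S(2) by blast
    then consider "t \<le> b" | "b \<le> s" by fastforce
    then show ?thesis
    proof cases
      case 1
      then have "s \<in> S" "t \<in> S" using st(1-3) S(2) T(3) by fastforce+
      then show ?thesis using S(4) st(3,4) by blast
    next
      case 2
      then have "s \<in> T" "t \<in> T" using st(1-3) T(2) S(3) by fastforce+
      then show ?thesis using T(4) st(3,4) by blast
    qed
  qed
  then show ?case
    using S(1-3) T(1-3) ab by (intro exI[of _ "S \<union> T"]) auto
qed

lemma piecewise_C1_curve_iff: "piecewise_C1_curve A \<gamma> \<longleftrightarrow> (\<exists>L. pw_length \<gamma> 0 1 L)"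
proof
  assume "piecewise_C1_curve A \<gamma>"
  then obtain S where "finite S" "{0, 1} \<subseteq> S" "S \<subseteq> {0..1}"
    "\<forall>s\<in>S. \<forall>t\<in>S. s < t \<and> S \<inter> {s<..<t} = {} \<longrightarrow> C1_curve A \<gamma> s t"
    unfolding piecewise_C1_curve_def by blast
  then show "\<exists>L. pw_length \<gamma> 0 1 L" by (intro pw_length_of_partition[of S]) auto
next
  assume "\<exists>L. pw_length \<gamma> 0 1 L"
  then show "piecewise_C1_curve A \<gamma>" unfolding piecewise_C1_curve_def using partition_of_pw_length by blast
qed

text \<open>Arbitrary parameter intervals are allowed, so that concatenating two curves needs only a
  shift; the unit interval of \<open>riem_dist\<close> is recovered by rescaling.\<close>

definition joined :: "'a \<Rightarrow> 'a \<Rightarrow> real \<Rightarrow> bool" where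
  "joined p q L \<longleftrightarrow> (\<exists>\<gamma> a b. pw_length \<gamma> a b L \<and> \<gamma> a = p \<and> \<gamma> b = q)"

lemma joined_unit_interval:
  assumes "joined p q L" obtains \<gamma> where "pw_length \<gamma> 0 1 L" "\<gamma> 0 = p" "\<gamma> 1 = q"
proof -
  obtain \<gamma> a b where \<gamma>: "pw_length \<gamma> a b L" "\<gamma> a = p" "\<gamma> b = q" using assms unfolding joined_def by blast
  have ab: "b - a > 0" using pw_length_less[OF \<gamma>(1)] by simp
  have "pw_length (\<lambda>t. \<gamma> ((b - a) * t + a)) 0 1 L"
    using pw_length_affine[OF \<gamma>(1) ab, of a] ab by simp
  then show thesis using that[of "\<lambda>t. \<gamma> ((b - a) * t + a)"] \<gamma> by simp
qed

lemma riem_dist_joined: "riem_dist A g p q = Inf {L. joined p q L}"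
proof -
  have len: "curve_length A g \<gamma> = L" if "pw_length \<gamma> 0 1 L" for \<gamma> L
    unfolding curve_length_def using pw_length_has_integral[OF that] by (rule integral_unique)
  have "{curve_length A g \<gamma> | \<gamma>. piecewise_C1_curve A \<gamma> \<and> \<gamma> 0 = p \<and> \<gamma> 1 = q} = {L. joined p q L}"
  proof (intro equalityI subsetI)
    fix L assume "L \<in> {curve_length A g \<gamma> | \<gamma>. piecewise_C1_curve A \<gamma> \<and> \<gamma> 0 = p \<and> \<gamma> 1 = q}"
    then obtain \<gamma> L' where "pw_length \<gamma> 0 1 L'" "L = curve_length A g \<gamma>" "\<gamma> 0 = p" "\<gamma> 1 = q"
      unfolding piecewise_C1_curve_iff by blast
    then show "L \<in> {L. joined p q L}" using len unfolding joined_def by blast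
  next
    fix L assume "L \<in> {L. joined p q L}"
    then obtain \<gamma> where \<gamma>: "pw_length \<gamma> 0 1 L" "\<gamma> 0 = p" "\<gamma> 1 = q" using joined_unit_interval by blast
    then have "piecewise_C1_curve A \<gamma>" "L = curve_length A g \<gamma>"
      using len unfolding piecewise_C1_curve_iff by blast+
    then show "L \<in> {curve_length A g \<gamma> | \<gamma>. piecewise_C1_curve A \<gamma> \<and> \<gamma> 0 = p \<and> \<gamma> 1 = q}" using \<gamma> by blast
  qed
  then show ?thesis unfolding riem_dist_def by simp
qed

lemma joined_nonneg: "joined p q L \<Longrightarrow> L \<ge> 0"
  unfolding joined_def using pw_length_nonneg by blast

lemma joined_sym: assumes "joined p q L" shows "joined q p L"
proof -
  obtain \<gamma> a b where \<gamma>: "pw_length \<gamma> a b L" "\<gamma> a = p" "\<gamma> b = q" using assms unfolding joined_def by blast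
  show ?thesis unfolding joined_def
    by (rule exI[of _ "\<lambda>t. \<gamma> (- t)"], rule exI[of _ "- b"], rule exI[of _ "- a"])
      (use pw_length_reverse[OF \<gamma>(1)] \<gamma> in simp)
qed

lemma joined_trans: assumes "joined p q L" "joined q r L'" shows "joined p r (L + L')"
proof -
  obtain \<gamma> a b where \<gamma>: "pw_length \<gamma> a b L" "\<gamma> a = p" "\<gamma> b = q"
    using assms(1) unfolding joined_def by blast
  obtain \<delta> a' b' where \<delta>: "pw_length \<delta> a' b' L'" "\<delta> a' = q" "\<delta> b' = r"
    using assms(2) unfolding joined_def by blast
  define c where "c = b' - a' + b"
  have \<delta>': "pw_length (\<lambda>t. \<delta> (1 * t + (a' - b))) b c L'"
    using pw_length_affine[OF \<delta>(1), of 1 "a' - b"] by (simp add: c_def diff_diff_eq2 diff_add_eq)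
  define \<eta> where "\<eta> t = (if t \<le> b then \<gamma> t else \<delta> (1 * t + (a' - b)))" for t
  have "pw_length \<eta> a b L" by (rule pw_length_cong[OF \<gamma>(1)]) (simp add: \<eta>_def)
  moreover have "pw_length \<eta> b c L'"
    by (rule pw_length_cong[OF \<delta>']) (use \<gamma>(3) \<delta>(2) in \<open>auto simp: \<eta>_def\<close>)
  ultimately have "pw_length \<eta> a c (L + L')" by (rule pw_length.join)
  moreover have "\<eta> a = p" "\<eta> c = r"
    using \<gamma>(2) \<delta>(3) pw_length_less[OF \<gamma>(1)] pw_length_less[OF \<delta>(1)] by (auto simp: \<eta>_def c_def)
  ultimately show ?thesis unfolding joined_def by blast
qed

lemma joined_C1:
  "C1_curve A \<gamma> a b \<Longrightarrow> a < b \<Longrightarrow> joined (\<gamma> a) (\<gamma> b) (integral {a..b} (speed \<gamma> {a..b}))"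
  unfolding joined_def using pw_length_C1 by blast

lemma C1_curve_line:
  assumes c: "c \<in> A" and seg: "\<And>t. t \<in> {0..1} \<Longrightarrow> y + t *\<^sub>R v \<in> snd c ` fst c"
  shows "C1_curve A (\<lambda>t. chart_inv c (y + t *\<^sub>R v)) 0 1"
  unfolding C1_curve_def
proof (intro conjI ballI)
  let ?\<gamma> = "\<lambda>t. chart_inv c (y + t *\<^sub>R v)"
  show cont: "continuous_on {0..1} ?\<gamma>"
    by (rule continuous_on_compose2[OF continuous_on_chart_inv[OF c]])
      (use seg in \<open>auto intro!: continuous_intros\<close>)
  fix c' assume c': "c' \<in> A"
  let ?T = "{t \<in> {0..1}. ?\<gamma> t \<in> fst c'}"
  have line: "((snd c \<circ> ?\<gamma>) has_vector_derivative v) (at t within {0..1})" if "t \<in> {0..1}" for t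
  proof -
    have "((\<lambda>t. y + t *\<^sub>R v) has_vector_derivative v) (at t within {0..1})"
      by (auto intro!: derivative_eq_intros)
    then show ?thesis
      by (rule has_vector_derivative_transform[OF that, rotated]) (use chart_chart_inv[OF c seg] in simp)
  qed
  have "continuous_on ?T (\<lambda>t. fd (transition c c') (y + t *\<^sub>R v) v)"
  proof (rule continuous_on_fd[OF smooth_transition[OF c c']])
    show "y + t *\<^sub>R v \<in> snd c ` (fst c \<inter> fst c')" if "t \<in> ?T" for t
      using that chart_chart_inv[OF c seg, of t] chart_inv_domain[OF c seg, of t]
      by (intro image_eqI[of _ _ "?\<gamma> t"]) auto
  qed (intro continuous_intros)+
  moreover have "((snd c' \<circ> ?\<gamma>) has_vector_derivative fd (transition c c') (y + t *\<^sub>R v) v) (at t within {0..1})"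
    if t: "t \<in> {0..1}" "?\<gamma> t \<in> fst c'" for t
    using chain_rule_transition[OF c c' t(1) chart_inv_domain[OF c seg[OF t(1)]] t(2) _ line[OF t(1)]]
      cont t(1) chart_chart_inv[OF c seg[OF t(1)]] by (simp add: continuous_on_eq_continuous_within)
  ultimately show "\<exists>x'. continuous_on ?T x' \<and> (\<forall>t\<in>{0..1}. ?\<gamma> t \<in> fst c' \<longrightarrow>
      ((snd c' \<circ> ?\<gamma>) has_vector_derivative x' t) (at t within {0..1}))"
    by blast
qed

lemma joined_refl: "joined p p 0"
proof -
  obtain c where c: "c \<in> A" "p \<in> fst c" by (rule chart_cover)
  have C1: "C1_curve A (\<lambda>t. p) 0 1"
    using C1_curve_line[OF c(1), of "snd c p" 0] c by (simp add: chart_inv_chart)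
  have y: "snd c p \<in> snd c ` fst c" using c by blast
  have "speed (\<lambda>t. p) {0..1} t = 0" if "t \<in> {0..1}" for t
  proof -
    have "speed (\<lambda>t. p) {0..1} t = sqrt (G c (snd c p) 0 0)"
      by (rule speed_chart) (use c that in \<open>auto simp: o_def\<close>)
    then show ?thesis using linear_0[OF metric_coord_linear_left[OF c(1) y]] by simp
  qed
  then have "integral {0..1} (speed (\<lambda>t. p) {0..1}) = integral {0..1::real} (\<lambda>t. 0::real)"
    by (intro integral_cong) auto
  then show ?thesis using joined_C1[OF C1] by simp
qed

text \<open>Coordinate segments join a point to all its neighbours, so the classes of joinable
  points are open, and connectedness leaves only one. The infimum in \<open>riem_dist\<close> is
  therefore taken over a nonempty set.\<close>

lemma joined_exists:
  assumes "connected (UNIV :: 'a set)" obtains L where "joined p q L"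
proof -
  let ?R = "\<lambda>p q. \<exists>L. joined p q L"
  have "?R p q"
  proof (rule connected_equivalence_relation[OF assms UNIV_I UNIV_I])
    show "?R y x" if "?R x y" for x y using that joined_sym by blast
    show "?R x z" if "?R x y" "?R y z" for x y z using that joined_trans by blast
    fix a
    obtain c where c: "c \<in> A" "a \<in> fst c" by (rule chart_cover)
    then obtain r where r: "r > 0" "ball (snd c a) r \<subseteq> snd c ` fst c"
      using open_image[OF c(1)] by (meson image_eqI open_contains_ball)
    let ?T = "fst c \<inter> snd c -` ball (snd c a) r"
    have "open ?T"
      using continuous_on_open_vimage[OF open_domain[OF c(1)]] continuous_on_chart[OF c(1)]
      by (metis Int_commute open_ball)
    moreover have "a \<in> ?T" using c r by simp
    moreover have "?R a x" if x: "x \<in> ?T" for x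
    proof -
      let ?v = "snd c x - snd c a"
      have "snd c a + t *\<^sub>R ?v \<in> snd c ` fst c" if t: "t \<in> {0..1}" for t
      proof -
        have "norm ?v < r" using x by (simp add: dist_norm norm_minus_commute)
        moreover have "dist (snd c a) (snd c a + t *\<^sub>R ?v) \<le> norm ?v"
          using t by (simp add: dist_norm mult_left_le_one_le)
        ultimately show ?thesis using r(2) by (intro subsetD[OF r(2)]) simp
      qed
      from joined_C1[OF C1_curve_line[OF c(1) this]] show ?thesis
        using c x by (auto simp: chart_inv_chart)
    qed
    ultimately show "\<exists>T. openin (top_of_set UNIV) T \<and> a \<in> T \<and> (\<forall>x\<in>T. ?R a x)"
      by (intro exI[of _ ?T]) auto
  qed
  then show thesis using that by blast
qed

text \<open>Minimising over \<open>K\<close> times the unit sphere compares the Riemannian with the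
  Euclidean norm. This serves twice: for the length of curves in a chart, and for turning a bound on
  the energy into a bound on the coordinate velocity.\<close>

lemma metric_lower_bound:
  assumes c: "c \<in> A" and K: "compact K" "K \<subseteq> snd c ` fst c"
  obtains \<mu> where "\<mu> > 0" "\<And>y v. y \<in> K \<Longrightarrow> \<mu> * norm v \<le> sqrt (G c y v v)"
proof (cases "K = {}")
  case True
  then show thesis using that[of 1] by simp
next
  case False
  let ?S = "sphere 0 1 :: 'e set"
  obtain b :: 'e where "b \<in> Basis" using nonempty_Basis by blast
  then have S: "K \<times> ?S \<noteq> {}" using False by (auto intro: exI[of _ b])
  have cont: "continuous_on (K \<times> ?S) (\<lambda>x. G c (fst x) (snd x) (snd x))"
    by (intro continuous_on_metric_coord c continuous_intros) (use K(2) in auto)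
  have "compact (K \<times> ?S)" using K(1) by (intro compact_Times) auto
  from continuous_attains_inf[OF this S cont] obtain y0 v0 where yv: "y0 \<in> K" "norm v0 = 1"
    and min: "\<And>y v. y \<in> K \<Longrightarrow> norm v = 1 \<Longrightarrow> G c y0 v0 v0 \<le> G c y v v"
    by auto
  define m where "m = G c y0 v0 v0"
  have m: "m > 0" unfolding m_def using yv K(2) by (intro metric_coord_pos[OF c]) auto
  have "sqrt m * norm v \<le> sqrt (G c y v v)" if y: "y \<in> K" for y v
  proof (cases "v = 0")
    case True
    then show ?thesis using metric_coord_nonneg[OF c, of y 0] y K(2) by auto
  next
    case False
    have yc: "y \<in> snd c ` fst c" using y K(2) by blast
    have "G c y v v = (norm v)\<^sup>2 * G c y (v /\<^sub>R norm v) (v /\<^sub>R norm v)"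
      using False by (simp add: linear_scale[OF metric_coord_linear_left[OF c yc]]
          linear_scale[OF metric_coord_linear_right[OF c yc]] power2_eq_square) (simp add: field_simps)
    also have "\<dots> \<ge> (norm v)\<^sup>2 * m"
      unfolding m_def using False by (intro mult_left_mono min y) auto
    finally have "sqrt ((norm v)\<^sup>2 * m) \<le> sqrt (G c y v v)" by (rule real_sqrt_le_mono)
    then show ?thesis by (simp add: real_sqrt_mult mult.commute)
  qed
  then show thesis using that[of "sqrt m"] m by simp
qed

text \<open>The coordinate distance to the centre, truncated at \<open>r\<close>, extends by \<open>r\<close> to a function on the
  whole manifold. It is Lipschitz along curves: the chart estimate applies near the closed coordinate
  ball, and the function is constant outside it.\<close>

lemma truncated_distance_le_length:
  assumes c: "c \<in> A" and r: "r > 0" and sub: "cball y\<^sub>0 (2 * r) \<subseteq> snd c ` fst c"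
    and \<mu>: "\<mu> > 0" "\<And>y v. y \<in> cball y\<^sub>0 (2 * r) \<Longrightarrow> \<mu> * norm v \<le> sqrt (G c y v v)"
  defines "K \<equiv> chart_inv c ` cball y\<^sub>0 r"
  defines "\<Phi> \<equiv> \<lambda>q. if q \<in> K then dist y\<^sub>0 (snd c q) else r"
  shows "pw_length \<gamma> a b L \<Longrightarrow> \<mu> * \<bar>\<Phi> (\<gamma> b) - \<Phi> (\<gamma> a)\<bar> \<le> L"
proof (induction rule: pw_length.induct)
  case (join a b L c' L')
  have "\<bar>\<Phi> (\<gamma> c') - \<Phi> (\<gamma> a)\<bar> \<le> \<bar>\<Phi> (\<gamma> c') - \<Phi> (\<gamma> b)\<bar> + \<bar>\<Phi> (\<gamma> b) - \<Phi> (\<gamma> a)\<bar>" by simp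
  from mult_left_mono[OF this, of \<mu>] show ?case using \<mu>(1) join.IH by (simp add: distrib_left)
next
  case (piece a b L)
  note C1 = piece(1,2)
  define U where "U = fst c \<inter> snd c -` ball y\<^sub>0 (2 * r)"
  have U: "open U" unfolding U_def
    using continuous_on_open_vimage[OF open_domain[OF c]] continuous_on_chart[OF c]
    by (metis Int_commute open_ball)
  have img: "cball y\<^sub>0 r \<subseteq> snd c ` fst c"
    using subset_cball[of r "2 * r" y\<^sub>0] r sub by simp
  have "compact K" unfolding K_def
    by (rule compact_continuous_image[OF continuous_on_subset[OF continuous_on_chart_inv[OF c] img]]) simp
  \<comment> \<open>Compact sets are closed because the manifold is Hausdorff. As \<open>K\<close>
    lies in \<open>U\<close>, the open sets \<open>U\<close> and \<open>- K\<close> cover the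
    manifold.\<close>
  then have K: "open (- K)" using compact_imp_closed by blast
  have \<Phi>U: "\<Phi> q = min r (dist y\<^sub>0 (snd c q))" if "q \<in> U" for q
  proof (cases "q \<in> K")
    case True
    then obtain y where "y \<in> cball y\<^sub>0 r" "q = chart_inv c y" unfolding K_def by blast
    then have "dist y\<^sub>0 (snd c q) \<le> r" using img chart_chart_inv[OF c, of y] by auto
    then show ?thesis using True unfolding \<Phi>_def by simp
  next
    case False
    have "q = chart_inv c (snd c q)" using that c by (simp add: U_def chart_inv_chart)
    then have "snd c q \<notin> cball y\<^sub>0 r" using False unfolding K_def by blast
    then show ?thesis using False unfolding \<Phi>_def by simp
  qed
  have KU: "q \<in> U" if "q \<in> K" for q
  proof -
    obtain y where y: "y \<in> cball y\<^sub>0 r" "q = chart_inv c y" using \<open>q \<in> K\<close> unfolding K_def by blast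
    then have "snd c q = y" "q \<in> fst c" using img chart_chart_inv[OF c] chart_inv_domain[OF c] by auto
    then show ?thesis using y(1) r unfolding U_def by simp
  qed
  let ?sp = "speed \<gamma> {a..b}"
  have int: "?sp integrable_on {s..t}" if "a \<le> s" "t \<le> b" for s t
    by (rule integrable_continuous_real, rule continuous_on_subset[OF continuous_on_speed[OF C1]]) (use that in auto)
  have near: "\<exists>d>0. \<forall>t\<in>{a..b}. dist t x < d \<longrightarrow> \<gamma> t \<in> W" if "open W" "\<gamma> x \<in> W" "x \<in> {a..b}" for W x
  proof -
    have "\<forall>\<^sub>F t in at x within {a..b}. \<gamma> t \<in> W"
      using C1_curveD[OF C1(1) that(3)] that(1,2) unfolding continuous_within by (rule topological_tendstoD)
    then show ?thesis using that(2) unfolding eventually_at by metis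
  qed
  have inU: "\<mu> * \<bar>\<Phi> (\<gamma> t) - \<Phi> (\<gamma> s)\<bar> \<le> integral {s..t} ?sp"
    if st: "a \<le> s" "s \<le> t" "t \<le> b" and U: "\<And>u. u \<in> {s..t} \<Longrightarrow> \<gamma> u \<in> U" for s t
  proof -
    obtain x' where x': "\<And>t. t \<in> {a..b} \<Longrightarrow> \<gamma> t \<in> fst c \<Longrightarrow> ((snd c \<circ> \<gamma>) has_vector_derivative x' t) (at t within {a..b})"
      "\<And>t. t \<in> {a..b} \<Longrightarrow> \<gamma> t \<in> fst c \<Longrightarrow> ?sp t = sqrt (G c (snd c (\<gamma> t)) (x' t) (x' t))"
      by (rule C1_curve_chartE[OF C1 c]) blast
    have dom: "\<gamma> u \<in> fst c" "snd c (\<gamma> u) \<in> cball y\<^sub>0 (2 * r)" "u \<in> {a..b}" if "u \<in> {s..t}" for u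
      using U[OF that] that st unfolding U_def by auto
    have ftc: "(x' has_integral (snd c \<circ> \<gamma>) t - (snd c \<circ> \<gamma>) s) {s..t}"
      by (rule fundamental_theorem_of_calculus[OF st(2)])
        (rule has_vector_derivative_within_subset[OF x'(1)], use dom st in auto)
    have "norm ((snd c \<circ> \<gamma>) t - (snd c \<circ> \<gamma>) s) \<le> integral {s..t} (\<lambda>u. ?sp u / \<mu>)"
      unfolding integral_unique[OF ftc, symmetric]
    proof (rule integral_norm_bound_integral)
      show "x' integrable_on {s..t}" using ftc by blast
      show "(\<lambda>u. ?sp u / \<mu>) integrable_on {s..t}" using int[OF st(1,3)] by (rule integrable_on_divide)
      show "norm (x' u) \<le> ?sp u / \<mu>" if "u \<in> {s..t}" for u
        using \<mu>(2)[OF dom(2)[OF that], of "x' u"] x'(2)[OF dom(3)[OF that] dom(1)[OF that]] \<mu>(1)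
        by (simp add: pos_le_divide_eq mult.commute)
    qed
    then have "\<mu> * dist (snd c (\<gamma> t)) (snd c (\<gamma> s)) \<le> integral {s..t} ?sp"
      using \<mu>(1) by (simp add: dist_norm pos_le_divide_eq mult.commute)
    moreover have "\<bar>\<Phi> (\<gamma> t) - \<Phi> (\<gamma> s)\<bar> \<le> dist (snd c (\<gamma> t)) (snd c (\<gamma> s))"
    proof -
      have "\<gamma> s \<in> U" "\<gamma> t \<in> U" using U st by auto
      then show ?thesis
        using dist_triangle[of y\<^sub>0 "snd c (\<gamma> t)" "snd c (\<gamma> s)"] dist_triangle2[of y\<^sub>0 "snd c (\<gamma> s)" "snd c (\<gamma> t)"]
        by (simp add: \<Phi>U dist_commute min_def abs_if)
    qed
    ultimately show ?thesis using \<mu>(1) by (meson mult_left_mono less_imp_le order_trans)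
  qed
  \<comment> \<open>Bisection asks for \<open>P\<close> on all short intervals around a point,
    including those that stick out of \<open>{a..b}\<close>, where the premises make it vacuous.
    Additivity over adjacent intervals then spreads the local estimates to
    \<open>{a..b}\<close>.\<close>
  define P where "P s t \<longleftrightarrow> (a \<le> s \<longrightarrow> s \<le> t \<longrightarrow> t \<le> b \<longrightarrow> \<mu> * \<bar>\<Phi> (\<gamma> t) - \<Phi> (\<gamma> s)\<bar> \<le> integral {s..t} ?sp)" for s t
  have "P a b"
  proof (rule Bolzano)
    show "a \<le> b" using piece(2) by simp
    fix s t u assume stu: "P s t" "P t u" "s \<le> t" "t \<le> u"
    show "P s u" unfolding P_def
    proof (intro impI)
      assume su: "a \<le> s" "s \<le> u" "u \<le> b"
      have "\<bar>\<Phi> (\<gamma> u) - \<Phi> (\<gamma> s)\<bar> \<le> \<bar>\<Phi> (\<gamma> u) - \<Phi> (\<gamma> t)\<bar> + \<bar>\<Phi> (\<gamma> t) - \<Phi> (\<gamma> s)\<bar>" by simp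
      from mult_left_mono[OF this, of \<mu>] 
      show "\<mu> * \<bar>\<Phi> (\<gamma> u) - \<Phi> (\<gamma> s)\<bar> \<le> integral {s..u} ?sp"
        using \<mu>(1) stu su Henstock_Kurzweil_Integration.integral_combine[OF stu(3,4) int[OF su(1,3)]]
        unfolding P_def by (simp add: distrib_left)
    qed
  next
    fix x assume x: "a \<le> x" "x \<le> b"
    show "\<exists>d>0. \<forall>s t. s \<le> x \<and> x \<le> t \<and> t - s < d \<longrightarrow> P s t"
    proof (cases "\<gamma> x \<in> U")
      case True
      obtain d where d: "d > 0" "\<And>t. t \<in> {a..b} \<Longrightarrow> dist t x < d \<Longrightarrow> \<gamma> t \<in> U"
        using near[OF U True] x by auto
      have "P s t" if "s \<le> x" "x \<le> t" "t - s < d" for s t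
        unfolding P_def by (intro impI inU d(2)) (use that in \<open>auto simp: dist_real_def\<close>)
      then show ?thesis using d(1) by blast
    next
      case False
      have "\<gamma> x \<in> - K" using KU False by blast
      then obtain d where d: "d > 0" "\<And>t. t \<in> {a..b} \<Longrightarrow> dist t x < d \<Longrightarrow> \<gamma> t \<in> - K"
        using near[OF K \<open>\<gamma> x \<in> - K\<close>] x by (meson atLeastAtMost_iff)
      have "P s t" if st: "s \<le> x" "x \<le> t" "t - s < d" for s t
        unfolding P_def
      proof (intro impI)
        assume ab: "a \<le> s" "s \<le> t" "t \<le> b"
        then have "\<gamma> s \<notin> K" "\<gamma> t \<notin> K" using d(2)[of s] d(2)[of t] st by (auto simp: dist_real_def)
        moreover have "0 \<le> integral {s..t} ?sp"
          using int[OF ab(1,3)] by (rule integral_nonneg) (use speed_nonneg[OF C1] ab in auto)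
        ultimately show "\<mu> * \<bar>\<Phi> (\<gamma> t) - \<Phi> (\<gamma> s)\<bar> \<le> integral {s..t} ?sp" unfolding \<Phi>_def by simp
      qed
      then show ?thesis using d(1) by blast
    qed
  qed
  then show ?case using piece(2) integral_unique[OF piece(3)] unfolding P_def by simp
qed

text \<open>The truncated distance is 0 at \<open>p\<close> and equals \<open>r\<close> off the
  coordinate ball of radius \<open>r\<close>, so a curve from \<open>p\<close> to a point outside
  that ball has length at least \<open>\<mu> * r\<close>. Half of \<open>r2\<close> is taken because
  the estimate needs the ball of twice the radius inside the chart.\<close>

lemma joined_lower_bound:
  assumes c: "c \<in> A" "p \<in> fst c" and W: "open W" "p \<in> W"
  obtains \<epsilon> where "\<epsilon> > 0" "\<And>q L. joined p q L \<Longrightarrow> L < \<epsilon> \<Longrightarrow> q \<in> W"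
proof -
  define y\<^sub>0 where "y\<^sub>0 = snd c p"
  have "open (snd c ` (fst c \<inter> W))" "y\<^sub>0 \<in> snd c ` (fst c \<inter> W)"
    using open_chart_image[OF c(1) W(1)] c W unfolding y\<^sub>0_def by auto
  then obtain r2 where r2: "r2 > 0" "cball y\<^sub>0 r2 \<subseteq> snd c ` (fst c \<inter> W)"
    by (meson open_contains_cball)
  define r where "r = r2 / 2"
  have r: "r > 0" "cball y\<^sub>0 (2 * r) \<subseteq> snd c ` (fst c \<inter> W)" using r2 unfolding r_def by auto
  then have sub: "cball y\<^sub>0 (2 * r) \<subseteq> snd c ` fst c" by blast
  obtain \<mu> where \<mu>: "\<mu> > 0" "\<And>y v. y \<in> cball y\<^sub>0 (2 * r) \<Longrightarrow> \<mu> * norm v \<le> sqrt (G c y v v)"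
    by (rule metric_lower_bound[OF c(1) compact_cball sub]) blast
  let ?K = "chart_inv c ` cball y\<^sub>0 r"
  have KW: "?K \<subseteq> W"
  proof -
    have "cball y\<^sub>0 r \<subseteq> snd c ` (fst c \<inter> W)" using subset_cball[of r "2 * r" y\<^sub>0] r by force
    then show ?thesis using chart_inv_chart[OF c(1)] by auto
  qed
  have pK: "p \<in> ?K" using chart_inv_chart[OF c] r(1) by (intro image_eqI[of _ _ y\<^sub>0]) (auto simp: y\<^sub>0_def)
  show thesis
  proof (rule that[of "\<mu> * r"])
    show "\<mu> * r > 0" using \<mu>(1) r(1) by simp
    fix q L assume L: "joined p q L" "L < \<mu> * r"
    obtain \<gamma> a b where \<gamma>: "pw_length \<gamma> a b L" "\<gamma> a = p" "\<gamma> b = q" using L(1) unfolding joined_def by blast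
    have "q \<in> ?K"
    proof (rule ccontr)
      assume "q \<notin> ?K"
      then show False
        using truncated_distance_le_length[OF c(1) r(1) sub \<mu> \<gamma>(1)] \<gamma>(2,3) pK r(1) L(2)
        by (simp add: y\<^sub>0_def)
    qed
    then show "q \<in> W" using KW by blast
  qed
qed

section \<open>The distance as a metric, and convergence of curves of bounded speed\<close>

context
  assumes conn: "connected (UNIV :: 'a set)"
begin

lemma riem_dist_le_joined: "joined p q L \<Longrightarrow> riem_dist A g p q \<le> L"
  unfolding riem_dist_joined using joined_nonneg by (intro cInf_lower bdd_belowI[of _ 0]) auto

lemma riem_dist_greatest: "(\<And>L. joined p q L \<Longrightarrow> z \<le> L) \<Longrightarrow> z \<le> riem_dist A g p q"
  unfolding riem_dist_joined using joined_exists[OF conn, of p q] by (intro cInf_greatest) auto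

lemma riem_dist_less_joined:
  assumes "riem_dist A g p q < z" obtains L where "joined p q L" "L < z"
  using riem_dist_greatest[of p q z] assms by (meson not_le)

text \<open>Metric balls are small in the manifold topology. Hence limits for the distance are
  limits in the manifold, and in a Hausdorff manifold distinct points have positive
  distance.\<close>

lemma riem_dist_neighbourhood:
  assumes "open W" "p \<in> W"
  obtains \<epsilon> where "\<epsilon> > 0" "\<And>q. riem_dist A g p q < \<epsilon> \<Longrightarrow> q \<in> W"
proof -
  obtain c where c: "c \<in> A" "p \<in> fst c" by (rule chart_cover)
  obtain \<epsilon> where "\<epsilon> > 0" "\<And>q L. joined p q L \<Longrightarrow> L < \<epsilon> \<Longrightarrow> q \<in> W"
    using joined_lower_bound[OF c assms] by blast
  then show thesis using riem_dist_less_joined that by metis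
qed

lemma riem_dist_commute: "riem_dist A g p q = riem_dist A g q p"
proof -
  have "joined p q = joined q p" using joined_sym by blast
  then show ?thesis unfolding riem_dist_joined by simp
qed

lemma riem_dist_triangle: "riem_dist A g p r \<le> riem_dist A g p q + riem_dist A g q r"
proof -
  have "riem_dist A g p r - L \<le> riem_dist A g q r" if L: "joined p q L" for L
    by (rule riem_dist_greatest) (use riem_dist_le_joined[OF joined_trans[OF L]] in fastforce)
  then have "riem_dist A g p r - riem_dist A g q r \<le> riem_dist A g p q"
    by (intro riem_dist_greatest) fastforce
  then show ?thesis by simp
qed

lemma Metric_space_riem_dist: "Metric_space UNIV (riem_dist A g)"
proof
  show "0 \<le> riem_dist A g p q" for p q by (rule riem_dist_greatest) (rule joined_nonneg)
  show "riem_dist A g p q = riem_dist A g q p" for p q by (rule riem_dist_commute)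
  show "riem_dist A g p r \<le> riem_dist A g p q + riem_dist A g q r" for p q r by (rule riem_dist_triangle)
  fix p q
  show "riem_dist A g p q = 0 \<longleftrightarrow> p = q"
  proof
    assume 0: "riem_dist A g p q = 0"
    show "p = q"
    proof (rule ccontr)
      assume "p \<noteq> q"
      then obtain W where "open W" "p \<in> W" "q \<notin> W" using hausdorff by blast
      then show False using riem_dist_neighbourhood[of W p] 0 by metis
    qed
  next
    assume "p = q"
    then show "riem_dist A g p q = 0"
      using riem_dist_le_joined[OF joined_refl] riem_dist_greatest[of p p 0] joined_nonneg
      by (metis order_antisym)
  qed
qed

text \<open>Completeness speaks of sequences, so it is applied along times \<open>\<tau> n\<close>
  tending to \<open>b\<close>. Passing to the limit in the Lipschitz estimate bounds the distance
  from \<open>x t\<close> to \<open>p\<close> by a multiple of \<open>b - t\<close>, which gives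
  convergence along all times.\<close>

lemma lipschitz_curve_converges:
  assumes complete: "Metric_space.mcomplete UNIV (riem_dist A g)" and ab: "a < b"
    and lip: "\<And>s t. a < s \<Longrightarrow> s < t \<Longrightarrow> t < b \<Longrightarrow> riem_dist A g (x s) (x t) \<le> K * (t - s)"
  obtains p where "(x \<longlongrightarrow> p) (at_left b)"
proof -
  interpret M: Metric_space UNIV "riem_dist A g" by (rule Metric_space_riem_dist)
  let ?d = "riem_dist A g"
  have lip': "?d (x s) (x t) \<le> \<bar>K\<bar> * \<bar>t - s\<bar>" if "s \<in> {a<..<b}" "t \<in> {a<..<b}" for s t
  proof -
    have "?d (x s) (x t) \<le> \<bar>K\<bar> * (t - s)" if "a < s" "s < t" "t < b" for s t
      using lip[OF that] mult_right_mono[OF abs_ge_self[of K], of "t - s"] that by linarith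
    from this[of s t] this[of t s] show ?thesis
      using that M.commute[of "x s" "x t"] by (cases s t rule: linorder_cases) auto
  qed
  \<comment> \<open>With 2 in the denominator even the first time lies strictly to the right of
    \<open>a\<close>.\<close>
  define \<tau> where "\<tau> n = b - (b - a) / (real n + 2)" for n
  have \<tau>: "\<tau> n \<in> {a<..<b}" for n
  proof -
    have "(b - a) / (real n + 2) > 0" using ab by simp
    moreover have "(b - a) / (real n + 2) < b - a" using ab by (simp add: divide_less_eq)
    ultimately show ?thesis unfolding \<tau>_def by simp
  qed
  have \<tau>lim: "\<tau> \<longlonglongrightarrow> b"
  proof -
    have "(\<lambda>n. (b - a) / (real n + 2)) \<longlonglongrightarrow> 0" 
      using LIMSEQ_ignore_initial_segment[OF lim_const_over_n[of "b - a"], of 2] by (simp add: add.commute)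
    from tendsto_diff[OF tendsto_const[of b] this] show ?thesis unfolding \<tau>_def by simp
  qed
  have "M.MCauchy (\<lambda>n. x (\<tau> n))" unfolding M.MCauchy_def
  proof (intro conjI allI impI)
    fix \<epsilon> :: real assume \<epsilon>: "\<epsilon> > 0"
    have "Cauchy \<tau>" using \<tau>lim LIMSEQ_imp_Cauchy by blast
    moreover have "\<epsilon> / (\<bar>K\<bar> + 1) > 0" using \<epsilon> by (simp add: add_nonneg_pos)
    ultimately obtain N where N: "\<And>m n. m \<ge> N \<Longrightarrow> n \<ge> N \<Longrightarrow> dist (\<tau> m) (\<tau> n) < \<epsilon> / (\<bar>K\<bar> + 1)"
      unfolding Cauchy_def by metis
    have "?d (x (\<tau> m)) (x (\<tau> n)) < \<epsilon>" if "N \<le> m" "N \<le> n" for m n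
    proof -
      have "?d (x (\<tau> m)) (x (\<tau> n)) \<le> \<bar>K\<bar> * dist (\<tau> n) (\<tau> m)" using lip'[OF \<tau> \<tau>] by (simp add: dist_real_def)
      also have "\<dots> \<le> (\<bar>K\<bar> + 1) * dist (\<tau> n) (\<tau> m)" by (intro mult_right_mono) auto
      also have "\<dots> < \<epsilon>" using N[OF that(2,1)] by (simp add: pos_less_divide_eq mult.commute add_nonneg_pos)
      finally show ?thesis .
    qed
    then show "\<exists>N. \<forall>n n'. N \<le> n \<longrightarrow> N \<le> n' \<longrightarrow> ?d (x (\<tau> n)) (x (\<tau> n')) < \<epsilon>" by blast
  qed simp
  then obtain p where "limitin M.mtopology (\<lambda>n. x (\<tau> n)) p sequentially"
    using complete unfolding M.mcomplete_def by blast
  then have p: "\<exists>N. \<forall>n\<ge>N. ?d (x (\<tau> n)) p < \<epsilon>" if "\<epsilon> > 0" for \<epsilon>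
    using that unfolding M.limit_metric_sequentially by blast
  have dp: "?d (x t) p \<le> \<bar>K\<bar> * (b - t)" if t: "t \<in> {a<..<b}" for t
  proof (rule field_le_epsilon)
    fix \<epsilon> :: real assume "\<epsilon> > 0"
    then obtain N where N: "\<And>n. n \<ge> N \<Longrightarrow> ?d (x (\<tau> n)) p < \<epsilon>" using p by blast
    have "\<forall>\<^sub>F n in sequentially. t < \<tau> n" by (rule order_tendstoD(1)[OF \<tau>lim]) (use t in auto)
    then obtain n where n: "t < \<tau> n" "n \<ge> N" unfolding eventually_sequentially by (meson nle_le)
    have "?d (x t) p \<le> ?d (x t) (x (\<tau> n)) + ?d (x (\<tau> n)) p" by (rule riem_dist_triangle)
    also have "?d (x t) (x (\<tau> n)) \<le> \<bar>K\<bar> * (b - t)"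
      using lip'[OF t \<tau>, of n] mult_left_mono[of "\<bar>\<tau> n - t\<bar>" "b - t" "\<bar>K\<bar>"] \<tau>[of n] n(1) by auto
    finally show "?d (x t) p \<le> \<bar>K\<bar> * (b - t) + \<epsilon>" using N[OF n(2)] by simp
  qed
  have "(x \<longlongrightarrow> p) (at_left b)"
  proof (rule topological_tendstoI)
    fix W assume "open W" "p \<in> W"
    then obtain \<epsilon> where \<epsilon>: "\<epsilon> > 0" "\<And>q. ?d p q < \<epsilon> \<Longrightarrow> q \<in> W" using riem_dist_neighbourhood by blast
    have "((\<lambda>t. \<bar>K\<bar> * (b - t)) \<longlongrightarrow> \<bar>K\<bar> * (b - b)) (at_left b)" by (intro tendsto_intros)
    then have "\<forall>\<^sub>F t in at_left b. \<bar>K\<bar> * (b - t) < \<epsilon>" using \<epsilon>(1) by (intro order_tendstoD(2)) auto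
    moreover have "\<forall>\<^sub>F t in at_left b. t \<in> {a<..<b}" using ab by (intro eventually_at_leftI[of a]) auto
    ultimately show "\<forall>\<^sub>F t in at_left b. x t \<in> W"
    proof eventually_elim
      case (elim t)
      then show ?case using dp[OF elim(2)] M.commute[of p "x t"] by (intro \<epsilon>(2)) simp
    qed
  qed
  then show thesis by (rule that)
qed

end

end

section \<open>Generalized plane waves\<close>

context riem
begin

text \<open>Existence from \<open>riesz_metric\<close> and uniqueness from injectivity of
  \<open>flat\<close> give the definite description in \<open>gradient\<close> its value; the
  estimate is then Cauchy-Schwarz.\<close>

lemma abs_coord_vec_le_gradient:
  assumes f: "smooth_near A p f" and c: "c \<in> A" "p \<in> fst c"
  shows "\<bar>coord_vec A c p e f\<bar> \<le> tnorm g p (gradient A g f p) * sqrt (G c (snd c p) e e)"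
proof -
  have y: "snd c p \<in> snd c ` fst c" using c by blast
  have "linear (fd (f \<circ> chart_inv c) (snd c p))"
    using smooth_near_has_derivative[OF f c] has_derivative_linear by blast
  from riesz_metric[OF c(1) y this]
  obtain z where z: "\<And>e. G c (snd c p) z e = coord_vec A c p e f"
    unfolding coord_vec_apply[OF f] by blast
  have "gradient A g f p = coord_vec A c p z" unfolding gradient_def
  proof (rule the_equality)
    show "coord_vec A c p z \<in> tangent_space A p \<and> (\<forall>W\<in>tangent_space A p. g p (coord_vec A c p z) W = W f)"
      using z by (auto simp: tangent_space_chart[OF c] metric_coord_chart[OF c])
    fix V assume V: "V \<in> tangent_space A p \<and> (\<forall>W\<in>tangent_space A p. g p V W = W f)"
    then obtain z' where z': "V = coord_vec A c p z'" unfolding tangent_space_chart[OF c] by blast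
    have "G c (snd c p) z' e = G c (snd c p) z e" for e
      unfolding z using V coord_vec_tangent[OF c] metric_coord_chart[OF c] unfolding z' by metis
    then have "flat c (snd c p) z' = flat c (snd c p) z" unfolding flat_def by simp
    then show "V = coord_vec A c p z" using inj_flat[OF c(1) y] z' by (metis injD)
  qed
  then have "tnorm g p (gradient A g f p) = sqrt (G c (snd c p) z z)"
    unfolding tnorm_def by (simp add: metric_coord_chart[OF c])
  then show ?thesis using metric_coord_Cauchy_Schwarz[OF c(1) y, of z e] unfolding z by simp
qed

end

text \<open>All charts of \<open>gpw_atlas\<close> have this form. The second factor
  \<open>'b\<close> stays general because \<open>H\<close> lives on the product of \<open>M0\<close>
  with one copy of the reals, the wave on the product with two.\<close>

abbreviation slab :: "('a, 'e) chart \<Rightarrow> ('a \<times> 'b, 'e \<times> 'b) chart" where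
  "slab c \<equiv> prod_chart c (UNIV, id)"

lemma slab_simps:
  "fst (slab c) = fst c \<times> UNIV" "snd (slab c) (x, w) = (snd c x, w)"
  "snd (slab c) ` fst (slab c) = (snd c ` fst c) \<times> UNIV"
  by (auto simp: prod_chart_def image_iff intro!: bexI)

context smooth_mfd
begin

lemma chart_inv_slab:
  assumes "c \<in> A" "y \<in> snd c ` fst c" shows "chart_inv (slab c) (y, w) = (chart_inv c y, w)"
proof -
  have "inj_on (snd (slab c)) (fst (slab c :: ('a \<times> 'b, 'e \<times> 'b) chart))"
    by (rule inj_on_inverseI[of _ "map_prod (chart_inv c) id"])
      (use chart_inv_chart[OF assms(1)] in \<open>auto simp: prod_chart_def\<close>)
  moreover have "(chart_inv c y, w) \<in> fst (slab c)" "snd (slab c) (chart_inv c y, w) = (y, w)"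
    using chart_inv_domain[OF assms] chart_chart_inv[OF assms] by (auto simp: prod_chart_def)
  ultimately show ?thesis unfolding chart_inv_def[of "slab c"] by (metis inv_into_f_f)
qed

lemma slab_image_domain:
  "(snd (slab c) :: 'a \<times> 'b \<Rightarrow> 'e \<times> 'b) ` (fst (slab c) \<inter> W \<times> UNIV) = snd c ` (fst c \<inter> W) \<times> UNIV"
  by (force simp: prod_chart_def)

end

locale gpw =
  fixes A :: "('a::t2_space, 'e::euclidean_space) chart set" and g\<^sub>0 :: "'a tensor2"
    and H :: "'a \<Rightarrow> real \<Rightarrow> real"
  assumes gpw: "generalized_plane_wave A g\<^sub>0 H"

sublocale gpw \<subseteq> M0: riem A g\<^sub>0
  using gpw by unfold_locales (simp add: generalized_plane_wave_def)

sublocale gpw \<subseteq> M: semi_riem "gpw_atlas A" "gpw_metric A g\<^sub>0 H"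
  using gpw by unfold_locales (simp add: generalized_plane_wave_def lorentzian_manifold_def)

context gpw
begin

lemma slab_gpw_atlas: "c \<in> A \<Longrightarrow> slab c \<in> gpw_atlas A"
  unfolding gpw_atlas_def prod_atlas_def std_atlas_def by blast

lemma gpw_atlas_slabE: assumes "C \<in> gpw_atlas A" obtains c where "c \<in> A" "C = slab c"
  using assms unfolding gpw_atlas_def prod_atlas_def std_atlas_def by blast

text \<open>Because coordinate vectors vanish by convention on functions that are not smooth, their
  values on \<open>u_coord\<close>, \<open>v_coord\<close> and on functions pulled back from
  \<open>M0\<close> can be computed only once smoothness is established. It is required in every
  chart of the product atlas, hence a whole family \<open>h\<close> of local expressions.\<close>

lemma smooth_near_product:
  fixes h :: "('a, 'e) chart \<Rightarrow> 'e \<times> real \<times> real \<Rightarrow> real"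
  assumes W: "open W" "fst P \<in> W"
    and h: "\<And>c. c \<in> A \<Longrightarrow> smooth_on (snd c ` (fst c \<inter> W) \<times> UNIV) (h c)"
    and eq: "\<And>c x w. c \<in> A \<Longrightarrow> x \<in> fst c \<inter> W \<Longrightarrow> h c (snd c x, w) = F (x, w)"
  shows "smooth_near (gpw_atlas A) P F"
  unfolding smooth_near_def smooth_fun_on_def
proof (intro exI conjI ballI)
  show "open (W \<times> (UNIV :: (real \<times> real) set))" "P \<in> W \<times> UNIV" using W by (auto simp: open_Times mem_Times_iff)
  fix C assume "C \<in> gpw_atlas A"
  then obtain c where c: "c \<in> A" "C = slab c" by (rule gpw_atlas_slabE)
  have "smooth_on (snd c ` (fst c \<inter> W) \<times> UNIV) (F \<circ> chart_inv C)"
  proof (rule smooth_on_cong[OF _ _ h[OF c(1)]])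
    show "open (snd c ` (fst c \<inter> W) \<times> (UNIV :: (real \<times> real) set))"
      using M0.open_chart_image[OF c(1) W(1)] by (intro open_Times) auto
    show "h c z = (F \<circ> chart_inv C) z" if z: "z \<in> snd c ` (fst c \<inter> W) \<times> UNIV" for z
    proof -
      obtain x w where "x \<in> fst c \<inter> W" "z = (snd c x, w)" using z by auto
      then show ?thesis
        using eq[OF c(1), of x w] M0.chart_inv_slab[OF c(1), of "snd c x" w] M0.chart_inv_chart[OF c(1), of x]
        unfolding c(2) by simp
    qed
  qed
  then show "smooth_on (snd C ` (fst C \<inter> W \<times> UNIV)) (F \<circ> chart_inv C)"
    unfolding c(2) M0.slab_image_domain .
qed

lemma coord_vec_slab:
  assumes c: "c \<in> A" "x \<in> fst c" and sm: "smooth_near (gpw_atlas A) (x, w) F"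
    and W: "open W" "x \<in> W" and eq: "\<And>x' w'. x' \<in> fst c \<inter> W \<Longrightarrow> h (snd c x', w') = F (x', w')"
    and D: "(h has_derivative D) (at (snd c x, w))"
  shows "coord_vec (gpw_atlas A) (slab c) (x, w) E F = D E"
proof -
  have "((F \<circ> chart_inv (slab c)) has_derivative D) (at (snd c x, w))"
  proof (rule has_derivative_transform_within_open[OF D])
    show "open (snd c ` (fst c \<inter> W) \<times> (UNIV :: (real \<times> real) set))"
      using M0.open_chart_image[OF c(1) W(1)] by (intro open_Times) auto
    show "(snd c x, w) \<in> snd c ` (fst c \<inter> W) \<times> UNIV" using c W by auto
    show "h z = (F \<circ> chart_inv (slab c)) z" if z: "z \<in> snd c ` (fst c \<inter> W) \<times> UNIV" for z
    proof -
      obtain x w where "x \<in> fst c \<inter> W" "z = (snd c x, w)" using z by auto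
      then show ?thesis
        using eq[of x w] M0.chart_inv_slab[OF c(1), of "snd c x" w] M0.chart_inv_chart[OF c(1), of x]
        by simp
    qed
  qed
  from fd_eqI[OF this] show ?thesis
    using M.coord_vec_apply[OF sm, of "slab c" E] by (simp add: slab_simps)
qed

lemma coord_vec_u_coord:
  assumes "c \<in> A" "x \<in> fst c"
  shows "coord_vec (gpw_atlas A) (slab c) (x, w) (e, a, b) u_coord = a"
proof -
  have bl: "bounded_linear (\<lambda>z :: 'e \<times> real \<times> real. fst (snd z))"
    by (rule bounded_linear_compose[OF bounded_linear_fst bounded_linear_snd])
  have "smooth_near (gpw_atlas A) (x, w) u_coord"
    by (rule smooth_near_product[of UNIV _ "\<lambda>c z. fst (snd z)"])
      (auto simp: u_coord_def split_beta intro: smooth_on_bounded_linear[OF bl])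
  from coord_vec_slab[OF assms this _ _ _ bounded_linear_imp_has_derivative[OF bl], of UNIV]
  show ?thesis by (simp add: u_coord_def split_beta)
qed

lemma coord_vec_v_coord:
  assumes "c \<in> A" "x \<in> fst c"
  shows "coord_vec (gpw_atlas A) (slab c) (x, w) (e, a, b) v_coord = b"
proof -
  have bl: "bounded_linear (\<lambda>z :: 'e \<times> real \<times> real. snd (snd z))"
    by (rule bounded_linear_compose[OF bounded_linear_snd bounded_linear_snd])
  have "smooth_near (gpw_atlas A) (x, w) v_coord"
    by (rule smooth_near_product[of UNIV _ "\<lambda>c z. snd (snd z)"])
      (auto simp: v_coord_def split_beta intro: smooth_on_bounded_linear[OF bl])
  from coord_vec_slab[OF assms this _ _ _ bounded_linear_imp_has_derivative[OF bl], of UNIV]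
  show ?thesis by (simp add: v_coord_def split_beta)
qed

lemma pushforward_coord_vec:
  assumes c: "c \<in> A" "x \<in> fst c"
  shows "pushforward A fst (x, w) (coord_vec (gpw_atlas A) (slab c) (x, w) (e, a, b)) = coord_vec A c x e"
proof
  fix f
  show "pushforward A fst (x, w) (coord_vec (gpw_atlas A) (slab c) (x, w) (e, a, b)) f = coord_vec A c x e f"
  proof (cases "smooth_near A x f")
    case True
    obtain W where W: "open W" "x \<in> W" "smooth_fun_on A W f" using True unfolding smooth_near_def by blast
    \<comment> \<open>The summand 0 brings \<open>?h\<close> into the affine form expected by
      \<open>smooth_on_compose_affine\<close>.\<close>
    let ?h = "\<lambda>c z. (f \<circ> chart_inv c) (0 + fst z)"
    have eq: "?h c (snd c x', w') = (f \<circ> fst) (x', w')" if "c \<in> A" "x' \<in> fst c \<inter> W" for c x' w'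
      using that by (simp add: M0.chart_inv_chart)
    have "smooth_on (snd c ` (fst c \<inter> W) \<times> UNIV) (?h c)" if "c \<in> A" for c
      by (rule smooth_on_compose_affine[OF bounded_linear_fst, of _ _ "snd c ` (fst c \<inter> W)"])
        (use that W M0.open_chart_image[OF that W(1)] in \<open>auto simp: smooth_fun_on_def o_def intro!: open_Times\<close>)
    from smooth_near_product[of W "(x, w)" ?h "f \<circ> fst", OF W(1) _ this eq] W(2)
    have sm: "smooth_near (gpw_atlas A) (x, w) (f \<circ> fst)" by simp
    have D: "(?h c has_derivative (\<lambda>z. fd (f \<circ> chart_inv c) (snd c x) (fst z))) (at (snd c x, w))"
      using has_derivative_compose[OF bounded_linear_imp_has_derivative[OF bounded_linear_fst], of "f \<circ> chart_inv c" _ "(snd c x, w)"]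
        M0.smooth_near_has_derivative[OF True c] by simp
    have "coord_vec (gpw_atlas A) (slab c) (x, w) (e, a, b) (f \<circ> fst) = fd (f \<circ> chart_inv c) (snd c x) e"
      using coord_vec_slab[OF c sm W(1,2) _ D, of "(e, a, b)"] eq[OF c(1)] by simp
    then show ?thesis using True by (simp add: pushforward_def M0.coord_vec_apply)
  qed (simp add: pushforward_def coord_vec_def)
qed

section \<open>The wave metric and its geodesic equation in product charts\<close>

definition H_coord :: "('a, 'e) chart \<Rightarrow> 'e \<times> real \<Rightarrow> real" where
  "H_coord c z = H (chart_inv c (fst z)) (snd z)"

lemma smooth_H_coord:
  assumes "c \<in> A" shows "smooth_on ((snd c ` fst c) \<times> UNIV) (H_coord c)"
proof -
  have "slab c \<in> prod_atlas A std_atlas" using assms unfolding prod_atlas_def std_atlas_def by blast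
  then have "smooth_on (snd (slab c) ` (fst (slab c) \<inter> UNIV)) ((\<lambda>(x, u). H x u) \<circ> chart_inv (slab c))"
    using gpw unfolding generalized_plane_wave_def smooth_fun_on_def by blast
  then have 1: "smooth_on ((snd c ` fst c) \<times> (UNIV :: real set)) ((\<lambda>(x, u). H x u) \<circ> chart_inv (slab c))"
    unfolding Int_UNIV_right slab_simps(3) .
  have "open ((snd c ` fst c) \<times> (UNIV :: real set))" using M0.open_image[OF assms] by (intro open_Times) auto
  then show ?thesis
    by (rule smooth_on_cong[OF _ _ 1]) (auto simp: H_coord_def M0.chart_inv_slab[OF assms])
qed

lemma smooth_near_H: "smooth_near A p (\<lambda>x. H x u)"
proof -
  have "smooth_on (snd c ` (fst c \<inter> UNIV)) ((\<lambda>x. H x u) \<circ> chart_inv c)" if c: "c \<in> A" for c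
  proof -
    have "bounded_linear (\<lambda>y::'e. (y, 0 :: real))"
      by (intro bounded_linear_Pair bounded_linear_ident bounded_linear_zero)
    from smooth_on_compose_affine[OF this M0.open_image[OF c], of "(0, u)", OF _ smooth_H_coord[OF c]]
    show ?thesis by (simp add: H_coord_def o_def)
  qed
  then show ?thesis unfolding smooth_near_def smooth_fun_on_def by (intro exI[of _ UNIV]) auto
qed

text \<open>The gradient in the growth condition differentiates at fixed \<open>u\<close>; in the
  two-variable derivative that occurs in the geodesic equation this is the increment
  \<open>(e, 0)\<close>.\<close>

lemma coord_vec_H:
  assumes c: "c \<in> A" "x \<in> fst c"
  shows "coord_vec A c x e (\<lambda>x. H x u) = fd (H_coord c) (snd c x, u) (e, 0)"
proof -
  have D: "(H_coord c has_derivative fd (H_coord c) (snd c x, u)) (at (snd c x, u))"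
    by (rule smooth_on_has_derivative[OF smooth_H_coord[OF c(1)]]) (use c in auto)
  have P: "((\<lambda>y. (y, u)) has_derivative (\<lambda>e. (e, 0))) (at (snd c x))"
    by (auto intro!: derivative_eq_intros)
  have "((\<lambda>y. H_coord c (y, u)) has_derivative (\<lambda>e. fd (H_coord c) (snd c x, u) (e, 0))) (at (snd c x))"
    using has_derivative_compose[OF P D] .
  then have "(((\<lambda>x. H x u) \<circ> chart_inv c) has_derivative (\<lambda>e. fd (H_coord c) (snd c x, u) (e, 0))) (at (snd c x))"
    by (simp add: H_coord_def o_def)
  from fd_eqI[OF this] show ?thesis using M0.coord_vec_apply[OF smooth_near_H] by metis
qed

lemma gpw_metric_coord:
  assumes c: "c \<in> A" and y: "y \<in> snd c ` fst c"
  shows "M.G (slab c) (y, u, v) (e, a, b) (e', a', b')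
    = M0.G c y e e' + (a * b' + b * a') + H_coord c (y, u) * a * a'"
proof -
  note d = M0.chart_inv_domain[OF c y]
  show ?thesis
    unfolding metric_coord_def M0.chart_inv_slab[OF c y] gpw_metric_def
      coord_vec_u_coord[OF c d] coord_vec_v_coord[OF c d] pushforward_coord_vec[OF c d]
    by (simp add: H_coord_def u_coord_def)
qed

lemma gpw_metric_coord_deriv:
  assumes c: "c \<in> A" and y: "y \<in> snd c ` fst c"
  shows "M.DG (slab c) (y, u, v) (d, du, dv) (e, a, b) (e', a', b')
    = M0.DG c y d e e' + fd (H_coord c) (y, u) (d, du) * a * a'"
proof -
  have D1: "((\<lambda>y. M0.G c y e e') has_derivative (\<lambda>d. M0.DG c y d e e')) (at y)"
    using smooth_on_has_derivative[OF M0.smooth_metric_coord[OF c] y] .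
  have D2: "(H_coord c has_derivative fd (H_coord c) (y, u)) (at (y, u))"
    by (rule smooth_on_has_derivative[OF smooth_H_coord[OF c]]) (use y in auto)
  have f: "(fst has_derivative fst) (at (y, u, v))"
    by (rule bounded_linear_imp_has_derivative[OF bounded_linear_fst])
  have s: "((\<lambda>z. (fst z, fst (snd z))) has_derivative (\<lambda>z. (fst z, fst (snd z)))) (at (y, u, v))"
    by (intro bounded_linear_imp_has_derivative bounded_linear_Pair bounded_linear_fst
        bounded_linear_compose[OF bounded_linear_fst bounded_linear_snd])
  have 1: "((\<lambda>z. M0.G c (fst z) e e') has_derivative (\<lambda>z. M0.DG c y (fst z) e e')) (at (y, u, v))"
    using has_derivative_compose[OF f, of "\<lambda>y. M0.G c y e e'"] D1 by simp
  have 2: "((\<lambda>z. H_coord c (fst z, fst (snd z))) has_derivative (\<lambda>z. fd (H_coord c) (y, u) (fst z, fst (snd z)))) (at (y, u, v))"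
    using has_derivative_compose[OF s, of "H_coord c"] D2 by simp
  have "((\<lambda>z. M0.G c (fst z) e e' + (a * b' + b * a') + H_coord c (fst z, fst (snd z)) * a * a') has_derivative
      (\<lambda>z. M0.DG c y (fst z) e e' + fd (H_coord c) (y, u) (fst z, fst (snd z)) * a * a')) (at (y, u, v))"
    by (rule derivative_eq_intros 1 2 refl | simp)+
  then have "((\<lambda>z. M.G (slab c) z (e, a, b) (e', a', b')) has_derivative
      (\<lambda>z. M0.DG c y (fst z) e e' + fd (H_coord c) (y, u) (fst z, fst (snd z)) * a * a')) (at (y, u, v))"
  proof (rule has_derivative_transform_within_open)
    show "open ((snd c ` fst c) \<times> (UNIV :: (real \<times> real) set))" using M0.open_image[OF c] by (intro open_Times) auto
  qed (use y gpw_metric_coord[OF c] in auto)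
  from fd_eqI[OF this] show ?thesis by simp
qed

text \<open>These are the Euler-Lagrange equations tested with \<open>\<partial>\<^sub>v\<close>, \<open>\<partial>\<^sub>u\<close> and the velocity in \<open>M\<^sub>0\<close>.\<close>

lemma geodesic_components:
  fixes \<gamma> :: "real \<Rightarrow> 'a \<times> real \<times> real"
  assumes c: "c \<in> A" and geo: "M.geodesic_at (slab c) \<gamma> t"
  defines "y \<equiv> \<lambda>s. snd c (fst (\<gamma> s))" and "u \<equiv> \<lambda>s. fst (snd (\<gamma> s))" and "v \<equiv> \<lambda>s. snd (snd (\<gamma> s))"
  defines "y' \<equiv> \<lambda>s. vector_derivative y (at s)" and "u' \<equiv> \<lambda>s. vector_derivative u (at s)"
    and "v' \<equiv> \<lambda>s. vector_derivative v (at s)"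
  obtains y'' where "fst (\<gamma> t) \<in> fst c" "isCont \<gamma> t"
    "\<forall>\<^sub>F s in nhds t. (y has_vector_derivative y' s) (at s) \<and> (u has_vector_derivative u' s) (at s)
      \<and> (v has_vector_derivative v' s) (at s)"
    "(y' has_vector_derivative y'') (at t)" "(u' has_vector_derivative 0) (at t)"
    "(v' has_vector_derivative (u' t)\<^sup>2 * fd (H_coord c) (y t, u t) (0, 1) / 2 - u' t * fd (H_coord c) (y t, u t) (y' t, u' t)) (at t)"
    "M0.G c (y t) y'' (y' t) + M0.DG c (y t) (y' t) (y' t) (y' t) / 2 = (u' t)\<^sup>2 * fd (H_coord c) (y t, u t) (y' t, 0) / 2"
proof -
  let ?w = "snd (slab c) \<circ> \<gamma>"
  have w: "?w = (\<lambda>s. (y s, u s, v s))"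
    by (auto simp: y_def u_def v_def slab_simps prod_eq_iff prod_chart_def)
  have t: "fst (\<gamma> t) \<in> fst c" "isCont \<gamma> t"
    using geo eventually_nhds_x_imp_x unfolding M.geodesic_at_def
    by (auto simp: slab_simps mem_Times_iff)
  obtain w'' where ev: "\<forall>\<^sub>F s in nhds t. (?w has_vector_derivative vector_derivative ?w (at s)) (at s)"
    and w'': "((\<lambda>s. vector_derivative ?w (at s)) has_vector_derivative w'') (at t)"
    and eq: "w'' + christoffel (gpw_atlas A) (gpw_metric A g\<^sub>0 H) (slab c) (snd (slab c) (\<gamma> t))
       (vector_derivative ?w (at t)) (vector_derivative ?w (at t)) = 0"
    by (rule M.geodesic_at_vector_derivative[OF geo])
  have comp: "(y has_vector_derivative y' s) (at s) \<and> (u has_vector_derivative u' s) (at s)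
      \<and> (v has_vector_derivative v' s) (at s) \<and> vector_derivative ?w (at s) = (y' s, u' s, v' s)"
    if "(?w has_vector_derivative vector_derivative ?w (at s)) (at s)" for s
  proof -
    let ?d = "vector_derivative ?w (at s)"
    have "(y has_vector_derivative fst ?d) (at s)"
      using bounded_linear.has_vector_derivative[OF bounded_linear_fst that] by (simp add: w)
    moreover have "(u has_vector_derivative fst (snd ?d)) (at s)"
      using bounded_linear.has_vector_derivative[OF bounded_linear_compose[OF bounded_linear_fst bounded_linear_snd] that]
      by (simp add: w)
    moreover have "(v has_vector_derivative snd (snd ?d)) (at s)"
      using bounded_linear.has_vector_derivative[OF bounded_linear_compose[OF bounded_linear_snd bounded_linear_snd] that]
      by (simp add: w)
    ultimately show ?thesis
      by (simp add: y'_def u'_def v'_def vector_derivative_at prod_eq_iff)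
  qed
  have ev': "\<forall>\<^sub>F s in nhds t. vector_derivative ?w (at s) = (y' s, u' s, v' s)"
    using ev by eventually_elim (use comp in blast)
  note wt = eventually_nhds_x_imp_x[OF ev']
  obtain y'' u'' v'' where w''_eq: "w'' = (y'', u'', v'')" by (cases w'') auto
  have w''2: "((\<lambda>s. (y' s, u' s, v' s)) has_vector_derivative (y'', u'', v'')) (at t)"
    using has_vector_derivative_transform_nhds[OF w'' ev'] unfolding w''_eq .
  have d: "(y' has_vector_derivative y'') (at t)" "(u' has_vector_derivative u'') (at t)" "(v' has_vector_derivative v'') (at t)"
    using bounded_linear.has_vector_derivative[OF bounded_linear_fst w''2]
      bounded_linear.has_vector_derivative[OF bounded_linear_compose[OF bounded_linear_fst bounded_linear_snd] w''2]
      bounded_linear.has_vector_derivative[OF bounded_linear_compose[OF bounded_linear_snd bounded_linear_snd] w''2]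
    by simp_all
  have yt: "y t \<in> snd c ` fst c" using t(1) unfolding y_def by blast
  have wc: "snd (slab c) (\<gamma> t) = (y t, u t, v t)" using fun_cong[OF w, of t] by simp
  have in_img: "(y t, u t, v t) \<in> snd (slab c) ` fst (slab c)" unfolding slab_simps(3) using yt by simp
  have EL0: "M.EL (slab c) (y t, u t, v t) (y' t, u' t, v' t) (y'', u'', v'') E = 0" for E
    using eq unfolding wt wc w''_eq M.geodesic_equation_iff[OF slab_gpw_atlas[OF c] in_img] by blast
  have EL: "M0.G c (y t) y'' e + (u'' * b + v'' * a) + H_coord c (y t, u t) * u'' * a
      + (M0.DG c (y t) (y' t) (y' t) e + fd (H_coord c) (y t, u t) (y' t, u' t) * u' t * a)
      - (M0.DG c (y t) e (y' t) (y' t) + fd (H_coord c) (y t, u t) (e, a) * u' t * u' t) / 2 = 0" for e a b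
    using EL0[of "(e, a, b)"] unfolding M.EL_def gpw_metric_coord[OF c yt] gpw_metric_coord_deriv[OF c yt] .
  note lin0 = linear_0[OF M0.metric_coord_linear_right[OF c yt]] linear_0[OF M0.metric_coord_deriv_linear3[OF c yt]]
    linear_0[OF M0.metric_coord_deriv_linear1[OF c yt]]
  have hl: "linear (fd (H_coord c) (y t, u t))" using fd_linear[OF smooth_H_coord[OF c], of "(y t, u t)"] yt by auto
  \<comment> \<open>The free variables of \<open>EL\<close> occur in the order \<open>e\<close>,
    \<open>b\<close>, \<open>a\<close>, and the instances here and below are to be read in this
    order.\<close>
  have u0: "u'' = 0"
    using EL[of 0 1 0] linear_0[OF hl] by (simp add: lin0 zero_prod_def)
  have v0: "v'' = (u' t)\<^sup>2 * fd (H_coord c) (y t, u t) (0, 1) / 2 - u' t * fd (H_coord c) (y t, u t) (y' t, u' t)"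
    using EL[of 0 0 1] by (simp add: lin0 u0 power2_eq_square algebra_simps)
  have e0: "M0.G c (y t) y'' (y' t) + M0.DG c (y t) (y' t) (y' t) (y' t) / 2 = (u' t)\<^sup>2 * fd (H_coord c) (y t, u t) (y' t, 0) / 2"
    using EL[of "y' t" 0 0] by (simp add: u0 power2_eq_square field_simps)
  show thesis
  proof (rule that[OF t _ d(1)])
    show "\<forall>\<^sub>F s in nhds t. (y has_vector_derivative y' s) (at s) \<and> (u has_vector_derivative u' s) (at s)
      \<and> (v has_vector_derivative v' s) (at s)"
      using ev by eventually_elim (use comp in blast)
  qed (use d(2,3) u0 v0 e0 in simp_all)
qed

end

section \<open>Completeness\<close>

context gpw
begin

lemma connected_base: "connected (UNIV :: 'a set)"
  using gpw unfolding generalized_plane_wave_def by blast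

section \<open>Energy estimates along a fixed geodesic\<close>

context
  fixes I :: "real set" and \<gamma> :: "real \<Rightarrow> 'a \<times> real \<times> real"
  assumes geo: "geodesic (gpw_atlas A) (gpw_metric A g\<^sub>0 H) I \<gamma>"
begin

abbreviation x where "x \<equiv> \<lambda>t. fst (\<gamma> t)"
abbreviation u where "u \<equiv> \<lambda>t. fst (snd (\<gamma> t))"
abbreviation v where "v \<equiv> \<lambda>t. snd (snd (\<gamma> t))"
abbreviation u' where "u' \<equiv> \<lambda>t. vector_derivative u (at t)"
abbreviation v' where "v' \<equiv> \<lambda>t. vector_derivative v (at t)"

text \<open>The squared speed of the projection to \<open>M0\<close>. Being positive definite, it
  controls the velocity there, which the Lorentzian square of the velocity of
  \<open>\<gamma>\<close> cannot do.\<close>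

definition energy :: "real \<Rightarrow> real" where
  "energy t = g\<^sub>0 (x t) (velocity A x t) (velocity A x t)"

lemma geodesic_at_slab:
  assumes "t \<in> I" "c \<in> A" "x t \<in> fst c" shows "M.geodesic_at (slab c) \<gamma> t"
proof -
  obtain C where "C \<in> gpw_atlas A" "M.geodesic_at C \<gamma> t"
    using geo assms(1) unfolding M.geodesic_iff by blast
  then show ?thesis
    using M.geodesic_at_transfer[of C \<gamma> t "slab c"] slab_gpw_atlas[OF assms(2)] assms(3)
    by (simp add: slab_simps mem_Times_iff)
qed

lemma geodesic_interval: "open I" "is_interval I"
  using geo unfolding M.geodesic_iff by auto

lemma isCont_components:
  assumes "t \<in> I" shows "isCont \<gamma> t" "isCont x t"
proof -
  obtain c where c: "c \<in> A" "x t \<in> fst c" by (rule M0.chart_cover)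
  show "isCont \<gamma> t" by (rule geodesic_components[OF c(1) geodesic_at_slab[OF assms c]])
  then show "isCont x t" by (intro continuous_intros)
qed

lemma u_affine: obtains k m where "\<And>t. t \<in> I \<Longrightarrow> u' t = k" "\<And>t. t \<in> I \<Longrightarrow> u t = m + k * t"
proof -
  have d: "(u has_real_derivative u' t) (at t)" "(u' has_real_derivative 0) (at t)" if t: "t \<in> I" for t
  proof -
    obtain c where c: "c \<in> A" "x t \<in> fst c" by (rule M0.chart_cover)
    show "(u' has_real_derivative 0) (at t)"
      unfolding has_real_derivative_iff_has_vector_derivative
      by (rule geodesic_components[OF c(1) geodesic_at_slab[OF t c]])
    show "(u has_real_derivative u' t) (at t)"
      unfolding has_real_derivative_iff_has_vector_derivative
      by (rule geodesic_components[OF c(1) geodesic_at_slab[OF t c]])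
        (auto dest: eventually_nhds_x_imp_x)
  qed
  have conv: "convex I" using geodesic_interval(2) by (rule is_interval_convex)
  obtain k where k: "\<And>t. t \<in> I \<Longrightarrow> u' t = k"
    using has_field_derivative_zero_constant[OF conv, of u'] d(2) has_field_derivative_at_within by metis
  have "((\<lambda>t. u t - k * t) has_real_derivative 0) (at t within I)" if t: "t \<in> I" for t
    using has_field_derivative_at_within[OF d(1)[OF t], of I] k[OF t] by (auto intro!: derivative_eq_intros)
  then obtain m where "\<And>t. t \<in> I \<Longrightarrow> u t - k * t = m"
    using has_field_derivative_zero_constant[OF conv, of "\<lambda>t. u t - k * t"] by metis
  then show thesis using k that[of k m] by (simp add: algebra_simps)
qed

lemma velocity_base:
  assumes t: "t \<in> I" and c: "c \<in> A" "x t \<in> fst c"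
  shows "velocity A x t = coord_vec A c (x t) (vector_derivative (\<lambda>s. snd c (x s)) (at t))"
proof -
  have "((\<lambda>s. snd c (x s)) has_vector_derivative vector_derivative (\<lambda>s. snd c (x s)) (at t)) (at t)"
    by (rule geodesic_components[OF c(1) geodesic_at_slab[OF t c]]) (auto dest: eventually_nhds_x_imp_x)
  then show ?thesis using M0.velocity_chart[where \<gamma> = x, OF c isCont_components(2)[OF t]] by (simp add: o_def)
qed

lemma energy_chart:
  assumes t: "t \<in> I" and c: "c \<in> A" "x t \<in> fst c"
  defines "y' \<equiv> vector_derivative (\<lambda>s. snd c (x s)) (at t)"
  shows "energy t = M0.G c (snd c (x t)) y' y'"
  unfolding energy_def velocity_base[OF assms(1-3)] y'_def by (simp add: M0.metric_coord_chart[OF c])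

lemma energy_nonneg: assumes "t \<in> I" shows "energy t \<ge> 0"
proof -
  obtain c where c: "c \<in> A" "x t \<in> fst c" by (rule M0.chart_cover)
  then show ?thesis unfolding energy_chart[OF assms c] by (intro M0.metric_coord_nonneg) auto
qed

text \<open>By the Leibniz rule and the symmetry of the metric, the derivative of the energy is
  twice the left side of the last identity in \<open>geodesic_components\<close>, that is
  \<open>(u' t)\<^sup>2\<close> times the derivative of \<open>H\<close> along the velocity at fixed
  \<open>u\<close>. Cauchy-Schwarz brings in the gradient.\<close>

lemma energy_derivative:
  assumes t: "t \<in> I"
  obtains D where "(energy has_real_derivative D) (at t)"
    "D \<le> (u' t)\<^sup>2 * tnorm g\<^sub>0 (x t) (gradient A g\<^sub>0 (\<lambda>p. H p (u t)) (x t)) * sqrt (energy t)"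
proof -
  obtain c where c: "c \<in> A" "x t \<in> fst c" by (rule M0.chart_cover)
  let ?y = "\<lambda>s. snd c (x s)" and ?y' = "\<lambda>s. vector_derivative (\<lambda>s. snd c (x s)) (at s)"
  obtain y'' where ev: "\<forall>\<^sub>F s in nhds t. (?y has_vector_derivative ?y' s) (at s) \<and>
      (u has_vector_derivative u' s) (at s) \<and> (v has_vector_derivative v' s) (at s)"
    and y'': "(?y' has_vector_derivative y'') (at t)"
    and eq: "M0.G c (?y t) y'' (?y' t) + M0.DG c (?y t) (?y' t) (?y' t) (?y' t) / 2
      = (u' t)\<^sup>2 * fd (H_coord c) (?y t, u t) (?y' t, 0) / 2"
    by (rule geodesic_components[OF c(1) geodesic_at_slab[OF t c]]) blast
  have y': "(?y has_vector_derivative ?y' t) (at t)" using eventually_nhds_x_imp_x[OF ev] by blast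
  have yt: "?y t \<in> snd c ` fst c" using c by blast
  let ?D = "(u' t)\<^sup>2 * fd (H_coord c) (?y t, u t) (?y' t, 0)"
  have "((\<lambda>s. M0.G c (?y s) (?y' s) (?y' s)) has_derivative
     (\<lambda>r. M0.DG c (?y t) (r *\<^sub>R ?y' t) (?y' t) (?y' t) + M0.G c (?y t) (r *\<^sub>R y'') (?y' t) + M0.G c (?y t) (?y' t) (r *\<^sub>R y''))) (at t)"
    by (rule M0.metric_coord_has_derivative[OF c(1) yt UNIV_I y'[unfolded has_vector_derivative_def]
          y''[unfolded has_vector_derivative_def] y''[unfolded has_vector_derivative_def]])
  moreover have "(\<lambda>r. M0.DG c (?y t) (r *\<^sub>R ?y' t) (?y' t) (?y' t) + M0.G c (?y t) (r *\<^sub>R y'') (?y' t) + M0.G c (?y t) (?y' t) (r *\<^sub>R y''))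
      = (\<lambda>r. r *\<^sub>R ?D)"
  proof
    fix r
    have "M0.DG c (?y t) (?y' t) (?y' t) (?y' t) + M0.G c (?y t) y'' (?y' t) + M0.G c (?y t) y'' (?y' t) = ?D"
      using eq by simp
    then show "M0.DG c (?y t) (r *\<^sub>R ?y' t) (?y' t) (?y' t) + M0.G c (?y t) (r *\<^sub>R y'') (?y' t) + M0.G c (?y t) (?y' t) (r *\<^sub>R y'')
      = r *\<^sub>R ?D"
      using M0.metric_coord_sym[OF c(1) yt, of "?y' t" "r *\<^sub>R y''"]
      by (simp add: linear_scale[OF M0.metric_coord_deriv_linear1[OF c(1) yt]]
          linear_scale[OF M0.metric_coord_linear_left[OF c(1) yt]] flip: distrib_left)
  qed
  ultimately have d: "((\<lambda>s. M0.G c (?y s) (?y' s) (?y' s)) has_vector_derivative ?D) (at t)"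
    unfolding has_vector_derivative_def by simp
  have "\<forall>\<^sub>F s in nhds t. s \<in> I" using geodesic_interval(1) t by (rule eventually_nhds_in_open)
  moreover have "\<forall>\<^sub>F s in nhds t. x s \<in> fst c"
    by (rule isCont_eventually_in_open[OF isCont_components(2)[OF t] M0.open_domain[OF c(1)] c(2)])
  ultimately have "\<forall>\<^sub>F s in nhds t. M0.G c (?y s) (?y' s) (?y' s) = energy s"
    by eventually_elim (rule energy_chart[symmetric, OF _ c(1)])
  from has_vector_derivative_transform_nhds[OF d this]
  have "(energy has_real_derivative ?D) (at t)" by (simp add: has_real_derivative_iff_has_vector_derivative)
  moreover have "?D \<le> (u' t)\<^sup>2 * (tnorm g\<^sub>0 (x t) (gradient A g\<^sub>0 (\<lambda>p. H p (u t)) (x t)) * sqrt (energy t))"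
  proof (rule mult_left_mono)
    show "fd (H_coord c) (?y t, u t) (?y' t, 0)
      \<le> tnorm g\<^sub>0 (x t) (gradient A g\<^sub>0 (\<lambda>p. H p (u t)) (x t)) * sqrt (energy t)"
      using M0.abs_coord_vec_le_gradient[OF smooth_near_H c, of "?y' t" "u t"]
      unfolding coord_vec_H[OF c] energy_chart[OF t c] by linarith
  qed simp
  ultimately show thesis using that by (simp add: mult.assoc)
qed

lemma continuous_on_speed_base: "continuous_on I (\<lambda>t. sqrt (energy t))"
proof (intro continuous_on_real_sqrt continuous_at_imp_continuous_on ballI)
  fix t assume "t \<in> I"
  then obtain D where "(energy has_real_derivative D) (at t)" by (rule energy_derivative)
  then show "isCont energy t" by (rule DERIV_isCont)
qed

lemma riem_dist_le_integral_speed: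
  assumes st: "s < t" "{s..t} \<subseteq> I"
  shows "riem_dist A g\<^sub>0 (x s) (x t) \<le> integral {s..t} (\<lambda>t. sqrt (energy t))"
proof -
  have "C1_curve A x s t" unfolding C1_curve_def
  proof (intro conjI ballI)
    show "continuous_on {s..t} x"
      by (intro continuous_at_imp_continuous_on ballI isCont_components(2)) (use st in auto)
    fix c assume c: "c \<in> A"
    let ?y' = "\<lambda>s. vector_derivative (\<lambda>s. snd c (x s)) (at s)"
    have *: "isCont ?y' r \<and> ((\<lambda>s. snd c (x s)) has_vector_derivative ?y' r) (at r)"
      if r: "r \<in> {s..t}" "x r \<in> fst c" for r
    proof -
      have "r \<in> I" using r st by auto
      obtain y'' where "(?y' has_vector_derivative y'') (at r)"
        "\<forall>\<^sub>F s in nhds r. ((\<lambda>s. snd c (x s)) has_vector_derivative ?y' s) (at s) \<and>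
          (u has_vector_derivative u' s) (at s) \<and> (v has_vector_derivative v' s) (at s)"
        by (rule geodesic_components[OF c geodesic_at_slab[OF \<open>r \<in> I\<close> c r(2)]]) blast
      then show ?thesis using has_vector_derivative_continuous eventually_nhds_x_imp_x by blast
    qed
    show "\<exists>x'. continuous_on {r \<in> {s..t}. x r \<in> fst c} x' \<and> (\<forall>r\<in>{s..t}. x r \<in> fst c \<longrightarrow>
        ((snd c \<circ> x) has_vector_derivative x' r) (at r within {s..t}))"
    proof (intro exI conjI ballI impI)
      show "continuous_on {r \<in> {s..t}. x r \<in> fst c} ?y'"
        using * by (intro continuous_at_imp_continuous_on ballI) blast
      show "((snd c \<circ> x) has_vector_derivative ?y' r) (at r within {s..t})" if "r \<in> {s..t}" "x r \<in> fst c" for r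
        unfolding o_def using *[OF that] has_vector_derivative_at_within by blast
    qed
  qed
  from M0.pw_length_C1[OF this st(1)] obtain L where L: "M0.pw_length x s t L" by blast
  have "((\<lambda>t. sqrt (energy t)) has_integral L) {s..t}"
    using M0.pw_length_has_integral[OF L] unfolding energy_def tnorm_def .
  then have "L = integral {s..t} (\<lambda>t. sqrt (energy t))" by (simp add: integral_unique)
  then show ?thesis
    using M0.riem_dist_le_joined[OF connected_base] L unfolding M0.joined_def by blast
qed

text \<open>Gronwall's inequality for the square of the speed plus the square of an upper bound for the
  distance to the base point of the growth condition.\<close>

lemma energy_bounded:
  assumes growth: "gradient_grows_at_most_linearly A g\<^sub>0 H"
    and t0: "t0 < b" "{t0..<b} \<subseteq> I"
  obtains t1 K where "t0 < t1" "t1 < b" "\<And>t. t \<in> {t1..<b} \<Longrightarrow> energy t \<le> K"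
proof -
  obtain k m where u': "\<And>t. t \<in> I \<Longrightarrow> u' t = k" and u: "\<And>t. t \<in> I \<Longrightarrow> u t = m + k * t"
    by (rule u_affine) blast
  \<comment> \<open>As \<open>u\<close> is affine, this bounds it on the whole interval; the summand
    1 provides the positive \<open>T\<close> that the growth condition asks for.\<close>
  define T where "T = \<bar>m\<bar> + \<bar>k\<bar> * (\<bar>t0\<bar> + \<bar>b\<bar>) + 1"
  have T: "T > 0" unfolding T_def by (simp add: add_nonneg_pos)
  have uT: "u t \<in> {-T..T}" if t: "t \<in> {t0..<b}" for t
  proof -
    have "\<bar>k * t\<bar> \<le> \<bar>k\<bar> * (\<bar>t0\<bar> + \<bar>b\<bar>)"
      unfolding abs_mult by (rule mult_left_mono) (use t in auto)
    then show ?thesis using u[of t] t t0(2) unfolding T_def by auto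
  qed
  from growth[unfolded gradient_grows_at_most_linearly_def, rule_format, OF T]
  obtain x0 a C where aC: "a > 0" "C > 0"
    and "\<forall>p. \<forall>r\<in>{-T..T}. tnorm g\<^sub>0 p (gradient A g\<^sub>0 (\<lambda>q. H q r) p) \<le> a * riem_dist A g\<^sub>0 p x0 + C"
    by (elim exE conjE)
  then have gr: "tnorm g\<^sub>0 p (gradient A g\<^sub>0 (\<lambda>q. H q r) p) \<le> a * riem_dist A g\<^sub>0 p x0 + C" if "r \<in> {-T..T}" for p r
    using that by blast
  define N where "N t = sqrt (energy t)" for t
  have Ncont: "continuous_on {t0..t} N" if "t < b" for t
    unfolding N_def by (rule continuous_on_subset[OF continuous_on_speed_base]) (use that t0 in auto)
  \<comment> \<open>The distance to \<open>x0\<close> need not be differentiable in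
    \<open>t\<close>; this majorant from the triangle inequality is, with derivative equal to the
    speed.\<close>
  define D where "D t = riem_dist A g\<^sub>0 (x t0) x0 + integral {t0..t} N" for t
  have dD: "riem_dist A g\<^sub>0 (x t) x0 \<le> D t" if t: "t \<in> {t0<..<b}" for t
  proof -
    have "{t0..t} \<subseteq> I" using t t0 by auto
    then have "riem_dist A g\<^sub>0 (x t0) (x t) \<le> integral {t0..t} N"
      unfolding N_def using t by (intro riem_dist_le_integral_speed) auto
    then show ?thesis
      unfolding D_def using M0.riem_dist_triangle[OF connected_base, of "x t" x0 "x t0"]
        M0.riem_dist_commute[OF connected_base, of "x t" "x t0"] by linarith
  qed
  have DN: "(D has_real_derivative N t) (at t)" if t: "t \<in> {t0<..<b}" for t
  proof -
    obtain t' where t': "t < t'" "t' < b" using dense[of t b] t by auto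
    have "((\<lambda>t. integral {t0..t} N) has_vector_derivative N t) (at t within {t0..t'})"
      by (rule integral_has_vector_derivative[OF Ncont[OF t'(2)]]) (use t t' in auto)
    then have "((\<lambda>t. integral {t0..t} N) has_real_derivative N t) (at t)"
      using t t' by (simp add: at_within_Icc_at has_real_derivative_iff_has_vector_derivative)
    then show ?thesis unfolding D_def by (auto intro!: derivative_eq_intros)
  qed
  \<comment> \<open>The summand 1 in \<open>Q\<close> lets the linear term \<open>2 * N t\<close> be
    absorbed. In \<open>M\<close> the first summand pays for the derivative of the energy, and the 2
    more than covers the derivative \<open>2 * D t * N t\<close> of the square of \<open>D\<close>,
    which is at most \<open>Q t\<close>.\<close>
  define M where "M = k\<^sup>2 * (a + C) + 2"
  define Q where "Q t = energy t + (D t)\<^sup>2 + 1" for t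
  have Q': "\<exists>q. (Q has_real_derivative q) (at t) \<and> q \<le> M * Q t" if t: "t \<in> {t0<..<b}" for t
  proof -
    have tI: "t \<in> I" and t0b: "t \<in> {t0..<b}" using t t0 by auto
    obtain e where e: "(energy has_real_derivative e) (at t)"
      "e \<le> (u' t)\<^sup>2 * tnorm g\<^sub>0 (x t) (gradient A g\<^sub>0 (\<lambda>p. H p (u t)) (x t)) * N t"
      unfolding N_def by (rule energy_derivative[OF tI])
    have N: "N t \<ge> 0" "(N t)\<^sup>2 = energy t" unfolding N_def using energy_nonneg[OF tI] by auto
    have "tnorm g\<^sub>0 (x t) (gradient A g\<^sub>0 (\<lambda>p. H p (u t)) (x t)) \<le> a * D t + C"
      using gr[OF uT[OF t0b], of "x t"] mult_left_mono[OF dD[OF t], of a] aC by linarith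
    then have "(u' t)\<^sup>2 * tnorm g\<^sub>0 (x t) (gradient A g\<^sub>0 (\<lambda>p. H p (u t)) (x t)) * N t \<le> k\<^sup>2 * (a * D t + C) * N t"
      unfolding u'[OF tI] using N(1) by (intro mult_right_mono mult_left_mono) auto
    then have e2: "e \<le> k\<^sup>2 * (a * (D t * N t) + C * N t)" using e(2) by (simp add: algebra_simps)
    have DN1: "2 * (D t * N t) \<le> Q t" and N1: "2 * N t \<le> Q t" "Q t \<ge> 0"
      using sum_squares_bound[of "D t" "N t"] sum_squares_bound[of "N t" 1] N(2) energy_nonneg[OF tI]
        zero_le_power2[of "D t"] unfolding Q_def power_one mult_1_right by linarith+
    have "a * (D t * N t) + C * N t \<le> (a + C) * Q t"
    proof -
      have "D t * N t \<le> Q t" "N t \<le> Q t" using DN1 N1 by linarith+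
      then have "a * (D t * N t) \<le> a * Q t" "C * N t \<le> C * Q t" using aC by (auto intro: mult_left_mono)
      then show ?thesis by (simp add: distrib_right)
    qed
    then have "k\<^sup>2 * (a * (D t * N t) + C * N t) \<le> k\<^sup>2 * ((a + C) * Q t)" by (rule mult_left_mono) simp
    moreover have "(Q has_real_derivative (e + 2 * D t * N t)) (at t)"
      unfolding Q_def using e(1) DN[OF t] by (auto intro!: derivative_eq_intros)
    ultimately show ?thesis
      using e2 DN1 N1 unfolding M_def by (intro exI[of _ "e + 2 * D t * N t"]) (simp add: algebra_simps)
  qed
  \<comment> \<open>The derivative of \<open>D\<close> was established on the open interval only, so
    the comparison starts at an interior time.\<close>
  obtain t1 where t1: "t0 < t1" "t1 < b" using dense[OF t0(1)] by blast
  have M: "M \<ge> 0" unfolding M_def using aC by simp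
  have "energy t \<le> Q t1 * exp (M * (b - t1))" if t: "t \<in> {t1..<b}" for t
  proof -
    have "Q t * exp (- M * t) \<le> Q t1 * exp (- M * t1)"
    proof (rule DERIV_nonpos_imp_nonincreasing[where f = "\<lambda>t. Q t * exp (- M * t)"])
      show "t1 \<le> t" using t by simp
      fix r assume r: "t1 \<le> r" "r \<le> t"
      obtain q where q: "(Q has_real_derivative q) (at r)" "q \<le> M * Q r" using Q'[of r] r t t1 by auto
      have "((\<lambda>t. Q t * exp (- M * t)) has_real_derivative (q - M * Q r) * exp (- M * r)) (at r)"
        by (auto intro!: derivative_eq_intros q(1) simp: algebra_simps)
      moreover have "(q - M * Q r) * exp (- M * r) \<le> 0" using q(2) by (simp add: mult_nonpos_nonneg)
      ultimately show "\<exists>d. ((\<lambda>t. Q t * exp (- M * t)) has_real_derivative d) (at r) \<and> d \<le> 0" by blast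
    qed
    then have "Q t * exp (- M * t) * exp (M * t) \<le> Q t1 * exp (- M * t1) * exp (M * t)"
      by (rule mult_right_mono) simp
    then have "Q t \<le> Q t1 * exp (M * (t - t1))" by (simp add: mult.assoc exp_add[symmetric] algebra_simps)
    also have "\<dots> \<le> Q t1 * exp (M * (b - t1))"
    proof (rule mult_left_mono)
      have "t1 \<in> I" using t1 t0(2) by auto
      then show "0 \<le> Q t1" using energy_nonneg[of t1] zero_le_power2[of "D t1"] unfolding Q_def by linarith
    qed (use t M in \<open>auto intro!: mult_left_mono\<close>)
    finally show ?thesis unfolding Q_def[of t] using zero_le_power2[of "D t"] by linarith
  qed
  then show thesis using that t1 by blast
qed

section \<open>Convergence and continuation at a finite end point\<close>

lemma base_converges:
  assumes "gradient_grows_at_most_linearly A g\<^sub>0 H" "Metric_space.mcomplete UNIV (riem_dist A g\<^sub>0)"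
    and t0: "t0 < b" "{t0..<b} \<subseteq> I"
  obtains t1 K p where "t0 < t1" "t1 < b" "\<And>t. t \<in> {t1..<b} \<Longrightarrow> energy t \<le> K" "(x \<longlongrightarrow> p) (at_left b)"
proof -
  obtain t1 K where t1: "t0 < t1" "t1 < b" and K: "\<And>t. t \<in> {t1..<b} \<Longrightarrow> energy t \<le> K"
    by (rule energy_bounded[OF assms(1) t0]) blast
  have "riem_dist A g\<^sub>0 (x s) (x t) \<le> sqrt K * (t - s)" if st: "t1 < s" "s < t" "t < b" for s t
  proof -
    have sub: "{s..t} \<subseteq> I" using st t1 t0 by auto
    have "riem_dist A g\<^sub>0 (x s) (x t) \<le> integral {s..t} (\<lambda>t. sqrt (energy t))"
      by (rule riem_dist_le_integral_speed[OF st(2) sub])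
    also have "\<dots> \<le> norm (integral {s..t} (\<lambda>t. sqrt (energy t)))" by simp
    also have "\<dots> \<le> sqrt K * (t - s)"
    proof (rule integral_bound)
      show "continuous_on {s..t} (\<lambda>t. sqrt (energy t))"
        by (rule continuous_on_subset[OF continuous_on_speed_base sub])
      show "norm (sqrt (energy r)) \<le> sqrt K" if "r \<in> {s..t}" for r
        using K[of r] energy_nonneg[of r] that st sub by auto
    qed (use st in simp)
    finally show ?thesis .
  qed
  then obtain p where "(x \<longlongrightarrow> p) (at_left b)"
    using M0.lipschitz_curve_converges[OF connected_base assms(2) t1(2), of x "sqrt K"] by blast
  then show thesis using that t1 K by blast
qed

text \<open>A chart around the limit \<open>p\<close> confines \<open>x\<close> to a compact
  coordinate ball and \<open>u\<close> to a bounded interval. There the energy controls the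
  coordinate velocity and the derivatives of \<open>H_coord\<close> are bounded. So
  \<open>v''\<close> is bounded, two integrations give the limit of \<open>v\<close>, and all
  hypotheses of \<open>geodesic_extend_right\<close> are available.\<close>

lemma geodesic_extends:
  assumes growth: "gradient_grows_at_most_linearly A g\<^sub>0 H"
    and complete: "Metric_space.mcomplete UNIV (riem_dist A g\<^sub>0)"
    and t0: "t0 < b" "{t0..<b} \<subseteq> I" and b: "\<And>t. t \<in> I \<Longrightarrow> t < b"
  obtains J \<delta> where "geodesic (gpw_atlas A) (gpw_metric A g\<^sub>0 H) J \<delta>" "I \<subset> J" "\<And>t. t \<in> I \<Longrightarrow> \<delta> t = \<gamma> t"
proof -
  obtain t1 K p where t1: "t0 < t1" "t1 < b" and K: "\<And>t. t \<in> {t1..<b} \<Longrightarrow> energy t \<le> K"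
    and p: "(x \<longlongrightarrow> p) (at_left b)"
    by (rule base_converges[OF growth complete t0]) blast
  obtain k m where u': "\<And>t. t \<in> I \<Longrightarrow> u' t = k" and u: "\<And>t. t \<in> I \<Longrightarrow> u t = m + k * t"
    by (rule u_affine) blast
  obtain c where c: "c \<in> A" "p \<in> fst c" by (rule M0.chart_cover)
  let ?y = "\<lambda>t. snd c (x t)" and ?y' = "\<lambda>s. vector_derivative (\<lambda>s. snd c (x s)) (at s)"
  obtain r where r: "r > 0" "cball (snd c p) r \<subseteq> snd c ` fst c"
    using M0.open_image[OF c(1)] c(2) by (meson image_eqI open_contains_cball)
  have evc: "\<forall>\<^sub>F t in at_left b. x t \<in> fst c"
    by (rule topological_tendstoD[OF p M0.open_domain[OF c(1)] c(2)])
  have "(?y \<longlongrightarrow> snd c p) (at_left b)"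
    by (rule continuous_on_tendsto_compose[OF M0.continuous_on_chart[OF c(1)] p c(2) evc])
  then have "\<forall>\<^sub>F t in at_left b. ?y t \<in> ball (snd c p) r"
    by (rule topological_tendstoD) (use r in auto)
  then have "\<forall>\<^sub>F t in at_left b. x t \<in> fst c \<and> ?y t \<in> ball (snd c p) r" using evc by eventually_elim simp
  then obtain a' where a': "a' < b" "\<And>t. a' < t \<Longrightarrow> t < b \<Longrightarrow> x t \<in> fst c \<and> ?y t \<in> ball (snd c p) r"
    unfolding eventually_at_left_field by blast
  define a where "a = max t1 a'"
  have a: "t1 \<le> a" "a < b" "{a<..<b} \<subseteq> I" using t1 t0 a' unfolding a_def by auto
  have dom: "x t \<in> fst c" "?y t \<in> cball (snd c p) r" if "t \<in> {a<..<b}" for t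
    using a'(2)[of t] that unfolding a_def by auto
  obtain \<mu> where \<mu>: "\<mu> > 0" "\<And>y v. y \<in> cball (snd c p) r \<Longrightarrow> \<mu> * norm v \<le> sqrt (M0.G c y v v)"
    by (rule M0.metric_lower_bound[OF c(1) compact_cball r(2)]) blast
  define Ky where "Ky = sqrt K / \<mu>"
  have y'_bound: "norm (?y' t) \<le> Ky" if t: "t \<in> {a<..<b}" for t
  proof -
    have tI: "t \<in> I" using t a by auto
    have "\<mu> * norm (?y' t) \<le> sqrt (energy t)"
      unfolding energy_chart[OF tI c(1) dom(1)[OF t]] by (rule \<mu>(2)[OF dom(2)[OF t]])
    also have "\<dots> \<le> sqrt K" using K[of t] t a by auto
    finally show ?thesis unfolding Ky_def using \<mu>(1) by (simp add: pos_le_divide_eq mult.commute)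
  qed
  define T where "T = \<bar>m\<bar> + \<bar>k\<bar> * (\<bar>t1\<bar> + \<bar>b\<bar>)"
  have uT: "u t \<in> {-T..T}" if t: "t \<in> {a<..<b}" for t
  proof -
    have "\<bar>k * t\<bar> \<le> \<bar>k\<bar> * (\<bar>t1\<bar> + \<bar>b\<bar>)"
      unfolding abs_mult by (rule mult_left_mono) (use t a in auto)
    then show ?thesis using u[of t] t a(3) unfolding T_def by auto
  qed
  have "compact (cball (snd c p) r \<times> {-T..T})" by (intro compact_Times) auto
  then obtain B where B: "B \<ge> 0" "\<And>z d. z \<in> cball (snd c p) r \<times> {-T..T} \<Longrightarrow> norm (fd (H_coord c) z d) \<le> B * norm d"
    by (rule smooth_on_fd_bounded[OF smooth_H_coord[OF c(1)]]) (use r in auto)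
  let ?v'' = "\<lambda>t. (u' t)\<^sup>2 * fd (H_coord c) (?y t, u t) (0, 1) / 2 - u' t * fd (H_coord c) (?y t, u t) (?y' t, u' t)"
  have comp: "(?y has_vector_derivative ?y' t) (at t)" "(u has_vector_derivative u' t) (at t)"
    "(v has_vector_derivative v' t) (at t)" "(v' has_vector_derivative ?v'' t) (at t)" if t: "t \<in> {a<..<b}" for t
  proof -
    have tI: "t \<in> I" using t a by auto
    note gc = geodesic_components[OF c(1) geodesic_at_slab[OF tI c(1) dom(1)[OF t]]]
    show "(v' has_vector_derivative ?v'' t) (at t)" by (rule gc)
    have "(?y has_vector_derivative ?y' t) (at t) \<and> (u has_vector_derivative u' t) (at t) \<and> (v has_vector_derivative v' t) (at t)"
      by (rule gc) (rule eventually_nhds_x_imp_x)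
    then show "(?y has_vector_derivative ?y' t) (at t)" "(u has_vector_derivative u' t) (at t)"
      "(v has_vector_derivative v' t) (at t)" by blast+
  qed
  \<comment> \<open>Both terms of \<open>?v''\<close> are estimated with \<open>u' = k\<close>: the
    increment \<open>(0, 1)\<close> has norm 1, and the increment formed from the velocities has
    norm at most \<open>Ky + \<bar>k\<bar>\<close>.\<close>
  define B2 where "B2 = k\<^sup>2 * B / 2 + \<bar>k\<bar> * (B * (Ky + \<bar>k\<bar>))"
  have v''_bound: "norm (?v'' t) \<le> B2" if t: "t \<in> {a<..<b}" for t
  proof -
    have z: "(?y t, u t) \<in> cball (snd c p) r \<times> {-T..T}" using dom(2)[OF t] uT[OF t] by blast
    have k: "u' t = k" using u' t a(3) by blast
    have "\<bar>fd (H_coord c) (?y t, u t) (0, 1)\<bar> \<le> B" using B(2)[OF z, of "(0, 1)"] by simp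
    then have 1: "\<bar>k\<^sup>2 * fd (H_coord c) (?y t, u t) (0, 1) / 2\<bar> \<le> k\<^sup>2 * B / 2" by (simp add: abs_mult mult_left_mono)
    have "\<bar>fd (H_coord c) (?y t, u t) (?y' t, k)\<bar> \<le> B * norm (?y' t, k)" using B(2)[OF z, of "(?y' t, k)"] by simp
    also have "\<dots> \<le> B * (Ky + \<bar>k\<bar>)"
      using norm_Pair_le[of "?y' t" k] y'_bound[OF t] B(1) by (intro mult_left_mono) auto
    finally have 2: "\<bar>k * fd (H_coord c) (?y t, u t) (?y' t, k)\<bar> \<le> \<bar>k\<bar> * (B * (Ky + \<bar>k\<bar>))"
      by (simp add: abs_mult mult_left_mono)
    show ?thesis unfolding k B2_def real_norm_def using 1 2 by linarith
  qed
  have v'_lip: "B2-lipschitz_on {a<..<b} v'"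
    by (rule lipschitz_of_bounded_vector_derivative[OF a(2) comp(4) v''_bound])
  obtain tm where tm: "tm \<in> {a<..<b}" using dense[OF a(2)] by auto
  \<comment> \<open>The value at one interior time plus the largest variation that the Lipschitz
    constant permits on the interval.\<close>
  define Kv where "Kv = \<bar>v' tm\<bar> + B2 * (b - a)"
  have v'_bound: "norm (v' t) \<le> Kv" if t: "t \<in> {a<..<b}" for t
  proof -
    have "\<bar>v' t - v' tm\<bar> \<le> B2 * \<bar>t - tm\<bar>" using lipschitz_onD[OF v'_lip t tm] by (simp add: dist_real_def)
    also have "\<dots> \<le> B2 * (b - a)"
      using lipschitz_on_nonneg[OF v'_lip] t tm by (intro mult_left_mono) auto
    finally show ?thesis unfolding Kv_def by simp
  qed
  have "Kv-lipschitz_on {a<..<b} v"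
    by (rule lipschitz_of_bounded_vector_derivative[OF a(2) comp(3) v'_bound])
  then obtain vb where vb: "(v \<longlongrightarrow> vb) (at_left b)" using lipschitz_tendsto_at_left[OF _ a(2)] by blast
  have ub: "(u \<longlongrightarrow> m + k * b) (at_left b)"
  proof (rule Lim_transform_eventually)
    show "((\<lambda>t. m + k * t) \<longlongrightarrow> m + k * b) (at_left b)" by (intro tendsto_intros)
    show "\<forall>\<^sub>F t in at_left b. m + k * t = u t"
      using a(2) by (rule eventually_at_leftI[rotated]) (use u a(3) in auto)
  qed
  have lim: "(\<gamma> \<longlongrightarrow> (p, m + k * b, vb)) (at_left b)"
    using tendsto_Pair[OF p tendsto_Pair[OF ub vb]] by simp
  show thesis
  proof (rule M.geodesic_extend_right[OF geo a(2,3) b slab_gpw_atlas[OF c(1)] _ lim])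
    show "(p, m + k * b, vb) \<in> fst (slab c)" using c(2) by (simp add: slab_simps)
    fix t assume t: "t \<in> {a<..<b}"
    show "\<gamma> t \<in> fst (slab c)" using dom(1)[OF t] by (simp add: slab_simps mem_Times_iff)
    have "snd (slab c) \<circ> \<gamma> = (\<lambda>s. (?y s, u s, v s))" by (auto simp: prod_chart_def prod_eq_iff)
    then have "((snd (slab c) \<circ> \<gamma>) has_vector_derivative (?y' t, u' t, v' t)) (at t)"
      using has_vector_derivative_Pair[OF comp(1)[OF t] has_vector_derivative_Pair[OF comp(2)[OF t] comp(3)[OF t]]] by simp
    then have "norm (vector_derivative (snd (slab c) \<circ> \<gamma>) (at t)) = norm (?y' t, u' t, v' t)"
      by (simp add: vector_derivative_at)
    also have "\<dots> \<le> norm (?y' t) + (norm (u' t) + norm (v' t))"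
      using norm_Pair_le[of "?y' t" "(u' t, v' t)"] norm_Pair_le[of "u' t" "v' t"] by linarith
    also have "\<dots> \<le> Ky + (\<bar>k\<bar> + Kv)"
      using y'_bound[OF t] v'_bound[OF t] u'[of t] t a(3) by (intro add_mono) auto
    finally show "norm (vector_derivative (snd (slab c) \<circ> \<gamma>) (at t)) \<le> Ky + (\<bar>k\<bar> + Kv)" .
  qed (assumption | rule that)+
qed

end

text \<open>The end point is the supremum of \<open>I\<close>. It does not belong to
  \<open>I\<close>, which is open, and as \<open>I\<close> is an interval it contains all points
  between any of its members and the supremum.\<close>

lemma geodesic_extends_above:
  assumes growth: "gradient_grows_at_most_linearly A g\<^sub>0 H"
    and complete: "Metric_space.mcomplete UNIV (riem_dist A g\<^sub>0)"
    and geo: "geodesic (gpw_atlas A) (gpw_metric A g\<^sub>0 H) I \<gamma>" and bdd: "bdd_above I"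
  obtains J \<delta> where "geodesic (gpw_atlas A) (gpw_metric A g\<^sub>0 H) J \<delta>" "I \<subset> J" "\<And>t. t \<in> I \<Longrightarrow> \<delta> t = \<gamma> t"
proof -
  have I: "open I" "is_interval I" "I \<noteq> {}" using geo unfolding M.geodesic_iff by auto
  define b where "b = Sup I"
  have le: "t \<le> b" if "t \<in> I" for t unfolding b_def using that bdd by (rule cSup_upper)
  have less: "t < b" if t: "t \<in> I" for t
  proof (rule ccontr)
    assume "\<not> t < b"
    then have "b \<in> I" using le[OF t] t by simp
    then obtain e where "e > 0" "ball b e \<subseteq> I" using I(1) open_contains_ball by blast
    then have "b + e / 2 \<in> I" by (auto simp: dist_real_def subset_iff)
    then show False using le[of "b + e / 2"] \<open>e > 0\<close> by simp
  qed
  obtain t0 where t0: "t0 \<in> I" using I(3) by blast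
  have "{t0..<b} \<subseteq> I"
  proof
    fix t assume t: "t \<in> {t0..<b}"
    then obtain s where "s \<in> I" "t < s" using less_cSup_iff[OF I(3) bdd, of t] unfolding b_def by auto
    then show "t \<in> I" using I(2) t0 t unfolding is_interval_1 by (meson atLeastLessThan_iff less_imp_le)
  qed
  then show thesis
    by (rule geodesic_extends[OF geo growth complete less[OF t0] _ less]) (assumption | rule that)+
qed

text \<open>An interval that misses a point lies on one side of it, so it is bounded above or below.
  In the second case the reversed geodesic is extended and the extension is reversed back.\<close>

lemma geodesic_not_extends_imp_UNIV:
  assumes growth: "gradient_grows_at_most_linearly A g\<^sub>0 H"
    and complete: "Metric_space.mcomplete UNIV (riem_dist A g\<^sub>0)"
    and inext: "inextensible_geodesic (gpw_atlas A) (gpw_metric A g\<^sub>0 H) I \<gamma>"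
  shows "I = UNIV"
proof (rule ccontr)
  assume "I \<noteq> UNIV"
  have geo: "geodesic (gpw_atlas A) (gpw_metric A g\<^sub>0 H) I \<gamma>"
    and max: "\<And>J \<delta>. geodesic (gpw_atlas A) (gpw_metric A g\<^sub>0 H) J \<delta> \<Longrightarrow> I \<subseteq> J \<Longrightarrow> (\<And>t. t \<in> I \<Longrightarrow> \<delta> t = \<gamma> t) \<Longrightarrow> J = I"
    using inext unfolding inextensible_geodesic_def by blast+
  have I: "is_interval I" using geo unfolding M.geodesic_iff by blast
  obtain b where b: "b \<notin> I" using \<open>I \<noteq> UNIV\<close> by blast
  then have "(\<forall>t\<in>I. t \<le> b) \<or> (\<forall>t\<in>I. b \<le> t)" using I unfolding is_interval_1 by (meson nle_le)
  then show False
  proof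
    assume "\<forall>t\<in>I. t \<le> b"
    then have "bdd_above I" by (intro bdd_aboveI) blast
    then obtain J \<delta> where J: "geodesic (gpw_atlas A) (gpw_metric A g\<^sub>0 H) J \<delta>" "I \<subset> J"
      "\<And>t. t \<in> I \<Longrightarrow> \<delta> t = \<gamma> t"
      by (rule geodesic_extends_above[OF growth complete geo]) (rule that)
    then show False using max[OF J(1) _ J(3)] by blast
  next
    assume "\<forall>t\<in>I. b \<le> t"
    then have "bdd_above (uminus ` I)" by (intro bdd_aboveI[of _ "- b"]) auto
    then obtain J \<delta> where J: "geodesic (gpw_atlas A) (gpw_metric A g\<^sub>0 H) J \<delta>" "uminus ` I \<subset> J"
      "\<And>t. t \<in> uminus ` I \<Longrightarrow> \<delta> t = \<gamma> (- t)"
      by (rule geodesic_extends_above[OF growth complete M.geodesic_reverse[OF geo]]) (rule that)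
    have "geodesic (gpw_atlas A) (gpw_metric A g\<^sub>0 H) (uminus ` J) (\<lambda>t. \<delta> (- t))"
      by (rule M.geodesic_reverse[OF J(1)])
    moreover have "I \<subseteq> uminus ` J" using J(2) by (force simp: image_iff)
    moreover have "\<delta> (- t) = \<gamma> t" if "t \<in> I" for t using J(3)[of "- t"] that by simp
    ultimately have "uminus ` J = I" by (rule max)
    then have "J = uminus ` I" by (auto simp: image_image)
    then show False using J(2) by blast
  qed
qed

end

theorem corollary3p4:
  fixes A :: "('a::{t2_space, second_countable_topology}, 'e::euclidean_space) chart set"
    and g\<^sub>0 :: "'a tensor2"
    and H :: "'a \<Rightarrow> real \<Rightarrow> real"
  assumes "generalized_plane_wave A g\<^sub>0 H"
    and "complete_riemannian_manifold A g\<^sub>0"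
    and "gradient_grows_at_most_linearly A g\<^sub>0 H"
  shows "geodesically_complete (gpw_atlas A) (gpw_metric A g\<^sub>0 H)"
proof -
  interpret gpw A g\<^sub>0 H by unfold_locales (rule assms(1))
  show ?thesis
    unfolding geodesically_complete_def
    using geodesic_not_extends_imp_UNIV[OF assms(3)] assms(2)
    unfolding complete_riemannian_manifold_def by blast
qed

end
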